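(* Let $\mathbb{K}$ be an algebraically closed field of arbitrary characteristic, let $n\ge 1$, and let $S=\mathbb{K}[x_0,\dots,x_n]$ with the standard grading. Let $f_0,\dots,f_n\in S$ be homogeneous polynomials of degrees $d_0,\dots,d_n$ such that $f_1,\dots,f_n$ is a regular sequence in $S$. Put $I=(f_0,\dots,f_n)$ and $R=S/I$, and assume $\dim \operatorname{Proj} R=0$. Let $J=(f_1,\dots,f_n)$ and $T=S/J$, let $I^s$ be the saturation of $I$, let $H$ be the image of $I^s$ in $T$, let $K=(0:_T H)$, and let $B=T/K$. Set $\tau=\sum_{i=1}^n d_i-n-1$ and let $\Omega_T\cong T[\tau]$ be the dualizing module of $T$. Then there is a short exact sequence of graded $T$-modules $$0\longrightarrow B[\tau-d_0]\longrightarrow \operatorname{Hom}_T(B,\Omega_T)\longrightarrow H^0_{T_+}(R)[\tau]\longrightarrow 0.$$ Moreover, the local cohomology module $H^0_{T_+}(R)$ is self-dual: there is an isomorphism of graded modules $$\bigl(H^0_{T_+}(R)[\tau+d_0]\bigr)^{\vee}\cong H^0_{T_+}(R).$$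
   Context: For a graded module $M$ and an integer $a$, $M[a]$ denotes the shifted module with $M[a]_k=M_{a+k}$. $S_+=(x_0,\dots,x_n)$ and $T_+$ denote the irrelevant maximal ideals of $S$ and $T$. The saturation of $I$ is $I^s=\bigcup_{i\ge 1}(I:S_+^i)$. The module $R=S/I$ is regarded as a graded $T$-module via the surjection $T=S/J\to S/I$. $H^0_{T_+}(R)$ is the $0$-th local cohomology, i.e. the graded submodule of elements of $R$ annihilated by some power of $T_+$. $(0:_T H)$ is the annihilator of $H$ in $T$. $\operatorname{Hom}_T(B,\Omega_T)$ is the graded Hom module. The Matlis dual of a finitely generated graded module $M$ is $M^{\vee}=\bigoplus_k (M^\vee)_k$ with $(M^{\vee})_k=\operatorname{Hom}_{\mathbb{K}}(M_{-k},\mathbb{K})$. Since $T$ is a one-dimensional graded complete intersection, its (graded) dualizing module is $\Omega_T\cong T[\tau]$. *)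

theory Defs
  imports
    "HOL-Algebra.QuotRing"
    "HOL-Algebra.Ideal_Product"
    "HOL-Algebra.Module"
    "HOL-Library.Poly_Mapping"
    "HOL-Library.Extended_Real"
    "HOL-Analysis.Function_Topology"
    "HOL-Computational_Algebra.Polynomial"
begin

section \<open>Graded rings and graded modules\<close>

text \<open>Gradings are internal and indexed by all integers: the field \<open>rcomp\<close> (of a ring)
  or \<open>gcomp\<close> (of a module) gives the homogeneous components as subsets of the carrier.
  Modules inherit from \<^typ>\<open>('a, 'm) module\<close> the fields \<open>mult\<close> and \<open>one\<close>,
  which carry no meaning for a module.\<close>

record 'a graded_ring = "'a ring" +
  rcomp :: "int \<Rightarrow> 'a set"

record ('a, 'm) graded_module = "('a, 'm) module" +
  gcomp :: "int \<Rightarrow> 'm set"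

text \<open>The additive group of \<open>G\<close> is the internal direct sum of the subgroups \<open>gr k\<close>.\<close>

definition direct_sum_decomposition :: "('m, 'x) ring_scheme \<Rightarrow> (int \<Rightarrow> 'm set) \<Rightarrow> bool" where
  "direct_sum_decomposition G gr \<longleftrightarrow>
     (\<forall>k. additive_subgroup (gr k) G) \<and>
     (\<forall>x\<in>carrier G. \<exists>!c. (\<forall>k. c k \<in> gr k) \<and> finite {k. c k \<noteq> \<zero>\<^bsub>G\<^esub>} \<and>
        x = finsum G c {k. c k \<noteq> \<zero>\<^bsub>G\<^esub>})"

definition is_graded_ring :: "('a, 'x) graded_ring_scheme \<Rightarrow> bool" where
  "is_graded_ring A \<longleftrightarrow>
     cring A \<and> direct_sum_decomposition A (rcomp A) \<and> \<one>\<^bsub>A\<^esub> \<in> rcomp A 0 \<and>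
     (\<forall>i j. \<forall>a\<in>rcomp A i. \<forall>b\<in>rcomp A j. a \<otimes>\<^bsub>A\<^esub> b \<in> rcomp A (i + j))"

definition is_graded_module ::
  "('a, 'x) graded_ring_scheme \<Rightarrow> ('a, 'm, 'y) graded_module_scheme \<Rightarrow> bool" where
  "is_graded_module A M \<longleftrightarrow>
     is_graded_ring A \<and> Module.module A M \<and> direct_sum_decomposition M (gcomp M) \<and>
     (\<forall>i j. \<forall>a\<in>rcomp A i. \<forall>x\<in>gcomp M j. a \<odot>\<^bsub>M\<^esub> x \<in> gcomp M (i + j))"

definition shift :: "('a, 'm) graded_module \<Rightarrow> int \<Rightarrow> ('a, 'm) graded_module" where
  "shift M a = M\<lparr>gcomp := \<lambda>k. gcomp M (a + k)\<rparr>"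

text \<open>The quotient \<open>A / I\<close>, graded by the images of the components of \<open>A\<close>.\<close>

definition graded_quotient :: "('a, 'x) graded_ring_scheme \<Rightarrow> 'a set \<Rightarrow> 'a set graded_ring" where
  "graded_quotient A I =
     \<lparr>carrier = carrier (A Quot I), monoid.mult = monoid.mult (A Quot I), one = one (A Quot I),
      zero = zero (A Quot I), add = add (A Quot I),
      rcomp = (\<lambda>k. (\<lambda>a. I +>\<^bsub>A\<^esub> a) ` rcomp A k)\<rparr>"

text \<open>The graded ring \<open>A\<close>, viewed as a module along a degree-preserving ring homomorphism \<open>h\<close>
  into \<open>A\<close>.\<close>

definition ring_as_module :: "('a \<Rightarrow> 'b) \<Rightarrow> 'b graded_ring \<Rightarrow> ('a, 'b) graded_module" where
  "ring_as_module h A =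
     \<lparr>carrier = carrier A, monoid.mult = monoid.mult A, one = one A, zero = zero A, add = add A,
      module.smult = (\<lambda>a x. h a \<otimes>\<^bsub>A\<^esub> x), gcomp = rcomp A\<rparr>"

definition module_homs ::
  "('a, 'x) ring_scheme \<Rightarrow> ('a, 'm, 'y) module_scheme \<Rightarrow> ('a, 'p, 'z) module_scheme
     \<Rightarrow> ('m \<Rightarrow> 'p) set" where
  "module_homs A M N =
     {\<phi> \<in> carrier M \<rightarrow> carrier N.
        (\<forall>x\<in>carrier M. \<forall>y\<in>carrier M. \<phi> (x \<oplus>\<^bsub>M\<^esub> y) = \<phi> x \<oplus>\<^bsub>N\<^esub> \<phi> y) \<and>
        (\<forall>a\<in>carrier A. \<forall>x\<in>carrier M. \<phi> (a \<odot>\<^bsub>M\<^esub> x) = a \<odot>\<^bsub>N\<^esub> \<phi> x)}"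

definition graded_hom ::
  "('a, 'x) graded_ring_scheme \<Rightarrow> ('a, 'm) graded_module \<Rightarrow> ('a, 'p) graded_module
     \<Rightarrow> ('m \<Rightarrow> 'p) \<Rightarrow> bool" where
  "graded_hom A M N \<phi> \<longleftrightarrow>
     is_graded_module A M \<and> is_graded_module A N \<and> \<phi> \<in> module_homs A M N \<and>
     (\<forall>k. \<phi> ` gcomp M k \<subseteq> gcomp N k)"

definition graded_isomorphic ::
  "('a, 'x) graded_ring_scheme \<Rightarrow> ('a, 'm) graded_module \<Rightarrow> ('a, 'p) graded_module \<Rightarrow> bool" where
  "graded_isomorphic A M N \<longleftrightarrow>
     (\<exists>\<phi>. graded_hom A M N \<phi> \<and> bij_betw \<phi> (carrier M) (carrier N))"

text \<open>\<open>0 \<rightarrow> M \<rightarrow> N \<rightarrow> P \<rightarrow> 0\<close>\<close>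

definition graded_short_exact ::
  "('a, 'x) graded_ring_scheme \<Rightarrow> ('a, 'm) graded_module \<Rightarrow> ('a, 'p) graded_module
     \<Rightarrow> ('a, 'q) graded_module \<Rightarrow> ('m \<Rightarrow> 'p) \<Rightarrow> ('p \<Rightarrow> 'q) \<Rightarrow> bool" where
  "graded_short_exact A M N P \<phi> \<psi> \<longleftrightarrow>
     graded_hom A M N \<phi> \<and> graded_hom A N P \<psi> \<and>
     inj_on \<phi> (carrier M) \<and>
     \<phi> ` carrier M = {y \<in> carrier N. \<psi> y = \<zero>\<^bsub>P\<^esub>} \<and>
     \<psi> ` carrier N = carrier P"

text \<open>The graded Hom module: its component of degree \<open>k\<close> consists of the homomorphisms
  raising degrees by \<open>k\<close>, and its elements are the finite sums of such homomorphisms.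
  Functions are made \<open>undefined\<close> outside the carrier so that equality is the right one.\<close>

definition Hom_comp ::
  "('a, 'x) ring_scheme \<Rightarrow> ('a, 'm) graded_module \<Rightarrow> ('a, 'p) graded_module
     \<Rightarrow> int \<Rightarrow> ('m \<Rightarrow> 'p) set" where
  "Hom_comp A M N k =
     {\<phi> \<in> module_homs A M N \<inter> extensional (carrier M).
        \<forall>i. \<phi> ` gcomp M i \<subseteq> gcomp N (i + k)}"

definition graded_Hom ::
  "('a, 'x) ring_scheme \<Rightarrow> ('a, 'm) graded_module \<Rightarrow> ('a, 'p) graded_module
     \<Rightarrow> ('a, 'm \<Rightarrow> 'p) graded_module" where
  "graded_Hom A M N =
     \<lparr>carrier =
        {\<phi> \<in> module_homs A M N \<inter> extensional (carrier M).
           \<exists>F c. finite F \<and> (\<forall>k\<in>F. c k \<in> Hom_comp A M N k) \<and>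
             (\<forall>x\<in>carrier M. \<phi> x = finsum N (\<lambda>k. c k x) F)},
      monoid.mult = undefined, one = undefined,
      zero = (\<lambda>x\<in>carrier M. \<zero>\<^bsub>N\<^esub>),
      add = (\<lambda>\<phi> \<psi>. \<lambda>x\<in>carrier M. \<phi> x \<oplus>\<^bsub>N\<^esub> \<psi> x),
      module.smult = (\<lambda>a \<phi>. \<lambda>x\<in>carrier M. a \<odot>\<^bsub>N\<^esub> \<phi> x),
      gcomp = Hom_comp A M N\<rparr>"

text \<open>The Matlis dual of \<open>M\<close>, which is a \<open>K\<close>-vector space via \<open>\<iota> : K \<rightarrow> A\<close>.
  A functional on the single component \<open>M\<^bsub>-k\<^esub>\<close> is encoded as a functional on \<open>M\<close>
  vanishing on all other components, so that the direct sum over \<open>k\<close> becomes the set of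
  functionals vanishing on all but finitely many components.\<close>

definition matlis_dual ::
  "('k::field \<Rightarrow> 'a) \<Rightarrow> ('a, 'm) graded_module \<Rightarrow> ('a, 'm \<Rightarrow> 'k) graded_module" where
  "matlis_dual \<iota> M =
     (let D = {\<phi> \<in> extensional (carrier M).
          (\<forall>x\<in>carrier M. \<forall>y\<in>carrier M. \<phi> (x \<oplus>\<^bsub>M\<^esub> y) = \<phi> x + \<phi> y) \<and>
          (\<forall>c. \<forall>x\<in>carrier M. \<phi> (\<iota> c \<odot>\<^bsub>M\<^esub> x) = c * \<phi> x) \<and>
          finite {k. \<exists>x\<in>gcomp M k. \<phi> x \<noteq> 0}}
      in \<lparr>carrier = D,
          monoid.mult = undefined, one = undefined,
          zero = (\<lambda>x\<in>carrier M. 0),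
          add = (\<lambda>\<phi> \<psi>. \<lambda>x\<in>carrier M. \<phi> x + \<psi> x),
          module.smult = (\<lambda>a \<phi>. \<lambda>x\<in>carrier M. \<phi> (a \<odot>\<^bsub>M\<^esub> x)),
          gcomp = (\<lambda>k. {\<phi> \<in> D. \<forall>j. j \<noteq> - k \<longrightarrow> (\<forall>x\<in>gcomp M j. \<phi> x = 0)})\<rparr>)"


section \<open>Ideals\<close>

primrec ideal_power :: "('a, 'x) ring_scheme \<Rightarrow> 'a set \<Rightarrow> nat \<Rightarrow> 'a set" where
  "ideal_power A I 0 = carrier A"
| "ideal_power A I (Suc k) = ideal_prod A I (ideal_power A I k)"

definition colon :: "('a, 'x) ring_scheme \<Rightarrow> 'a set \<Rightarrow> 'a set \<Rightarrow> 'a set" where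
  "colon A I L = {a \<in> carrier A. \<forall>b\<in>L. a \<otimes>\<^bsub>A\<^esub> b \<in> I}"

definition saturation :: "('a, 'x) ring_scheme \<Rightarrow> 'a set \<Rightarrow> 'a set \<Rightarrow> 'a set" where
  "saturation A m I = (\<Union>i\<in>{1..}. colon A I (ideal_power A m i))"

definition ann :: "('a, 'x) ring_scheme \<Rightarrow> 'a set \<Rightarrow> 'a set" where
  "ann A H = {a \<in> carrier A. \<forall>h\<in>H. a \<otimes>\<^bsub>A\<^esub> h = \<zero>\<^bsub>A\<^esub>}"

definition irrelevant_ideal :: "('a, 'x) graded_ring_scheme \<Rightarrow> 'a set" where
  "irrelevant_ideal A = Idl\<^bsub>A\<^esub> (\<Union>k\<in>{0<..}. rcomp A k)"

definition homogeneous_ideal :: "('a, 'x) graded_ring_scheme \<Rightarrow> 'a set \<Rightarrow> bool" where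
  "homogeneous_ideal A I \<longleftrightarrow> ideal I A \<and> I = Idl\<^bsub>A\<^esub> (I \<inter> (\<Union>k. rcomp A k))"

definition regular_sequence :: "('a, 'x) ring_scheme \<Rightarrow> 'a list \<Rightarrow> bool" where
  "regular_sequence A as \<longleftrightarrow>
     set as \<subseteq> carrier A \<and>
     (\<forall>i<length as. \<forall>a\<in>carrier A.
        (as ! i) \<otimes>\<^bsub>A\<^esub> a \<in> Idl\<^bsub>A\<^esub> (set (take i as)) \<longrightarrow> a \<in> Idl\<^bsub>A\<^esub> (set (take i as))) \<and>
     Idl\<^bsub>A\<^esub> (set as) \<noteq> carrier A"

text \<open>\<open>H\<^sup>0\<^sub>m(M)\<close>: the submodule of the elements annihilated by some power of \<open>m\<close>.\<close>

definition local_cohomology_0 ::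
  "('a, 'x) ring_scheme \<Rightarrow> 'a set \<Rightarrow> ('a, 'm) graded_module \<Rightarrow> ('a, 'm) graded_module" where
  "local_cohomology_0 A m M =
     (let \<Gamma> = {x \<in> carrier M. \<exists>i. \<forall>a\<in>ideal_power A m i. a \<odot>\<^bsub>M\<^esub> x = \<zero>\<^bsub>M\<^esub>}
      in M\<lparr>carrier := \<Gamma>, gcomp := \<lambda>k. gcomp M k \<inter> \<Gamma>\<rparr>)"


section \<open>Proj and its dimension\<close>

definition Proj :: "('a, 'x) graded_ring_scheme \<Rightarrow> 'a set set" where
  "Proj A = {P. primeideal P A \<and> homogeneous_ideal A P \<and> \<not> irrelevant_ideal A \<subseteq> P}"

definition Proj_topology :: "('a, 'x) graded_ring_scheme \<Rightarrow> 'a set topology" where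
  "Proj_topology A =
     topology_generated_by {{P \<in> Proj A. a \<notin> P} | a k. 0 < k \<and> a \<in> rcomp A k}"

definition irreducible_closed :: "'p topology \<Rightarrow> 'p set \<Rightarrow> bool" where
  "irreducible_closed X Z \<longleftrightarrow>
     closedin X Z \<and> Z \<noteq> {} \<and>
     (\<forall>U V. closedin X U \<and> closedin X V \<and> Z \<subseteq> U \<union> V \<longrightarrow> Z \<subseteq> U \<or> Z \<subseteq> V)"

text \<open>The dimension of the empty space is \<open>-\<infinity>\<close>; in particular, dimension \<open>0\<close>
  implies nonemptiness.\<close>

definition krull_dim :: "'p topology \<Rightarrow> ereal" where
  "krull_dim X =
     (SUP k\<in>{k. \<exists>Z. (\<forall>i\<le>k. irreducible_closed X (Z i)) \<and> (\<forall>i<k. Z i \<subset> Z (Suc i))}.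
        ereal (real k))"


section \<open>The polynomial ring\<close>

type_synonym 'k mpoly = "(nat \<Rightarrow>\<^sub>0 nat) \<Rightarrow>\<^sub>0 'k"

definition mon_degree :: "(nat \<Rightarrow>\<^sub>0 nat) \<Rightarrow> nat" where
  "mon_degree m = (\<Sum>i\<in>Poly_Mapping.keys m. Poly_Mapping.lookup m i)"

definition Const :: "'k::field \<Rightarrow> 'k mpoly" where
  "Const c = Poly_Mapping.single 0 c"

definition Var :: "nat \<Rightarrow> 'k::field mpoly" where
  "Var i = Poly_Mapping.single (Poly_Mapping.single i 1) 1"

text \<open>\<open>K[x\<^sub>0,\<dots>,x\<^sub>n]\<close> with the standard grading\<close>

definition poly_ring :: "nat \<Rightarrow> 'k::field mpoly graded_ring" where
  "poly_ring n =
     (let C = {p. \<forall>m\<in>Poly_Mapping.keys p. Poly_Mapping.keys m \<subseteq> {0..n}}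
      in \<lparr>carrier = C, monoid.mult = (*), one = 1, zero = 0, add = (+),
          rcomp = (\<lambda>k. {p \<in> C. \<forall>m\<in>Poly_Mapping.keys p. int (mon_degree m) = k})\<rparr>)"

end

theory Submission
  imports Defs
begin

text \<open>
Let \<open>J = (f\<^sub>1,\<dots>,f\<^sub>n)\<close>, \<open>I = J + (f\<^sub>0)\<close> and \<open>d\<^sub>0\<close> the degree of \<open>f\<^sub>0\<close>. Two ideals of \<open>S\<close> control
everything: \<open>A = J : f\<^sub>0\<close> and \<open>L = J : A\<close>. Once \<open>L\<close> is known to be the saturation of \<open>I\<close>, the module
\<open>H\<^sup>0(R)\<close> is \<open>L/I\<close>, the annihilator of \<open>H = L/J\<close> is \<open>A/J\<close>, so \<open>B = S/A\<close>, and evaluation at \<open>1\<close>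
identifies \<open>Hom\<^sub>T(B, T[\<tau>])\<close> with \<open>(L/J)[\<tau>]\<close>. The short exact sequence is then
\<open>0 \<rightarrow> S/A \<rightarrow> L/J \<rightarrow> L/I \<rightarrow> 0\<close> with first map multiplication by \<open>f\<^sub>0\<close>.

Saturation and self-duality both come from one trace. Choose a linear form \<open>l\<close> that is a
nonzerodivisor on \<open>S/J\<close>. For \<open>M \<ge> 1\<close> the ring \<open>S/(J + (l\<^sup>M))\<close> is an artinian complete
intersection, so its socle is one-dimensional, in degree \<open>\<tau> + M\<close>; a functional \<open>tr\<close> on that degree
that is nonzero on the socle makes \<open>(v, w) \<mapsto> tr(v w)\<close> nondegenerate. A functional on the forms of
degree \<open>j < M\<close> that kills \<open>I\<close> is therefore \<open>v \<mapsto> tr(v b)\<close>, and nondegeneracy forces \<open>f\<^sub>0 b\<close> into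
\<open>J + (l\<^sup>M)\<close> (\<open>represented_by_linkage\<close>). In degrees \<open>j > \<tau> + d\<^sub>0\<close> this puts \<open>b\<close> into \<open>A\<close>, hence \<open>L\<close> and
\<open>I\<close> agree there (\<open>L_high_degree\<close>), which gives the saturation. In general \<open>f\<^sub>0 b = l\<^sup>M h\<close> modulo \<open>J\<close> with
\<open>h \<in> L\<close>. So the pairing \<open>\<langle>p, q\<rangle> = tr(a q)\<close> on \<open>L\<close>, where \<open>l\<^sup>M p = f\<^sub>0 a\<close> modulo \<open>J\<close>, represents every
functional on \<open>L/I\<close>; it is symmetric, vanishes on \<open>I\<close> and pairs degree \<open>i\<close> with degree
\<open>\<tau> + d\<^sub>0 - i\<close>, and this is the self-duality of \<open>L/I\<close>.

The socle is computed by exchanging one element of a regular sequence at a time: if \<open>f\<close> and \<open>g\<close> are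
nonzerodivisors modulo \<open>Q\<close>, then \<open>g w = f w'\<close> modulo \<open>Q\<close> matches the socle of \<open>S/(Q + (f))\<close> with the
socle of \<open>S/(Q + (g))\<close>. General linear forms, which exist because the field is infinite and \<open>S\<close> is
noetherian, lead in this way from any homogeneous regular sequence to a sequence of variables
(\<open>socle_type_regular_sequences\<close>). The same argument for the \<open>n\<close> forms \<open>f\<^sub>1,\<dots>,f\<^sub>n\<close> shows that \<open>S/J\<close> has
no socle, which is what provides \<open>l\<close>.

All of this is polynomial arithmetic with homogeneous ideals. The graded \<open>T\<close>-modules of the theorem
are subquotients \<open>X/Y\<close> of \<open>S\<close>, and \<open>presents\<close> records such a description of a module; its graded
module structure, and homomorphisms out of it, are then read off from \<open>X\<close> and \<open>Y\<close>.
\<close>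

section \<open>Polynomials and their homogeneous components\<close>

abbreviation (input) "lookup \<equiv> Poly_Mapping.lookup"
abbreviation (input) "keys \<equiv> Poly_Mapping.keys"
abbreviation (input) "single \<equiv> Poly_Mapping.single"

definition polys :: "nat \<Rightarrow> 'k::field mpoly set" where
  "polys n = {p. \<forall>m\<in>keys p. keys m \<subseteq> {0..n}}"

text \<open>Degrees are integers, so that shifts need no case distinction; there are no nonzero forms of negative degree.\<close>

definition forms :: "nat \<Rightarrow> int \<Rightarrow> 'k::field mpoly set" where
  "forms n k = {p \<in> polys n. \<forall>m\<in>keys p. int (mon_degree m) = k}"

definition hcomp :: "int \<Rightarrow> 'k::field mpoly \<Rightarrow> 'k mpoly" where
  "hcomp k p = (\<Sum>m\<in>{m \<in> keys p. int (mon_degree m) = k}. single m (lookup p m))"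

lemma lookup_hcomp: "lookup (hcomp k p) m = (if int (mon_degree m) = k then lookup p m else 0)"
proof -
  have "lookup (hcomp k p) m = (\<Sum>x\<in>{m \<in> keys p. int (mon_degree m) = k}. if x = m then lookup p m else 0)"
    unfolding hcomp_def lookup_sum by (rule sum.cong) (auto simp: lookup_single)
  also have "\<dots> = (if int (mon_degree m) = k then lookup p m else 0)"
    by (subst sum.delta) (auto simp: in_keys_iff)
  finally show ?thesis .
qed

lemma hcomp_add: "hcomp k (p + q) = hcomp k p + hcomp k q"
  by (rule poly_mapping_eqI) (simp add: lookup_hcomp lookup_add)

lemma hcomp_zero [simp]: "hcomp k 0 = 0"
  by (rule poly_mapping_eqI) (simp add: lookup_hcomp)

lemma hcomp_diff: "hcomp k (p - q) = hcomp k p - hcomp k q"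
  by (rule poly_mapping_eqI) (simp add: lookup_hcomp lookup_minus)

lemma hcomp_sum: "hcomp k (sum g A) = (\<Sum>x\<in>A. hcomp k (g x))"
  by (induction A rule: infinite_finite_induct) (auto simp: hcomp_add)

lemma keys_hcomp: "keys (hcomp k p) = {m \<in> keys p. int (mon_degree m) = k}"
  by (auto simp: in_keys_iff lookup_hcomp split: if_splits)

lemma hcomp_in_forms: "p \<in> polys n \<Longrightarrow> hcomp k p \<in> forms n k"
  by (auto simp: polys_def forms_def keys_hcomp)

lemma forms_subset: "forms n k \<subseteq> polys n"
  by (auto simp: forms_def)

lemma forms_polys: "p \<in> forms n k \<Longrightarrow> p \<in> polys n"
  by (auto simp: forms_def)

lemma hcomp_of_form: "p \<in> forms n j \<Longrightarrow> hcomp k p = (if k = j then p else 0)"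
  by (rule poly_mapping_eqI) (auto simp: forms_def lookup_hcomp in_keys_iff)

lemma forms_negative: "k < 0 \<Longrightarrow> p \<in> forms n k \<Longrightarrow> p = 0"
  by (rule poly_mapping_eqI) (force simp: forms_def in_keys_iff)

lemma polys_0 [simp]: "0 \<in> polys n" by (simp add: polys_def)
lemma polys_1 [simp]: "1 \<in> polys n" by (simp add: polys_def)
lemma forms_0 [simp]: "0 \<in> forms n k" by (simp add: forms_def)
lemma forms_1 [simp]: "1 \<in> forms n 0" by (simp add: forms_def mon_degree_def)

lemma keys_uminus [simp]: "keys (- p) = keys (p :: 'a \<Rightarrow>\<^sub>0 'b::ab_group_add)"
  by (auto simp: in_keys_iff)

lemma polys_add: "p \<in> polys n \<Longrightarrow> q \<in> polys n \<Longrightarrow> p + q \<in> polys n"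
  unfolding polys_def using keys_add[of p q] by blast

lemma polys_uminus: "p \<in> polys n \<Longrightarrow> - p \<in> polys n"
  by (simp add: polys_def)

lemma polys_diff: "p \<in> polys n \<Longrightarrow> q \<in> polys n \<Longrightarrow> p - q \<in> polys n"
  using polys_add[of p n "- q"] by (simp add: polys_uminus)

lemma keys_mon_add: "keys (a + b) = keys a \<union> keys (b :: nat \<Rightarrow>\<^sub>0 nat)"
  by (auto simp: in_keys_iff lookup_add)

lemma mon_degree_superset:
  assumes "finite A" "keys m \<subseteq> A"
  shows "mon_degree m = (\<Sum>i\<in>A. lookup m i)"
  unfolding mon_degree_def by (rule sum.mono_neutral_left) (use assms in \<open>auto simp: in_keys_iff\<close>)

lemma mon_degree_add: "mon_degree (a + b) = mon_degree a + mon_degree b"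
proof -
  have "mon_degree (a + b) = (\<Sum>i\<in>keys a \<union> keys b. lookup (a + b) i)"
    by (rule mon_degree_superset) (auto simp: keys_mon_add)
  also have "\<dots> = (\<Sum>i\<in>keys a \<union> keys b. lookup a i) + (\<Sum>i\<in>keys a \<union> keys b. lookup b i)"
    by (simp add: lookup_add sum.distrib)
  also have "\<dots> = mon_degree a + mon_degree b"
    using mon_degree_superset[of "keys a \<union> keys b" a] mon_degree_superset[of "keys a \<union> keys b" b] by simp
  finally show ?thesis .
qed

lemma polys_mult: "p \<in> polys n \<Longrightarrow> q \<in> polys n \<Longrightarrow> p * q \<in> polys n"
  unfolding polys_def using keys_mult[of p q] by (fastforce simp: keys_mon_add)

lemma forms_mult: "p \<in> forms n i \<Longrightarrow> q \<in> forms n j \<Longrightarrow> p * q \<in> forms n (i + j)"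
  unfolding forms_def using keys_mult[of p q] polys_mult[of p n q]
  by (fastforce simp: mon_degree_add)

lemma forms_add: "p \<in> forms n k \<Longrightarrow> q \<in> forms n k \<Longrightarrow> p + q \<in> forms n k"
  unfolding forms_def using keys_add[of p q] polys_add[of p n q] by blast

lemma forms_uminus: "p \<in> forms n k \<Longrightarrow> - p \<in> forms n k"
  by (simp add: forms_def polys_uminus)

lemma forms_diff: "p \<in> forms n k \<Longrightarrow> q \<in> forms n k \<Longrightarrow> p - q \<in> forms n k"
  using forms_add[of p n k "- q"] by (simp add: forms_uminus)

lemma forms_sum: "(\<And>x. x \<in> A \<Longrightarrow> g x \<in> forms n k) \<Longrightarrow> sum g A \<in> forms n k"
  by (induction A rule: infinite_finite_induct) (auto simp: forms_add)

lemma polys_sum: "(\<And>x. x \<in> A \<Longrightarrow> g x \<in> polys n) \<Longrightarrow> sum g A \<in> polys n"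
  by (induction A rule: infinite_finite_induct) (auto simp: polys_add)

lemma forms_power: "p \<in> forms n i \<Longrightarrow> p ^ k \<in> forms n (int k * i)"
proof (induction k)
  case (Suc k) then show ?case
    using forms_mult[of p n i "p ^ k" "int k * i"] by (simp add: algebra_simps)
qed simp

lemma polys_power: "p \<in> polys n \<Longrightarrow> p ^ k \<in> polys n"
  by (induction k) (auto simp: polys_mult)

lemma Const_forms [simp]: "Const c \<in> forms n 0"
  by (simp add: forms_def polys_def Const_def mon_degree_def)

lemma Const_polys [simp]: "Const c \<in> polys n"
  by (rule forms_polys[OF Const_forms])

lemma Var_forms: "i \<le> n \<Longrightarrow> Var i \<in> forms n 1"
  by (simp add: forms_def polys_def Var_def mon_degree_def)

lemma Var_polys: "i \<le> n \<Longrightarrow> Var i \<in> polys n"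
  by (rule forms_polys[OF Var_forms])

lemma Const_0 [simp]: "Const 0 = 0" by (simp add: Const_def)
lemma Const_1 [simp]: "Const 1 = 1" by (simp add: Const_def)
lemma Const_add: "Const (a + b) = Const a + Const b" by (simp add: Const_def single_add)
lemma Const_mult: "Const (a * b) = Const a * Const b" by (simp add: Const_def mult_single)
lemma Const_diff: "Const (a - b) = Const a - Const b" by (simp add: Const_def single_diff)
lemma Const_mult_single: "Const a * single m c = single m (a * c)"
  by (simp add: Const_def mult_single)

lemma form_0_Const: "p \<in> forms n 0 \<Longrightarrow> p = Const (lookup p 0)"
proof (rule poly_mapping_eqI)
  fix m assume p: "p \<in> forms n 0"
  have "lookup p m = 0" if "m \<noteq> 0"
  proof (rule ccontr)
    assume "lookup p m \<noteq> 0"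
    then have "mon_degree m = 0" using p by (auto simp: forms_def in_keys_iff)
    then have "m = 0" by (intro poly_mapping_eqI) (auto simp: mon_degree_def in_keys_iff)
    with that show False by simp
  qed
  then show "lookup p m = lookup (Const (lookup p 0)) m"
    by (auto simp: Const_def lookup_single when_def)
qed

definition degrees :: "'k::field mpoly \<Rightarrow> int set" where
  "degrees p = (\<lambda>m. int (mon_degree m)) ` keys p"

lemma finite_degrees [simp]: "finite (degrees p)" by (simp add: degrees_def)

lemma hcomp_outside_degrees: "k \<notin> degrees p \<Longrightarrow> hcomp k p = 0"
  by (rule poly_mapping_eqI) (auto simp: lookup_hcomp degrees_def in_keys_iff)

lemma sum_hcomp_superset:
  assumes "finite D" "degrees p \<subseteq> D"
  shows "p = (\<Sum>k\<in>D. hcomp k p)"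
proof (rule poly_mapping_eqI)
  fix m
  have "lookup (\<Sum>k\<in>D. hcomp k p) m = (\<Sum>k\<in>D. if k = int (mon_degree m) then lookup p m else 0)"
    unfolding lookup_sum by (rule sum.cong) (auto simp: lookup_hcomp)
  also have "\<dots> = lookup p m"
    using assms by (subst sum.delta) (force simp: degrees_def in_keys_iff)+
  finally show "lookup p m = lookup (\<Sum>k\<in>D. hcomp k p) m" by simp
qed

lemma sum_hcomp: "p = (\<Sum>k\<in>degrees p. hcomp k p)"
  by (rule sum_hcomp_superset) auto

text \<open>Through this rule every congruence between products with forms can be replaced by its homogeneous components.\<close>

lemma hcomp_form_mult:
  assumes q: "q \<in> forms n d" and p: "p \<in> polys n"
  shows "hcomp k (q * p) = q * hcomp (k - d) p"
proof -
  have "q * p = (\<Sum>j\<in>degrees p. q * hcomp j p)"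
    using arg_cong[OF sum_hcomp[of p], of "(*) q"] by (simp only: sum_distrib_left)
  then have "hcomp k (q * p) = hcomp k (\<Sum>j\<in>degrees p. q * hcomp j p)"
    by (rule arg_cong)
  also have "\<dots> = (\<Sum>j\<in>degrees p. if j = k - d then q * hcomp j p else 0)"
    unfolding hcomp_sum
  proof (rule sum.cong)
    fix j
    show "hcomp k (q * hcomp j p) = (if j = k - d then q * hcomp j p else 0)"
      using hcomp_of_form[OF forms_mult[OF q hcomp_in_forms[OF p]], of k j] by auto
  qed simp
  also have "\<dots> = q * hcomp (k - d) p"
    by (auto simp: hcomp_outside_degrees)
  finally show ?thesis .
qed

lemma hcomp_negative: "k < 0 \<Longrightarrow> hcomp k p = 0"
  by (rule poly_mapping_eqI) (simp add: lookup_hcomp)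

lemma sum_monomials: "p = (\<Sum>m\<in>keys p. single m (lookup p m))"
proof (rule poly_mapping_eqI)
  fix m
  have "lookup (\<Sum>m\<in>keys p. single m (lookup p m)) m = (\<Sum>x\<in>keys p. if x = m then lookup p m else 0)"
    unfolding lookup_sum by (rule sum.cong) (auto simp: lookup_single)
  then show "lookup p m = lookup (\<Sum>m\<in>keys p. single m (lookup p m)) m"
    by (auto simp: in_keys_iff)
qed

section \<open>Homogeneous ideals of the polynomial ring\<close>

text \<open>Ideals are handled as plain sets of polynomials, so that identities are settled by the arithmetic of
the type of polynomials. Closure under \<open>hcomp\<close> expresses homogeneity.\<close>

definition hideal :: "nat \<Rightarrow> 'k::field mpoly set \<Rightarrow> bool" where
  "hideal n I \<longleftrightarrow> I \<subseteq> polys n \<and> 0 \<in> I \<and> (\<forall>a\<in>I. \<forall>b\<in>I. a + b \<in> I) \<and>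
     (\<forall>a\<in>polys n. \<forall>b\<in>I. a * b \<in> I) \<and> (\<forall>k. \<forall>a\<in>I. hcomp k a \<in> I)"

lemma hidealI:
  assumes "I \<subseteq> polys n" "0 \<in> I" "\<And>a b. a \<in> I \<Longrightarrow> b \<in> I \<Longrightarrow> a + b \<in> I"
    "\<And>a b. a \<in> polys n \<Longrightarrow> b \<in> I \<Longrightarrow> a * b \<in> I" "\<And>k a. a \<in> I \<Longrightarrow> hcomp k a \<in> I"
  shows "hideal n I"
  using assms by (auto simp: hideal_def)

context
  fixes n and I :: "'k::field mpoly set" assumes I: "hideal n I"
begin
lemma hideal_subset: "a \<in> I \<Longrightarrow> a \<in> polys n" using I by (auto simp: hideal_def)
lemma hideal_0: "0 \<in> I" using I by (auto simp: hideal_def)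
lemma hideal_add: "a \<in> I \<Longrightarrow> b \<in> I \<Longrightarrow> a + b \<in> I" using I by (auto simp: hideal_def)
lemma hideal_mult: "a \<in> polys n \<Longrightarrow> b \<in> I \<Longrightarrow> a * b \<in> I" using I by (auto simp: hideal_def)
lemma hideal_mult_right: "a \<in> polys n \<Longrightarrow> b \<in> I \<Longrightarrow> b * a \<in> I"
  using hideal_mult by (simp add: mult.commute)
lemma hideal_hcomp: "a \<in> I \<Longrightarrow> hcomp k a \<in> I" using I by (auto simp: hideal_def)
lemma hideal_uminus: "a \<in> I \<Longrightarrow> - a \<in> I"
  using hideal_mult[of "- 1" a] by (simp add: polys_uminus)
lemma hideal_diff: "a \<in> I \<Longrightarrow> b \<in> I \<Longrightarrow> a - b \<in> I"
  using hideal_add[of a "- b"] hideal_uminus by simp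
lemma hideal_sum: "(\<And>x. x \<in> A \<Longrightarrow> g x \<in> I) \<Longrightarrow> sum g A \<in> I"
  by (induction A rule: infinite_finite_induct) (auto simp: hideal_add hideal_0)
lemma hideal_cong: "a - b \<in> I \<Longrightarrow> a \<in> I \<longleftrightarrow> b \<in> I"
  using hideal_add[of "a - b" b] hideal_diff[of a "a - b"] by auto
lemma hideal_hcomp_iff: "a \<in> I \<longleftrightarrow> (\<forall>k. hcomp k a \<in> I)"
proof
  assume "\<forall>k. hcomp k a \<in> I"
  then have "(\<Sum>k\<in>degrees a. hcomp k a) \<in> I" by (intro hideal_sum) auto
  then show "a \<in> I" by (subst sum_hcomp)
qed (simp add: hideal_hcomp)
end

text \<open>Multiplication by \<open>f\<close> is injective on \<open>S/I\<close>.\<close>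

definition nonzerodiv :: "nat \<Rightarrow> 'k::field mpoly set \<Rightarrow> 'k mpoly \<Rightarrow> bool" where
  "nonzerodiv n I f \<longleftrightarrow> (\<forall>a\<in>polys n. f * a \<in> I \<longrightarrow> a \<in> I)"

text \<open>The ideal \<open>I + (f)\<close>.\<close>

definition adjoin :: "nat \<Rightarrow> 'k::field mpoly set \<Rightarrow> 'k mpoly \<Rightarrow> 'k mpoly set" where
  "adjoin n I f = {q + f * a | q a. q \<in> I \<and> a \<in> polys n}"

lemma adjoin_iff: "v \<in> adjoin n I f \<longleftrightarrow> (\<exists>a\<in>polys n. v - f * a \<in> I)"
proof
  assume "\<exists>a\<in>polys n. v - f * a \<in> I"
  then obtain a where "a \<in> polys n" "v - f * a \<in> I" by blast
  then show "v \<in> adjoin n I f"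
    unfolding adjoin_def by (intro CollectI exI[of _ "v - f * a"] exI[of _ a]) auto
next
  assume "v \<in> adjoin n I f"
  then obtain q a where "v = q + f * a" "q \<in> I" "a \<in> polys n" by (auto simp: adjoin_def)
  then show "\<exists>a\<in>polys n. v - f * a \<in> I" by (intro bexI[of _ a]) auto
qed

lemma adjoinI: "a \<in> polys n \<Longrightarrow> v - f * a \<in> I \<Longrightarrow> v \<in> adjoin n I f"
  by (auto simp: adjoin_iff)

lemma hideal_adjoin:
  fixes I :: "'k::field mpoly set"
  assumes I: "hideal n I" and f: "f \<in> forms n d"
  shows "hideal n (adjoin n I f)"
proof (rule hidealI)
  show "adjoin n I f \<subseteq> polys n"
    using hideal_subset[OF I] forms_polys[OF f] by (auto simp: adjoin_def intro!: polys_add polys_mult)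
  show "0 \<in> adjoin n I f" by (rule adjoinI[of 0]) (auto simp: hideal_0[OF I])
next
  fix a b assume "a \<in> adjoin n I f" "b \<in> adjoin n I f"
  then obtain a' b' where "a' \<in> polys n" "b' \<in> polys n" "a - f * a' \<in> I" "b - f * b' \<in> I"
    by (auto simp: adjoin_iff)
  then show "a + b \<in> adjoin n I f"
    using hideal_add[OF I, of "a - f * a'" "b - f * b'"]
    by (intro adjoinI[of "a' + b'"]) (auto simp: polys_add algebra_simps)
next
  fix a b :: "'k mpoly" assume a: "a \<in> polys n" and "b \<in> adjoin n I f"
  then obtain b' where "b' \<in> polys n" "b - f * b' \<in> I"
    by (auto simp: adjoin_iff)
  then show "a * b \<in> adjoin n I f"
    using hideal_mult[OF I a, of "b - f * b'"] a
    by (intro adjoinI[of "a * b'"]) (auto simp: polys_mult algebra_simps)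
next
  fix k a assume "a \<in> adjoin n I f"
  then obtain b where b: "b \<in> polys n" "a - f * b \<in> I" by (auto simp: adjoin_iff)
  from hideal_hcomp[OF I b(2), of k] show "hcomp k a \<in> adjoin n I f"
    using b forms_polys[OF hcomp_in_forms[OF b(1), of "k - d"]] by (intro adjoinI[of "hcomp (k - d) b"]) (auto simp: hcomp_diff hcomp_form_mult[OF f])
qed

lemma adjoin_mono: "hideal n I \<Longrightarrow> I \<subseteq> adjoin n I f"
  unfolding adjoin_iff subset_eq by (intro ballI bexI[of _ 0]) auto

lemma adjoin_self: "hideal n I \<Longrightarrow> a \<in> polys n \<Longrightarrow> f * a \<in> adjoin n I f"
  by (rule adjoinI) (auto simp: hideal_0)

lemma adjoin_commute: "adjoin n (adjoin n I f) g = adjoin n (adjoin n I g) f"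
proof -
  have "adjoin n (adjoin n I f) g \<subseteq> adjoin n (adjoin n I g) f" for f g
  proof
    fix x assume "x \<in> adjoin n (adjoin n I f) g"
    then obtain a b where "a \<in> polys n" "b \<in> polys n" "x - g * a - f * b \<in> I" by (auto simp: adjoin_iff)
    then show "x \<in> adjoin n (adjoin n I g) f"
      unfolding adjoin_iff by (intro bexI[of _ b] bexI[of _ a]) (auto simp: algebra_simps)
  qed
  then show ?thesis by blast
qed

lemma hideal_zero: "hideal n {0}"
  by (rule hidealI) auto

lemma nonzerodiv_power: "f \<in> polys n \<Longrightarrow> nonzerodiv n I f \<Longrightarrow> nonzerodiv n I (f ^ k)"
proof (induction k)
  case (Suc k)
  show ?case unfolding nonzerodiv_def
  proof (intro ballI impI)
    fix a assume a: "a \<in> polys n" "f ^ Suc k * a \<in> I"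
    then have "f * (f ^ k * a) \<in> I" by (simp add: mult.assoc)
    then have "f ^ k * a \<in> I" using Suc.prems a(1) unfolding nonzerodiv_def by (blast intro: polys_mult polys_power)
    then show "a \<in> I" using Suc.IH[OF Suc.prems] a(1) unfolding nonzerodiv_def by blast
  qed
qed (simp add: nonzerodiv_def)

text \<open>Membership of a form in \<open>I + (f)\<close> is witnessed by a form: take the component of the right degree of any witness.\<close>

lemma adjoin_form_witness:
  assumes I: "hideal n I" and f: "f \<in> forms n d" and v: "v \<in> forms n k" "v \<in> adjoin n I f"
  obtains a where "a \<in> forms n (k - d)" "v - f * a \<in> I"
proof -
  obtain b where b: "b \<in> polys n" "v - f * b \<in> I" using v by (auto simp: adjoin_iff)
  from hideal_hcomp[OF I b(2), of k] have "v - f * hcomp (k - d) b \<in> I" using v(1) b by (simp add: hcomp_diff hcomp_form_mult[OF f] hcomp_of_form)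
  with hcomp_in_forms[OF b(1)] that show thesis by blast
qed

section \<open>Ascending chains of homogeneous ideals\<close>

definition monomials :: "nat \<Rightarrow> nat \<Rightarrow> (nat \<Rightarrow>\<^sub>0 nat) set" where
  "monomials n d = {m. keys m \<subseteq> {0..n} \<and> mon_degree m = d}"

lemma lookup_le_mon_degree: "lookup m i \<le> mon_degree m"
proof (cases "i \<in> keys m")
  case True
  then show ?thesis unfolding mon_degree_def by (intro member_le_sum) auto
qed (simp add: in_keys_iff)

lemma finite_monomials [simp]: "finite (monomials n d)"
proof (rule finite_imageD)
  have "lookup ` monomials n d \<subseteq> {f. \<forall>i. (i \<in> {0..n} \<longrightarrow> f i \<in> {0..d}) \<and> (i \<notin> {0..n} \<longrightarrow> f i = 0)}"
    using lookup_le_mon_degree by (fastforce simp: monomials_def in_keys_iff)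
  then show "finite (lookup ` monomials n d)"
    by (rule finite_subset) (rule finite_set_of_finite_funs; simp)
  show "inj_on lookup (monomials n d)"
    by (intro inj_onI poly_mapping_eqI) simp
qed

lemma keys_form: "p \<in> forms n (int d) \<Longrightarrow> keys p \<subseteq> monomials n d"
  by (auto simp: forms_def polys_def monomials_def)

lemma single_form: "m \<in> monomials n d \<Longrightarrow> single m c \<in> forms n (int d)"
  by (auto simp: forms_def polys_def monomials_def)

text \<open>Pass to a monotone subsequence one coordinate at a time. A nonincreasing sequence of natural numbers
is constant from its minimum on, so dropping finitely many terms makes it nondecreasing.\<close>

lemma strict_mono_subseq_all_coordinates_mono:
  fixes m :: "nat \<Rightarrow> nat \<Rightarrow> nat"
  shows "\<exists>r. strict_mono (r :: nat \<Rightarrow> nat) \<and> (\<forall>i<N. incseq (\<lambda>k. m (r k) i))"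
proof (induction N)
  case 0
  then show ?case by (intro exI[of _ id]) (simp add: strict_mono_def)
next
  case (Suc N)
  then obtain r where r: "strict_mono r" "\<And>i. i < N \<Longrightarrow> incseq (\<lambda>k. m (r k) i)" by blast
  obtain f :: "nat \<Rightarrow> nat" where f: "strict_mono f" "monoseq (\<lambda>k. m (r (f k)) N)"
    using seq_monosub[of "\<lambda>k. m (r k) N"] by auto
  obtain K where K: "incseq (\<lambda>k. m (r (f (k + K))) N)"
  proof (cases "incseq (\<lambda>k. m (r (f k)) N)")
    case True
    then show ?thesis using that[of 0] by simp
  next
    case False
    then have dec: "decseq (\<lambda>k. m (r (f k)) N)" using f(2) by (simp add: monoseq_iff)
    define K where "K = arg_min (\<lambda>k. m (r (f k)) N) (\<lambda>_. True)"
    have min: "m (r (f K)) N \<le> m (r (f k)) N" for k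
      unfolding K_def by (rule arg_min_nat_le) simp
    have "m (r (f (k + K))) N = m (r (f K)) N" for k
      using min[of "k + K"] decseqD[OF dec, of K "k + K"] by simp
    then show ?thesis using that[of K] by (simp add: incseq_def)
  qed
  have "incseq (\<lambda>k. m (r (f (k + K))) i)" if "i < Suc N" for i
  proof (cases "i = N")
    case False
    then have i: "incseq (\<lambda>k. m (r k) i)" using that r(2) by simp
    show ?thesis unfolding incseq_def
      using incseqD[OF i] f(1) by (auto simp: strict_mono_less_eq)
  qed (use K in simp)
  moreover have "strict_mono (\<lambda>k. r (f (k + K)))"
    using r(1) f(1) by (auto simp: strict_mono_def)
  ultimately show ?case by blast
qed

lemma dickson:
  fixes m :: "nat \<Rightarrow> nat \<Rightarrow>\<^sub>0 nat"
  assumes "\<And>k. keys (m k) \<subseteq> {0..n}"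
  obtains j k where "j < k" "\<And>i. lookup (m j) i \<le> lookup (m k) i"
proof -
  obtain r :: "nat \<Rightarrow> nat" where r: "strict_mono r" "\<And>i. i < Suc n \<Longrightarrow> incseq (\<lambda>k. lookup (m (r k)) i)"
    using strict_mono_subseq_all_coordinates_mono[of "Suc n" "\<lambda>k. lookup (m k)"] by blast
  have "lookup (m (r 0)) i \<le> lookup (m (r 1)) i" for i
  proof (cases "i < Suc n")
    case True
    then show ?thesis using incseqD[OF r(2), of i 0 1] by simp
  next
    case False
    then have "i \<notin> keys (m (r 0))" using assms[of "r 0"] by auto
    then show ?thesis by (simp add: in_keys_iff)
  qed
  moreover have "r 0 < r 1" using r(1) by (simp add: strict_mono_def)
  ultimately show thesis using that by blast
qed

lemma lookup_single_mult: "lookup (single a c * p) (a + m) = c * lookup (p :: 'k::field mpoly) m"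
proof -
  have "single a c * p = (\<Sum>x\<in>keys p. single (a + x) (c * lookup p x))"
  proof -
    have "single a c * p = single a c * (\<Sum>x\<in>keys p. single x (lookup p x))"
      using sum_monomials[of p] by simp
    then show ?thesis by (simp add: sum_distrib_left mult_single)
  qed
  then have "lookup (single a c * p) (a + m) = (\<Sum>x\<in>keys p. if x = m then c * lookup p m else 0)"
    by (simp add: lookup_sum lookup_single when_def)
  then show ?thesis by (auto simp: in_keys_iff)
qed

definition lead :: "'k::field mpoly \<Rightarrow> (nat \<Rightarrow>\<^sub>0 nat)" where
  "lead p = Max (keys p)"

lemma lead_in_keys: "p \<noteq> 0 \<Longrightarrow> lead p \<in> keys p"
  unfolding lead_def by (intro Max_in) auto

lemma lead_ge: "m \<in> keys p \<Longrightarrow> m \<le> lead p"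
  unfolding lead_def by (intro Max_ge) auto

lemma hideal_separating_form:
  assumes "hideal n I" "hideal n J" "\<not> J \<subseteq> I"
  obtains k g where "g \<in> forms n k" "g \<in> J" "g \<notin> I"
proof -
  obtain a where a: "a \<in> J" "a \<notin> I" using assms(3) by blast
  then obtain k where "hcomp k a \<notin> I" using hideal_hcomp_iff[OF assms(1)] by blast
  moreover have "hcomp k a \<in> J" "hcomp k a \<in> forms n k"
    using a hideal_hcomp[OF assms(2) a(1)] hcomp_in_forms[OF hideal_subset[OF assms(2) a(1)]] by auto
  ultimately show thesis using that by blast
qed

text \<open>If every step were strict, choose in each \<open>Q (Suc k) - Q k\<close> a form whose leading monomial is least
among the forms of its degree. By Dickson's lemma the leading monomial of some \<open>g j\<close> divides
that of a later \<open>g k\<close>; cancelling it yields a form of the same degree with a smaller leading monomial.\<close>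

lemma hideal_ascending_chain_stops:
  assumes Q: "\<And>k. hideal n (Q k)" and mono: "\<And>k. Q k \<subseteq> Q (Suc k)"
  shows "\<exists>k. Q (Suc k) = Q k"
proof (rule ccontr)
  assume no: "\<nexists>k. Q (Suc k) = Q k"
  define new where "new k e g \<longleftrightarrow> g \<in> forms n (int e) \<and> g \<in> Q (Suc k) \<and> g \<notin> Q k \<and>
      (\<forall>g'\<in>forms n (int e). g' \<in> Q (Suc k) \<longrightarrow> g' \<notin> Q k \<longrightarrow> lead g \<le> lead g')" for k e g
  have "\<exists>e g. new k e g" for k
  proof -
    have "\<not> Q (Suc k) \<subseteq> Q k" using no mono by blast
    then obtain z h where h: "h \<in> forms n z" "h \<in> Q (Suc k)" "h \<notin> Q k"
      using hideal_separating_form[OF Q Q] by blast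
    have "h \<noteq> 0" using h(3) hideal_0[OF Q] by auto
    then have "z \<ge> 0" using forms_negative[of z h n] h(1) by force
    then obtain e where e: "z = int e" using nonneg_int_cases by blast
    define G where "G = {g \<in> forms n (int e). g \<in> Q (Suc k) \<and> g \<notin> Q k}"
    have "lead ` G \<subseteq> monomials n e"
    proof
      fix x assume "x \<in> lead ` G"
      then obtain g where g: "x = lead g" "g \<in> forms n (int e)" "g \<notin> Q k" by (auto simp: G_def)
      then have "g \<noteq> 0" using hideal_0[OF Q] by auto
      then show "x \<in> monomials n e" using keys_form[OF g(2)] lead_in_keys g(1) by auto
    qed
    then have fin: "finite (lead ` G)" by (rule finite_subset) simp
    have "h \<in> G" using h e by (simp add: G_def)
    then have "Min (lead ` G) \<in> lead ` G" using fin by (intro Min_in) auto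
    then obtain g where g: "g \<in> G" "lead g = Min (lead ` G)" by auto
    then have "lead g \<le> lead g'" if "g' \<in> G" for g' using that fin by simp
    then show ?thesis using g(1) unfolding G_def new_def by blast
  qed
  then obtain e where "\<forall>k. \<exists>g. new k (e k) g" by metis
  then obtain g where "\<forall>k. new k (e k) (g k)" by metis
  then have g: "\<And>k. g k \<in> forms n (int (e k))" "\<And>k. g k \<in> Q (Suc k)" "\<And>k. g k \<notin> Q k"
    and min: "\<And>k g'. g' \<in> forms n (int (e k)) \<Longrightarrow> g' \<in> Q (Suc k) \<Longrightarrow> g' \<notin> Q k \<Longrightarrow> lead (g k) \<le> lead g'"
    unfolding new_def by blast+
  have g0: "g k \<noteq> 0" for k using g(3)[of k] hideal_0[OF Q, of k] by auto
  have lmg: "lead (g k) \<in> monomials n (e k)" for k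
    using keys_form[OF g(1)] lead_in_keys[OF g0] by blast
  then have "keys (lead (g k)) \<subseteq> {0..n}" for k by (auto simp: monomials_def)
  then obtain j k where jk: "j < k" and le: "\<And>i. lookup (lead (g j)) i \<le> lookup (lead (g k)) i"
    using dickson[of "\<lambda>k. lead (g k)"] by blast
  define a where "a = lead (g k) - lead (g j)"
  have a: "lead (g k) = a + lead (g j)"
    by (rule poly_mapping_eqI) (use le in \<open>simp add: a_def lookup_add lookup_minus\<close>)
  have ak: "a \<in> monomials n (e k - e j)"
    using lmg[of k] lmg[of j] by (auto simp: monomials_def a keys_mon_add mon_degree_add)
  have ej: "e j \<le> e k" using lmg[of k] lmg[of j] by (auto simp: monomials_def a mon_degree_add)
  \<comment> \<open>a multiple of the earlier form cancels the leading term of the later one\<close>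
  define c where "c = lookup (g k) (lead (g k)) / lookup (g j) (lead (g j))"
  define h where "h = g k - single a c * g j"
  have gj: "lookup (g j) (lead (g j)) \<noteq> 0" using lead_in_keys[OF g0] by (simp add: in_keys_iff)
  have xg: "single a c * g j \<in> forms n (int (e k))"
    using forms_mult[OF single_form[OF ak] g(1)[of j]] ej by (simp add: of_nat_diff)
  have hf: "h \<in> forms n (int (e k))" unfolding h_def by (intro forms_diff g xg)
  have "Q i \<subseteq> Q i'" if "i \<le> i'" for i i' using lift_Suc_mono_le[of Q, OF mono that] .
  from this[of "Suc j" k] have "g j \<in> Q k" using g(2)[of j] jk by auto
  then have xQ: "single a c * g j \<in> Q k"
    by (intro hideal_mult[OF Q] forms_polys[OF single_form[OF ak]])
  have hQ: "h \<notin> Q k"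
    using hideal_cong[OF Q, of "g k" h k] xQ g(3)[of k] by (auto simp: h_def)
  have hQ': "h \<in> Q (Suc k)" unfolding h_def using xQ mono by (intro hideal_diff[OF Q] g) auto
  have "h \<noteq> 0" using hQ hideal_0[OF Q] by auto
  then have "lead h \<in> keys h" by (rule lead_in_keys)
  moreover have "keys h \<subseteq> {m. m \<le> lead (g k)}"
  proof
    fix m assume "m \<in> keys h"
    then have "m \<in> keys (g k) \<or> m \<in> keys (single a c * g j)"
      by (auto simp: h_def in_keys_iff lookup_minus)
    then show "m \<in> {m. m \<le> lead (g k)}"
    proof
      assume "m \<in> keys (single a c * g j)"
      then obtain x where "m = a + x" "x \<in> keys (g j)"
        using keys_mult[of "single a c" "g j"] by (auto split: if_splits)
      then show ?thesis using lead_ge[of x "g j"] a by (simp add: add_left_mono)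
    qed (auto intro: lead_ge)
  qed
  moreover have "lookup h (lead (g k)) = 0"
    using lookup_single_mult[of a c "g j" "lead (g j)"] gj a
    by (simp add: h_def lookup_minus c_def)
  then have "lead (g k) \<notin> keys h" by (simp add: in_keys_iff)
  ultimately have "lead h \<le> lead (g k)" "lead h \<noteq> lead (g k)" by auto
  then have "lead h < lead (g k)" by (rule le_neq_trans)
  then show False using min[OF hf hQ' hQ] by simp
qed

lemma wf_hideal: "wf {(J :: 'k::field mpoly set, I). hideal n I \<and> hideal n J \<and> I \<subset> J}"
proof (subst wf_iff_no_infinite_down_chain, rule notI)
  assume "\<exists>Q :: nat \<Rightarrow> 'k mpoly set. \<forall>k. (Q (Suc k), Q k) \<in> {(J, I). hideal n I \<and> hideal n J \<and> I \<subset> J}"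
  then obtain Q :: "nat \<Rightarrow> 'k mpoly set" where
    "\<forall>k. (Q (Suc k), Q k) \<in> {(J, I). hideal n I \<and> hideal n J \<and> I \<subset> J}" by (rule exE)
  then have "hideal n (Q k) \<and> hideal n (Q (Suc k)) \<and> Q k \<subset> Q (Suc k)" for k by (auto dest: spec[of _ k])
  then have Q: "\<And>k. hideal n (Q k)" "\<And>k. Q k \<subset> Q (Suc k)" by simp_all
  have "\<exists>k. Q (Suc k) = Q k"
    by (rule hideal_ascending_chain_stops[of n]) (use Q(1) Q(2)[THEN psubset_imp_subset] in simp_all)
  then obtain k where "Q (Suc k) = Q k" by (rule exE)
  then show False using Q(2)[of k] by simp
qed

section \<open>Maximal annihilators and linear nonzerodivisors\<close>

text \<open>The colon ideal \<open>I : a\<close>, the annihilator of \<open>a\<close> in \<open>S/I\<close>.\<close>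

definition colon_by :: "nat \<Rightarrow> 'k::field mpoly set \<Rightarrow> 'k mpoly \<Rightarrow> 'k mpoly set" where
  "colon_by n I a = {b \<in> polys n. b * a \<in> I}"

lemma hideal_colon_by:
  fixes I :: "'k::field mpoly set"
  assumes I: "hideal n I" and a: "a \<in> forms n d"
  shows "hideal n (colon_by n I a)"
proof (rule hidealI)
  show "colon_by n I a \<subseteq> polys n" "0 \<in> colon_by n I a" by (auto simp: colon_by_def hideal_0[OF I])
next
  fix b c :: "'k mpoly" assume "b \<in> colon_by n I a" "c \<in> colon_by n I a"
  then show "b + c \<in> colon_by n I a"
    using hideal_add[OF I, of "b * a" "c * a"] by (simp add: colon_by_def polys_add distrib_right)
next
  fix b c :: "'k mpoly" assume "b \<in> polys n" "c \<in> colon_by n I a"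
  then show "b * c \<in> colon_by n I a"
    using hideal_mult[OF I, of b "c * a"] by (simp add: colon_by_def polys_mult mult.assoc)
next
  fix k and b :: "'k mpoly" assume "b \<in> colon_by n I a"
  then show "hcomp k b \<in> colon_by n I a"
    using hideal_hcomp[OF I, of "a * b" "k + d"]
    by (simp add: colon_by_def forms_polys[OF hcomp_in_forms] hcomp_form_mult[OF a] mult.commute)
qed

text \<open>The maximal ones among the annihilators of nonzero homogeneous elements of \<open>S/I\<close>; they are associated primes.\<close>

definition max_colons :: "nat \<Rightarrow> 'k::field mpoly set \<Rightarrow> 'k mpoly set set" where
  "max_colons n I = {P. \<exists>b k. b \<in> forms n k \<and> b \<notin> I \<and> P = colon_by n I b \<and>
     (\<forall>c j. c \<in> forms n j \<longrightarrow> c \<notin> I \<longrightarrow> P \<subseteq> colon_by n I c \<longrightarrow> colon_by n I c = P)}"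

lemma max_colonsE:
  assumes "P \<in> max_colons n I"
  obtains b k where "b \<in> forms n k" "b \<notin> I" "P = colon_by n I b"
    "\<forall>c j. c \<in> forms n j \<longrightarrow> c \<notin> I \<longrightarrow> P \<subseteq> colon_by n I c \<longrightarrow> colon_by n I c = P"
proof -
  have "\<exists>b k. b \<in> forms n k \<and> b \<notin> I \<and> P = colon_by n I b \<and>
     (\<forall>c j. c \<in> forms n j \<longrightarrow> c \<notin> I \<longrightarrow> P \<subseteq> colon_by n I c \<longrightarrow> colon_by n I c = P)"
    using assms unfolding max_colons_def by (rule CollectD)
  then obtain b k where b: "b \<in> forms n k" "b \<notin> I" "P = colon_by n I b"
     and m: "\<forall>c j. c \<in> forms n j \<longrightarrow> c \<notin> I \<longrightarrow> P \<subseteq> colon_by n I c \<longrightarrow> colon_by n I c = P"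
    by (elim exE conjE) 
  show thesis by (rule that[OF b m])
qed

lemma max_colons_hideal: "hideal n I \<Longrightarrow> P \<in> max_colons n I \<Longrightarrow> hideal n P"
  by (elim max_colonsE) (simp add: hideal_colon_by)

lemma max_colons_cover:
  assumes I: "hideal n I" and a: "a \<in> forms n k" "a \<notin> I"
  shows "\<exists>P\<in>max_colons n I. colon_by n I a \<subseteq> P"
proof -
  define F where "F = {P. colon_by n I a \<subseteq> P \<and> (\<exists>b k. b \<in> forms n k \<and> b \<notin> I \<and> P = colon_by n I b)}"
  have "colon_by n I a \<in> F" using a by (auto simp: F_def)
  then obtain P where P: "P \<in> F" and max: "\<And>P'. (P', P) \<in> {(J, I). hideal n I \<and> hideal n J \<and> I \<subset> J} \<Longrightarrow> P' \<notin> F"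
    using wfE_min[OF wf_hideal[of n]] by blast
  obtain b j where b: "b \<in> forms n j" "b \<notin> I" "P = colon_by n I b" "colon_by n I a \<subseteq> P" using P by (auto simp: F_def)
  have "colon_by n I c = P" if c: "c \<in> forms n i" "c \<notin> I" "P \<subseteq> colon_by n I c" for c i
  proof (rule ccontr)
    assume "colon_by n I c \<noteq> P"
    then have "colon_by n I c \<notin> F" using c max[of "colon_by n I c"] hideal_colon_by[OF I c(1)] hideal_colon_by[OF I b(1)] b(3) by auto
    moreover have "colon_by n I c \<in> F" using c b by (auto simp: F_def)
    ultimately show False by simp
  qed
  then have "P \<in> max_colons n I" unfolding max_colons_def using b by blast
  then show ?thesis using b(4) by blast
qed

text \<open>If \<open>v b \<notin> I\<close>, then \<open>I : (v b)\<close> contains \<open>I : b\<close>, so both are equal by maximality, and \<open>u\<close> lies in the former.\<close>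

lemma max_colons_prime:
  assumes I: "hideal n I" and P: "P \<in> max_colons n I"
    and u: "u \<in> forms n i" and v: "v \<in> forms n j" and uv: "u * v \<in> P"
  shows "u \<in> P \<or> v \<in> P"
proof -
  obtain b k where b: "b \<in> forms n k" "b \<notin> I" "P = colon_by n I b"
    and max: "\<forall>c j. c \<in> forms n j \<longrightarrow> c \<notin> I \<longrightarrow> P \<subseteq> colon_by n I c \<longrightarrow> colon_by n I c = P"
    by (rule max_colonsE[OF P])
  show ?thesis
  proof (cases "v * b \<in> I")
    case True
    then show ?thesis using b v by (simp add: colon_by_def forms_polys)
  next
    case False
    have "P \<subseteq> colon_by n I (v * b)"
    proof
      fix x assume "x \<in> P"
      then have "x \<in> polys n" "v * (x * b) \<in> I"
        using hideal_mult[OF I forms_polys[OF v], of "x * b"] by (simp_all add: b(3) colon_by_def)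
      then show "x \<in> colon_by n I (v * b)" by (simp add: colon_by_def mult.left_commute[of x v b])
    qed
    then have "colon_by n I (v * b) = P" using max forms_mult[OF v b(1)] False by blast
    moreover have "u \<in> colon_by n I (v * b)" using uv forms_polys[OF u] by (simp add: b(3) colon_by_def mult.assoc)
    ultimately show ?thesis by simp
  qed
qed

text \<open>Infinitely many distinct \<open>P k = I : a k\<close> would give an ascending chain \<open>I + (a 0, \<dots>, a (k - 1))\<close>; where
it stops, everything that kills \<open>a 0, \<dots>, a (k - 1)\<close> kills \<open>a k\<close>. But for each \<open>i < k\<close> there is a
form in \<open>P i\<close> outside \<open>P k\<close>, and the product of these forms contradicts primality of \<open>P k\<close>.\<close>

lemma finite_max_colons:
  assumes I: "hideal n I"
  shows "finite (max_colons n I)"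
proof (rule ccontr)
  assume "infinite (max_colons n I)"
  then obtain P :: "nat \<Rightarrow> 'a mpoly set" where P: "inj P" "range P \<subseteq> max_colons n I"
    using infinite_countable_subset by blast
  then have Pa: "P k \<in> max_colons n I" for k by auto
  define wit where "wit k b d \<longleftrightarrow> b \<in> forms n d \<and> b \<notin> I \<and> P k = colon_by n I b \<and>
     (\<forall>c j. c \<in> forms n j \<longrightarrow> c \<notin> I \<longrightarrow> P k \<subseteq> colon_by n I c \<longrightarrow> colon_by n I c = P k)" for k b d
  have "\<exists>b d. wit k b d" for k
    using Pa[of k] unfolding max_colons_def wit_def by (rule CollectD)
  then obtain a where "\<forall>k. \<exists>d. wit k (a k) d" by metis
  then obtain d where wit: "\<And>k. wit k (a k) (d k)" by metis
  note wit' = wit[unfolded wit_def]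
  note a = wit'[THEN conjunct1] wit'[THEN conjunct2, THEN conjunct1]
      wit'[THEN conjunct2, THEN conjunct2, THEN conjunct1]
  have max: "colon_by n I c = P k" if "c \<in> forms n j" "c \<notin> I" "P k \<subseteq> colon_by n I c" for k c j
    using wit[of k] that unfolding wit_def by blast
  define Q where "Q = rec_nat I (\<lambda>k A. adjoin n A (a k))"
  have Q0: "Q 0 = I" and QS: "\<And>k. Q (Suc k) = adjoin n (Q k) (a k)" by (simp_all add: Q_def)
  have hQ: "hideal n (Q k)" for k
    by (induction k) (auto simp: Q0 QS I intro: hideal_adjoin a)
  obtain k where k: "Q (Suc k) = Q k"
    using hideal_ascending_chain_stops[of n Q, OF hQ] adjoin_mono[OF hQ] QS by auto
  have "a k * 1 \<in> Q (Suc k)" unfolding QS by (rule adjoin_self[OF hQ]) simp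
  then have ak: "a k \<in> Q k" using k by simp
  have kill: "w * v \<in> I" if "w \<in> polys n" "v \<in> Q j" "\<And>i. i < j \<Longrightarrow> w \<in> P i" for w v j
    using that
  proof (induction j arbitrary: v)
    case 0
    then show ?case using hideal_mult[OF I] by (simp add: Q0)
  next
    case (Suc j)
    then obtain c where c: "c \<in> polys n" "v - a j * c \<in> Q j" by (auto simp: QS adjoin_iff)
    have "w * (v - a j * c) \<in> I" using Suc.IH[of "v - a j * c"] Suc.prems c(2) by simp
    moreover have "w \<in> colon_by n I (a j)" using Suc.prems(3)[of j] a(3)[of j] by simp
    then have "(w * a j) * c \<in> I" using c(1) hideal_mult_right[OF I] by (simp add: colon_by_def)
    ultimately have "w * (v - a j * c) + (w * a j) * c \<in> I" by (rule hideal_add[OF I])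
    then show ?case by (simp add: algebra_simps)
  qed
  have "\<exists>u e. u \<in> forms n e \<and> u \<in> P i \<and> u \<notin> P k" if i: "i < k" for i
  proof -
    have "\<not> P i \<subseteq> P k"
    proof
      assume "P i \<subseteq> P k"
      then have "colon_by n I (a k) = P i" by (intro max[of _ "d k"] a) (simp add: a(3)[of k, symmetric])
      then have "P k = P i" using a(3)[of k] by simp
      then show False using P(1) i by (simp add: inj_eq)
    qed
    then show ?thesis
      using hideal_separating_form[OF max_colons_hideal[OF I Pa] max_colons_hideal[OF I Pa]] by metis
  qed
  then obtain u e where u: "\<And>i. i < k \<Longrightarrow> u i \<in> forms n (e i)" "\<And>i. i < k \<Longrightarrow> u i \<in> P i"
      "\<And>i. i < k \<Longrightarrow> u i \<notin> P k"
    by metis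
  have prodf: "\<exists>z. (\<Prod>i<j. u i) \<in> forms n z" if "j \<le> k" for j
    using that
  proof (induction j)
    case 0
    show ?case by (intro exI[of _ 0]) simp
  next
    case (Suc j)
    then show ?case using forms_mult[OF _ u(1)[of j]] by fastforce
  qed
  have out: "(\<Prod>i<j. u i) \<notin> P k" if "j \<le> k" for j
    using that
  proof (induction j)
    case 0
    then show ?case using a(2)[of k] a(3)[of k] by (simp add: colon_by_def)
  next
    case (Suc j)
    then obtain z where "(\<Prod>i<j. u i) \<in> forms n z" using prodf[of j] by auto
    then show ?case using max_colons_prime[OF I Pa[of k], of "\<Prod>i<j. u i" z "u j" "e j"] Suc u by auto
  qed
  define w where "w = (\<Prod>i<k. u i)"
  obtain z where "w \<in> forms n z" using prodf[of k] by (auto simp: w_def)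
  then have wp: "w \<in> polys n" by (rule forms_polys)
  have "w \<in> P i" if i: "i < k" for i
  proof -
    have "w = (\<Prod>j\<in>{..<k} - {i}. u j) * u i"
      unfolding w_def using i by (subst prod.remove[of _ i]) (auto simp: mult.commute)
    moreover have "(\<Prod>j\<in>{..<k} - {i}. u j) \<in> polys n"
    proof -
      have "(\<Prod>j\<in>B. u j) \<in> polys n" if "B \<subseteq> {..<k}" for B
        using that
        by (induction B rule: infinite_finite_induct) (auto intro!: polys_mult forms_polys[OF u(1)])
      then show ?thesis by auto
    qed
    ultimately show ?thesis using hideal_mult[OF max_colons_hideal[OF I Pa]] u(2)[OF i] by simp
  qed
  then have "w * a k \<in> I" by (intro kill[OF wp ak])
  then have "w \<in> P k" using wp a(3)[of k] by (simp add: colon_by_def)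
  then show False using out[of k] by (simp add: w_def)
qed

definition socle :: "nat \<Rightarrow> 'k::field mpoly set \<Rightarrow> 'k mpoly set" where
  "socle n I = {y \<in> polys n. \<forall>i\<le>n. Var i * y \<in> I}"

text \<open>An annihilator that contains all variables would make its element a socle element.\<close>

lemma max_colons_misses_variable:
  assumes "socle n I \<subseteq> I" "P \<in> max_colons n I"
  shows "\<exists>i\<le>n. Var i \<notin> P"
proof (rule ccontr)
  assume no: "\<not> (\<exists>i\<le>n. Var i \<notin> P)"
  obtain b k where b: "b \<in> forms n k" "b \<notin> I" "P = colon_by n I b" using assms(2) by (elim max_colonsE)
  then have "b \<in> socle n I" using no forms_polys[OF b(1)] by (auto simp: socle_def colon_by_def)
  then show False using assms(1) b(2) by blast
qed

text \<open>The linear forms are not a finite union of the proper subspaces that the ideals cut out. Given \<open>v\<close>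
outside the old ideals and \<open>w\<close> outside the new one, the line of all \<open>w + c v\<close> meets each old ideal at most
once, so an infinite field leaves room on it.\<close>

lemma linear_form_avoiding:
  fixes PP :: "'k::field mpoly set set"
  assumes inf: "infinite (UNIV :: 'k set)" and fin: "finite PP"
    and "\<And>P. P \<in> PP \<Longrightarrow> hideal n P" "\<And>P. P \<in> PP \<Longrightarrow> \<exists>i\<le>n. Var i \<notin> P"
  shows "\<exists>l\<in>forms n 1. \<forall>P\<in>PP. l \<notin> P"
  using fin assms(3,4)
proof (induction PP)
  case empty
  then show ?case using Var_forms[of 0 n] by auto
next
  case (insert P' PP)
  then obtain v where v: "v \<in> forms n 1" "\<And>P. P \<in> PP \<Longrightarrow> v \<notin> P" by auto
  obtain i where i: "i \<le> n" "Var i \<notin> P'" using insert.prems(2)[of P'] by auto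
  define w :: "'k mpoly" where "w = Var i"
  have w: "w \<in> forms n 1" "w \<notin> P'" using i Var_forms[of i n] by (auto simp: w_def)
  show ?case
  proof (cases "v \<in> P'")
    case False
    then show ?thesis using v by auto
  next
    case True
    have "finite {c. w + Const c * v \<in> P}" if P: "P \<in> PP" for P
    proof (cases "{c. w + Const c * v \<in> P} = {}")
      case False
      then obtain c where c: "w + Const c * v \<in> P" by blast
      have hP: "hideal n P" using insert.prems(1) P by auto
      have "c' = c" if c': "w + Const c' * v \<in> P" for c'
      proof (rule ccontr)
        assume ne: "c' \<noteq> c"
        have "(w + Const c' * v) - (w + Const c * v) \<in> P" by (rule hideal_diff[OF hP c' c])
        then have "Const (c' - c) * v \<in> P" by (simp add: Const_diff algebra_simps)
        then have "Const (inverse (c' - c)) * (Const (c' - c) * v) \<in> P"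
          by (rule hideal_mult[OF hP Const_polys])
        then have "(Const (inverse (c' - c)) * Const (c' - c)) * v \<in> P" by (simp only: mult.assoc)
        moreover have "Const (inverse (c' - c)) * Const (c' - c) = 1"
          using ne by (simp flip: Const_mult)
        ultimately have "v \<in> P" by (simp only: mult_1_left)
        then show False using v(2)[OF P] by simp
      qed
      then have "{c. w + Const c * v \<in> P} \<subseteq> {c}" by blast
      then show ?thesis by (rule finite_subset) simp
    qed simp
    then have "finite (\<Union>P\<in>PP. {c. w + Const c * v \<in> P})" using insert.hyps by blast
    then obtain c where c: "c \<notin> (\<Union>P\<in>PP. {c. w + Const c * v \<in> P})"
      using inf ex_new_if_finite by blast
    have "w + Const c * v \<notin> P'"
    proof
      assume a: "w + Const c * v \<in> P'"
      have hP: "hideal n P'" using insert.prems(1) by auto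
      have "(w + Const c * v) - Const c * v \<in> P'"
        by (rule hideal_diff[OF hP a hideal_mult[OF hP _ True]]) simp
      then show False using w by simp
    qed
    moreover have "w + Const c * v \<in> forms n 1"
      using forms_add[OF w(1)] forms_mult[OF Const_forms v(1)] by simp
    ultimately show ?thesis using c by auto
  qed
qed

lemma nonzerodiv_formI:
  assumes I: "hideal n I" and l: "l \<in> forms n d"
    and *: "\<And>k a. a \<in> forms n k \<Longrightarrow> l * a \<in> I \<Longrightarrow> a \<in> I"
  shows "nonzerodiv n I l"
  unfolding nonzerodiv_def
proof (intro ballI impI)
  fix a assume a: "a \<in> polys n" "l * a \<in> I"
  have "hcomp k a \<in> I" for k
    using *[OF hcomp_in_forms[OF a(1)], of k] hideal_hcomp[OF I a(2), of "k + d"] by (simp add: hcomp_form_mult[OF l a(1)])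
  then show "a \<in> I" using hideal_hcomp_iff[OF I] by blast
qed

text \<open>A linear form outside the maximal annihilators of both quotients; it is taken for two ideals at once
because the exchange argument has to replace elements of two regular sequences by the same form.\<close>

lemma common_linear_nonzerodiv:
  fixes I I' :: "'k::field mpoly set"
  assumes inf: "infinite (UNIV :: 'k set)"
    and I: "hideal n I" "socle n I \<subseteq> I" and I': "hideal n I'" "socle n I' \<subseteq> I'"
  obtains l where "l \<in> forms n 1" "nonzerodiv n I l" "nonzerodiv n I' l"
proof -
  have "\<exists>l\<in>forms n 1. \<forall>P\<in>max_colons n I \<union> max_colons n I'. l \<notin> P"
    by (rule linear_form_avoiding[OF inf])
       (use finite_max_colons[OF I(1)] finite_max_colons[OF I'(1)] max_colons_hideal[OF I(1)] max_colons_hideal[OF I'(1)]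
          max_colons_misses_variable[OF I(2)] max_colons_misses_variable[OF I'(2)] in auto)
  then obtain l where l: "l \<in> forms n 1" "\<And>P. P \<in> max_colons n I \<union> max_colons n I' \<Longrightarrow> l \<notin> P" by blast
  have "nonzerodiv n I0 l" if I0: "hideal n I0" "\<And>P. P \<in> max_colons n I0 \<Longrightarrow> l \<notin> P" for I0
  proof (rule nonzerodiv_formI[OF I0(1) l(1)], rule ccontr)
    fix k a assume a: "a \<in> forms n k" "l * a \<in> I0" "a \<notin> I0"
    then obtain P where "P \<in> max_colons n I0" "colon_by n I0 a \<subseteq> P" using max_colons_cover[OF I0(1)] by blast
    moreover have "l \<in> colon_by n I0 a" using a forms_polys[OF l(1)] by (simp add: colon_by_def)
    ultimately show False using I0(2) by blast
  qed
  then show thesis using that l I I' by auto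
qed

lemma infinite_alg_closed_field: "infinite (UNIV :: 'k::alg_closed_field set)"
proof
  assume fin: "finite (UNIV :: 'k set)"
  define p :: "'k poly" where "p = (\<Prod>a\<in>UNIV. [:- a, 1:]) + 1"
  have "degree (\<Prod>a\<in>(UNIV :: 'k set). [:- a, 1:]) = card (UNIV :: 'k set)"
    by (subst degree_prod_eq_sum_degree) auto
  then have "degree p > 0" using fin unfolding p_def
    by (subst degree_add_eq_left) (auto simp: finite_UNIV_card_ge_0)
  then obtain x where "poly p x = 0" using alg_closed_imp_poly_has_root by blast
  moreover have "poly p x = 1" using fin by (auto simp: p_def poly_prod)
  ultimately show False by simp
qed

section \<open>Socles and regular sequences\<close>

text \<open>Every monomial of positive degree is divisible by a variable.\<close>

lemma socle_mult:
  assumes I: "hideal n I" and y: "y \<in> socle n I" and f: "f \<in> forms n d" and d: "d > 0"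
  shows "f * y \<in> I"
proof -
  have "single m c * y \<in> I" if m: "m \<in> keys f" for m c
  proof -
    have md: "keys m \<subseteq> {0..n}" "int (mon_degree m) = d" using f m by (auto simp: forms_def polys_def)
    then have "keys m \<noteq> {}" using d by (auto simp: mon_degree_def)
    then obtain i where i: "i \<in> keys m" by blast
    define m' where "m' = m - single i 1"
    have mm: "m = single i 1 + m'"
      by (rule poly_mapping_eqI)
         (use i in \<open>auto simp: m'_def lookup_add lookup_minus lookup_single when_def in_keys_iff\<close>)
    then have "keys m' \<subseteq> {0..n}" using md(1) by (auto simp: keys_mon_add)
    then have p: "single m' c \<in> polys n" by (simp add: polys_def)
    have "Var i * y \<in> I" using y i md(1) by (auto simp: socle_def)
    then have "single m' c * (Var i * y) \<in> I" by (rule hideal_mult[OF I p])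
    moreover have "single m c = single m' c * Var i" by (simp add: mm Var_def mult_single add.commute)
    ultimately show ?thesis by (simp add: mult.assoc)
  qed
  then have "(\<Sum>m\<in>keys f. single m (lookup f m) * y) \<in> I" by (intro hideal_sum[OF I])
  moreover have "f * y = (\<Sum>m\<in>keys f. single m (lookup f m) * y)"
    using sum_monomials[of f] by (simp flip: sum_distrib_right)
  ultimately show ?thesis by simp
qed

lemma socle_trivial:
  assumes I: "hideal n I" and f: "f \<in> forms n d" "d > 0" "nonzerodiv n I f"
  shows "socle n I \<subseteq> I"
proof
  fix y assume y: "y \<in> socle n I"
  then show "y \<in> I" using socle_mult[OF I y f(1,2)] f(3) by (simp add: socle_def nonzerodiv_def)
qed

text \<open>The usual permutability of regular sequences of forms. If \<open>u a \<in> Q\<close>, then \<open>a = f a'\<close> modulo \<open>Q\<close> with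
\<open>u a' \<in> Q\<close> and \<open>a'\<close> of smaller degree, so induction on the degree replaces the intersection of the
powers of \<open>f\<close>.\<close>

lemma nonzerodiv_swap:
  assumes Q: "hideal n Q" and f: "f \<in> forms n d" "d > 0" "nonzerodiv n Q f"
    and u: "u \<in> forms n e" "nonzerodiv n (adjoin n Q f) u"
  shows "nonzerodiv n Q u" "nonzerodiv n (adjoin n Q u) f"
proof -
  note fp = forms_polys[OF f(1)] and up = forms_polys[OF u(1)]
  have "a \<in> Q" if "a \<in> forms n k" "u * a \<in> Q" for a k
    using that
  proof (induction "nat (k + 1)" arbitrary: a k rule: less_induct)
    case less
    note ap = forms_polys[OF less.prems(1)]
    show ?case
    proof (cases "k < 0")
      case True
      then show ?thesis using forms_negative less.prems(1) hideal_0[OF Q] by metis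
    next
      case False
      have "u * a \<in> adjoin n Q f" using less.prems(2) adjoin_mono[OF Q] by blast
      then have "a \<in> adjoin n Q f" using u(2) ap by (simp add: nonzerodiv_def)
      then obtain a1 where a1: "a1 \<in> forms n (k - d)" "a - f * a1 \<in> Q"
        by (rule adjoin_form_witness[OF Q f(1) less.prems(1)])
      have "u * a - u * (a - f * a1) \<in> Q"
        by (rule hideal_diff[OF Q less.prems(2) hideal_mult[OF Q up a1(2)]])
      then have "f * (u * a1) \<in> Q" by (simp add: algebra_simps)
      then have "u * a1 \<in> Q" using f(3) polys_mult[OF up forms_polys[OF a1(1)]] by (simp add: nonzerodiv_def)
      then have "a1 \<in> Q" using less.hyps[of "k - d" a1] a1(1) False f(2) by simp
      then show ?thesis using hideal_cong[OF Q a1(2)] hideal_mult[OF Q fp] by simp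
    qed
  qed
  then show "nonzerodiv n Q u" by (rule nonzerodiv_formI[OF Q u(1)])
  show "nonzerodiv n (adjoin n Q u) f"
    unfolding nonzerodiv_def
  proof (intro ballI impI)
    fix a assume a: "a \<in> polys n" "f * a \<in> adjoin n Q u"
    then obtain b where b: "b \<in> polys n" "f * a - u * b \<in> Q" by (auto simp: adjoin_iff)
    have "- (f * a - u * b) \<in> Q" by (rule hideal_uminus[OF Q b(2)])
    then have "u * b \<in> adjoin n Q f" using a(1) by (intro adjoinI[of a]) (simp_all add: algebra_simps)
    then have "b \<in> adjoin n Q f" using u(2) b(1) by (simp add: nonzerodiv_def)
    then obtain b' where b': "b' \<in> polys n" "b - f * b' \<in> Q" by (auto simp: adjoin_iff)
    have "(f * a - u * b) + u * (b - f * b') \<in> Q"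
      by (rule hideal_add[OF Q b(2) hideal_mult[OF Q up b'(2)]])
    then have "f * (a - u * b') \<in> Q" by (simp add: algebra_simps)
    then have "a - u * b' \<in> Q" using f(3) a(1) polys_mult[OF up b'(1)] by (simp add: nonzerodiv_def polys_diff)
    then show "a \<in> adjoin n Q u" by (rule adjoinI[OF b'(1)])
  qed
qed

text \<open>A homogeneous regular sequence modulo \<open>Q\<close>; each form is listed with its degree, which a zero form does not determine.\<close>

primrec regular_forms :: "nat \<Rightarrow> 'k::field mpoly set \<Rightarrow> ('k mpoly \<times> nat) list \<Rightarrow> bool" where
  "regular_forms n Q [] \<longleftrightarrow> True"
| "regular_forms n Q (f # fs) \<longleftrightarrow> fst f \<in> forms n (int (snd f)) \<and> snd f > 0 \<and>
     nonzerodiv n Q (fst f) \<and> regular_forms n (adjoin n Q (fst f)) fs"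

definition adjoin_all :: "nat \<Rightarrow> 'k::field mpoly set \<Rightarrow> ('k mpoly \<times> nat) list \<Rightarrow> 'k mpoly set" where
  "adjoin_all n Q fs = foldl (adjoin n) Q (map fst fs)"

lemma adjoin_all_simps [simp]: "adjoin_all n Q [] = Q" "adjoin_all n Q (f # fs) = adjoin_all n (adjoin n Q (fst f)) fs"
  by (simp_all add: adjoin_all_def)

lemma adjoin_all_snoc: "adjoin_all n Q (fs @ [f]) = adjoin n (adjoin_all n Q fs) (fst f)"
  by (simp add: adjoin_all_def)

lemma regular_forms_snoc:
  "regular_forms n Q (fs @ [f]) \<longleftrightarrow> regular_forms n Q fs \<and> fst f \<in> forms n (int (snd f)) \<and> snd f > 0 \<and>
    nonzerodiv n (adjoin_all n Q fs) (fst f)"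
  by (induction fs arbitrary: Q) auto

lemma hideal_adjoin_all: "hideal n Q \<Longrightarrow> regular_forms n Q fs \<Longrightarrow> hideal n (adjoin_all n Q fs)"
  by (induction fs arbitrary: Q) (auto intro: hideal_adjoin)

lemma adjoin_all_commute: "adjoin_all n (adjoin n Q u) fs = adjoin n (adjoin_all n Q fs) u"
proof (induction fs arbitrary: Q)
  case (Cons f fs)
  show ?case using Cons[of "adjoin n Q (fst f)"] by (simp add: adjoin_commute[of n Q u])
qed simp

lemma regular_forms_move_to_front:
  assumes "hideal n Q" "regular_forms n Q fs" "u \<in> forms n e" "nonzerodiv n (adjoin_all n Q fs) u"
  shows "nonzerodiv n Q u \<and> regular_forms n (adjoin n Q u) fs"
  using assms
proof (induction fs arbitrary: Q)
  case (Cons f fs)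
  have f: "fst f \<in> forms n (int (snd f))" "int (snd f) > 0" "nonzerodiv n Q (fst f)" "regular_forms n (adjoin n Q (fst f)) fs"
    using Cons.prems by auto
  have IH: "nonzerodiv n (adjoin n Q (fst f)) u" "regular_forms n (adjoin n (adjoin n Q (fst f)) u) fs"
    using Cons.IH[OF hideal_adjoin[OF Cons.prems(1) f(1)] f(4) Cons.prems(3)] Cons.prems(4) by auto
  show ?case
    using nonzerodiv_swap[OF Cons.prems(1) f(1,2,3) Cons.prems(3) IH(1)] IH(2) f(1,2) by (simp add: adjoin_commute)
qed simp

text \<open>The relation \<open>g w = f w'\<close> modulo \<open>I\<close> between \<open>w\<close> modulo \<open>(I, f)\<close> and \<open>w'\<close> modulo \<open>(I, g)\<close> is
symmetric in the two sides; it respects zero because \<open>f\<close> can be cancelled modulo \<open>I\<close>.\<close>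

lemma exchange_adjoin:
  assumes I: "hideal n I" and f: "f \<in> polys n" "nonzerodiv n I f" and g: "g \<in> polys n"
    and w: "w' \<in> polys n" "g * w - f * w' \<in> I" "w \<in> adjoin n I f"
  shows "w' \<in> adjoin n I g"
proof -
  obtain a where a: "a \<in> polys n" "w - f * a \<in> I" using w by (auto simp: adjoin_iff)
  have "g * (w - f * a) - (g * w - f * w') \<in> I"
    by (rule hideal_diff[OF I hideal_mult[OF I g a(2)] w(2)])
  then have "f * (w' - g * a) \<in> I" by (simp add: algebra_simps)
  then have "w' - g * a \<in> I" using f(2) w(1) a(1) g by (simp add: nonzerodiv_def polys_diff polys_mult)
  then show ?thesis by (rule adjoinI[OF a(1)])
qed

lemma exchange_socle:
  assumes I: "hideal n I" and f: "f \<in> polys n" "nonzerodiv n I f" and g: "g \<in> polys n"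
    and w: "w' \<in> polys n" "g * w - f * w' \<in> I" "w \<in> socle n (adjoin n I f)"
  shows "w' \<in> socle n (adjoin n I g)"
proof -
  have "Var i * w' \<in> adjoin n I g" if i: "i \<le> n" for i
  proof (rule exchange_adjoin[OF I f g])
    show "Var i * w' \<in> polys n" by (rule polys_mult[OF Var_polys[OF i] w(1)])
    have "Var i * (g * w - f * w') \<in> I" by (rule hideal_mult[OF I Var_polys[OF i] w(2)])
    then show "g * (Var i * w) - f * (Var i * w') \<in> I" by (simp add: algebra_simps)
    show "Var i * w \<in> adjoin n I f" using w(3) i by (simp add: socle_def)
  qed
  then show ?thesis using w(1) by (simp add: socle_def)
qed

text \<open>The socle of \<open>S/I\<close> is spanned by the class of \<open>y\<close>, which may be zero.\<close>

definition cyclic_socle :: "nat \<Rightarrow> 'k::field mpoly set \<Rightarrow> 'k mpoly \<Rightarrow> bool" where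
  "cyclic_socle n I y \<longleftrightarrow> y \<in> socle n I \<and> (\<forall>v\<in>socle n I. \<exists>c. v - Const c * y \<in> I)"

text \<open>A socle element \<open>y\<close> of \<open>S/(I, f)\<close> has \<open>g y \<in> (I, f)\<close>, because \<open>g\<close> has positive degree; so \<open>y\<close>
has a partner \<open>y'\<close>. The same applies to the socle elements of \<open>S/(I, g)\<close>, hence the two socles correspond.\<close>

lemma exchange_cyclic_socle:
  assumes I: "hideal n I" and f: "f \<in> forms n d" "d > 0" "nonzerodiv n I f"
    and g: "g \<in> forms n e" "e > 0" "nonzerodiv n I g"
    and y: "y \<in> forms n s" "cyclic_socle n (adjoin n I f) y"
  obtains y' where "y' \<in> forms n (s + e - d)" "cyclic_socle n (adjoin n I g) y'"
    "y' \<in> adjoin n I g \<longleftrightarrow> y \<in> adjoin n I f"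
proof -
  note fp = forms_polys[OF f(1)] and gp = forms_polys[OF g(1)] and yp = forms_polys[OF y(1)]
  have ys: "y \<in> socle n (adjoin n I f)" using y(2) by (simp add: cyclic_socle_def)
  have "g * y \<in> adjoin n I f" by (rule socle_mult[OF hideal_adjoin[OF I f(1)] ys g(1,2)])
  then obtain y' where y': "y' \<in> forms n (e + s - d)" "g * y - f * y' \<in> I"
    by (rule adjoin_form_witness[OF I f(1) forms_mult[OF g(1) y(1)]])
  note yp' = forms_polys[OF y'(1)]
  have y's: "y' \<in> socle n (adjoin n I g)" by (rule exchange_socle[OF I fp f(3) gp yp' y'(2) ys])
  have r: "f * y' - g * y \<in> I" using hideal_uminus[OF I y'(2)] by simp
  have iff: "y' \<in> adjoin n I g \<longleftrightarrow> y \<in> adjoin n I f"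
    using exchange_adjoin[OF I fp f(3) gp yp' y'(2)] exchange_adjoin[OF I gp g(3) fp yp r] by blast
  have "\<exists>c. v - Const c * y' \<in> adjoin n I g" if v: "v \<in> socle n (adjoin n I g)" for v
  proof -
    have vp: "v \<in> polys n" using v by (simp add: socle_def)
    have "f * v \<in> adjoin n I g" by (rule socle_mult[OF hideal_adjoin[OF I g(1)] v f(1,2)])
    then obtain v' where v': "v' \<in> polys n" "f * v - g * v' \<in> I" by (auto simp: adjoin_iff)
    have "v' \<in> socle n (adjoin n I f)" by (rule exchange_socle[OF I gp g(3) fp v' v])
    then obtain c where c: "v' - Const c * y \<in> adjoin n I f" using y(2) by (auto simp: cyclic_socle_def)
    have "v - Const c * y' \<in> adjoin n I g"
    proof (rule exchange_adjoin[OF I fp f(3) gp _ _ c])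
      show "v - Const c * y' \<in> polys n" using vp yp' by (simp add: polys_diff polys_mult)
      have "- (f * v - g * v') - Const c * (g * y - f * y') \<in> I"
        by (rule hideal_diff[OF I hideal_uminus[OF I v'(2)] hideal_mult[OF I Const_polys y'(2)]])
      then show "g * (v' - Const c * y) - f * (v - Const c * y') \<in> I" by (simp add: algebra_simps)
    qed
    then show ?thesis by blast
  qed
  then show thesis
    using that[of y'] y'(1) y's iff by (simp add: cyclic_socle_def add.commute)
qed

text \<open>A homogeneous linear system with more unknowns than equations has a nontrivial solution; the proof eliminates one unknown.\<close>

lemma nontrivial_relation:
  fixes w :: "'i \<Rightarrow> 'b \<Rightarrow> 'k::field"
  assumes "finite B" "finite A" "card B < card A"
  shows "\<exists>c. (\<exists>i\<in>A. c i \<noteq> 0) \<and> (\<forall>b\<in>B. (\<Sum>i\<in>A. c i * w i b) = 0)"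
  using assms
proof (induction B arbitrary: A w rule: finite_induct)
  case empty
  then have "A \<noteq> {}" by auto
  then show ?case by (intro exI[of _ "\<lambda>_. 1"]) auto
next
  case (insert b B)
  show ?case
  proof (cases "\<exists>p\<in>A. w p b \<noteq> 0")
    case False
    have "card B < card A" using insert.prems insert.hyps by simp
    then obtain c where "\<exists>i\<in>A. c i \<noteq> 0" "\<forall>b\<in>B. (\<Sum>i\<in>A. c i * w i b) = 0"
      using insert.IH[OF insert.prems(1), of w] by blast
    then show ?thesis using False by (intro exI[of _ c]) auto
  next
    case True
    then obtain p where p: "p \<in> A" "w p b \<noteq> 0" by blast
    define w' where "w' i x = w i x - w i b / w p b * w p x" for i x
    have "card B < card (A - {p})" using insert.prems insert.hyps p by simp
    then obtain c where c: "\<exists>i\<in>A - {p}. c i \<noteq> 0" "\<forall>x\<in>B. (\<Sum>i\<in>A - {p}. c i * w' i x) = 0"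
      using insert.IH[of "A - {p}" w'] insert.prems by auto
    define c' where "c' i = (if i = p then - (\<Sum>i\<in>A - {p}. c i * (w i b / w p b)) else c i)" for i
    have eq: "(\<Sum>i\<in>A. c' i * w i x) = (\<Sum>i\<in>A - {p}. c i * w' i x)" for x
    proof -
      have "(\<Sum>i\<in>A. c' i * w i x) = c' p * w p x + (\<Sum>i\<in>A - {p}. c' i * w i x)"
        using p(1) insert.prems(1) by (simp add: sum.remove)
      also have "(\<Sum>i\<in>A - {p}. c' i * w i x) = (\<Sum>i\<in>A - {p}. c i * w i x)"
        by (rule sum.cong) (auto simp: c'_def)
      also have "c' p * w p x = - (\<Sum>i\<in>A - {p}. c i * (w i b / w p b) * w p x)"
        by (simp add: c'_def sum_distrib_right)
      finally show ?thesis by (simp add: w'_def algebra_simps sum_subtractf)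
    qed
    have "w' i b = 0" for i using p(2) by (simp add: w'_def)
    then have "(\<Sum>i\<in>A. c' i * w i x) = 0" if "x \<in> insert b B" for x
      using that c(2) unfolding eq by auto
    moreover have "\<exists>i\<in>A. c' i \<noteq> 0" using c(1) by (auto simp: c'_def)
    ultimately show ?thesis by blast
  qed
qed

lemma form_expansion:
  assumes "p \<in> forms n (int d)"
  shows "p = (\<Sum>m\<in>monomials n d. Const (lookup p m) * single m 1)"
proof -
  have "p = (\<Sum>m\<in>keys p. single m (lookup p m))" by (rule sum_monomials)
  also have "\<dots> = (\<Sum>m\<in>monomials n d. single m (lookup p m))"
    by (rule sum.mono_neutral_left) (use keys_form[OF assms] in \<open>auto simp: in_keys_iff\<close>)
  finally show ?thesis by (simp add: Const_mult_single)
qed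

text \<open>\<open>S/I\<close> vanishes in all large degrees, hence is finite-dimensional over the field.\<close>

definition fin_length :: "nat \<Rightarrow> 'k::field mpoly set \<Rightarrow> bool" where
  "fin_length n I \<longleftrightarrow> (\<exists>k0. \<forall>k\<ge>k0. forms n k \<subseteq> I)"

lemma divide_by_linear_power:
  assumes I: "hideal n I" and u: "u \<in> forms n 1" and k0: "\<forall>k\<ge>k0. forms n k \<subseteq> adjoin n I u"
    and v: "v \<in> forms n (k + int j)" and k: "k \<ge> k0"
  shows "\<exists>w\<in>forms n k. v - u ^ j * w \<in> I"
  using v
proof (induction j arbitrary: v)
  case 0
  then show ?case by (intro bexI[of _ v]) (auto simp: hideal_0[OF I])
next
  case (Suc j)
  have "forms n (k + int (Suc j)) \<subseteq> adjoin n I u" by (rule k0[rule_format]) (use k in simp)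
  then have "v \<in> adjoin n I u" using Suc.prems by blast
  then obtain a where a: "a \<in> forms n (k + int (Suc j) - 1)" "v - u * a \<in> I"
    by (rule adjoin_form_witness[OF I u Suc.prems])
  then obtain w where w: "w \<in> forms n k" "a - u ^ j * w \<in> I" using Suc.IH[of a] by auto
  have "(v - u * a) + u * (a - u ^ j * w) \<in> I"
    by (rule hideal_add[OF I a(2) hideal_mult[OF I forms_polys[OF u] w(2)]])
  then show ?case using w(1) by (intro bexI[of _ w]) (simp_all add: algebra_simps)
qed

text \<open>In large degrees multiplication by \<open>u\<close> is bijective on \<open>S/I\<close>, so \<open>f/u\<^sup>d\<close> acts there as an injective
endomorphism of a finite-dimensional space and is surjective. Without inverting \<open>u\<close>: for a form
\<open>v0\<close> the \<open>N + 1\<close> products \<open>u\<^bsup>d(N-i)\<^esup> f\<^sup>i v0\<close> lie, modulo \<open>I\<close>, in a space of dimension at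
most \<open>N\<close>, so they satisfy a relation; cancelling from it the lowest power of \<open>f\<close> shows
\<open>v0 \<in> (I, f)\<close>.\<close>

lemma exchange_fin_length:
  fixes I :: "'k::field mpoly set"
  assumes I: "hideal n I" and u: "u \<in> forms n 1" "nonzerodiv n I u" and f: "f \<in> forms n (int d)" "nonzerodiv n I f"
    and fin: "fin_length n (adjoin n I u)"
  shows "fin_length n (adjoin n I f)"
proof -
  obtain k0' where k0': "\<forall>k\<ge>k0'. forms n k \<subseteq> adjoin n I u" using fin by (auto simp: fin_length_def)
  define k0 where "k0 = max k0' 0"
  have k0: "\<forall>k\<ge>k0. forms n k \<subseteq> adjoin n I u" "k0 \<ge> 0" using k0' by (auto simp: k0_def)
  note up = forms_polys[OF u(1)] and fp = forms_polys[OF f(1)]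
  have hf: "hideal n (adjoin n I f)" by (rule hideal_adjoin[OF I f(1)])
  have "v0 \<in> adjoin n I f" if k: "k \<ge> k0 + int d" and v0: "v0 \<in> forms n k" for k v0
  proof -
    note v0p = forms_polys[OF v0]
    define N where "N = card (monomials n (nat k))"
    have kn: "k = int (nat k)" using k k0(2) by simp
    define z where "z i = u ^ (d * (N - i)) * (f ^ i * v0)" for i
    have zf: "z i \<in> forms n (k + int (d * N))" if "i \<le> N" for i
    proof -
      have "int (d * (N - i)) * 1 + (int i * int d + k) = k + int (d * N)"
        using that by (simp add: of_nat_diff algebra_simps)
      moreover have "z i \<in> forms n (int (d * (N - i)) * 1 + (int i * int d + k))" unfolding z_def
        by (rule forms_mult[OF forms_power[OF u(1)] forms_mult[OF forms_power[OF f(1)] v0]])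
      ultimately show ?thesis by (simp only:)
    qed
    have "\<exists>w. w \<in> forms n k \<and> z i - u ^ (d * N) * w \<in> I" if "i \<in> {..N}" for i
      using divide_by_linear_power[OF I u(1) k0(1) zf[of i]] that k by auto
    then obtain w where w: "\<And>i. i \<in> {..N} \<Longrightarrow> w i \<in> forms n k"
        "\<And>i. i \<in> {..N} \<Longrightarrow> z i - u ^ (d * N) * w i \<in> I"
      by metis
    obtain c where c: "\<exists>i\<in>{..N}. c i \<noteq> 0"
      and rel: "\<And>m. m \<in> monomials n (nat k) \<Longrightarrow> (\<Sum>i\<in>{..N}. c i * lookup (w i) m) = 0"
      using nontrivial_relation[of "monomials n (nat k)" "{..N}" "\<lambda>i. lookup (w i)"] by (auto simp: N_def)
    have "(\<Sum>i\<le>N. Const (c i) * w i) = 0"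
    proof (rule poly_mapping_eqI)
      fix m
      have "lookup (\<Sum>i\<le>N. Const (c i) * w i) m = (\<Sum>i\<le>N. c i * lookup (w i) m)"
        unfolding lookup_sum Const_def
        by (rule sum.cong) (use lookup_single_mult[of 0 _ _ m] in simp_all)
      also have "\<dots> = 0"
      proof (cases "m \<in> monomials n (nat k)")
        case False
        have "lookup (w i) m = 0" if i: "i \<in> {..N}" for i
        proof -
          have "w i \<in> forms n (int (nat k))" using w(1)[OF i] kn by simp
          then have "m \<notin> keys (w i)" using keys_form[of "w i" n "nat k"] False by blast
          then show ?thesis by (simp add: in_keys_iff)
        qed
        then show ?thesis by (intro sum.neutral) simp
      qed (rule rel)
      finally show "lookup (\<Sum>i\<le>N. Const (c i) * w i) m = lookup 0 m" by simp
    qed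
    then have "(\<Sum>i\<le>N. Const (c i) * z i) = (\<Sum>i\<le>N. Const (c i) * z i) - u ^ (d * N) * (\<Sum>i\<le>N. Const (c i) * w i)"
      by simp
    also have "\<dots> = (\<Sum>i\<le>N. Const (c i) * (z i - u ^ (d * N) * w i))"
      by (simp add: sum_distrib_left sum_subtractf algebra_simps)
    also have "\<dots> \<in> I"
      by (intro hideal_sum[OF I] hideal_mult[OF I Const_polys] w(2))
    finally have sumz: "(\<Sum>i\<le>N. Const (c i) * z i) \<in> I" .
    \<comment> \<open>the term with the lowest power of \<open>f\<close> that really occurs\<close>
    define i0 where "i0 = (LEAST i. i \<le> N \<and> c i \<noteq> 0)"
    have i0: "i0 \<le> N" "c i0 \<noteq> 0" using LeastI_ex[of "\<lambda>i. i \<le> N \<and> c i \<noteq> 0"] c by (auto simp: i0_def)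
    have lowest: "c i = 0" if "i < i0" for i using not_less_Least[of i "\<lambda>i. i \<le> N \<and> c i \<noteq> 0"] that i0(1)
      by (auto simp: i0_def)
    define t where "t = (\<Sum>i\<in>{i0<..N}. Const (c i) * (u ^ (d * (N - i)) * (f ^ (i - Suc i0) * v0)))"
    have tp: "t \<in> polys n" unfolding t_def
      by (intro polys_sum polys_mult polys_power up fp v0p Const_polys)
    have "{..N} = {..<i0} \<union> {i0} \<union> {i0<..N}" using i0(1) by auto
    then have "(\<Sum>i\<le>N. Const (c i) * z i) = (\<Sum>i<i0. Const (c i) * z i) + Const (c i0) * z i0
         + (\<Sum>i\<in>{i0<..N}. Const (c i) * z i)"
      by (simp only:) (subst sum.union_disjoint; force)+
    also have "(\<Sum>i<i0. Const (c i) * z i) = 0" using lowest by (intro sum.neutral) simp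
    also have "(\<Sum>i\<in>{i0<..N}. Const (c i) * z i) = f ^ i0 * (f * t)"
    proof -
      have "z i = f ^ i0 * (f * (u ^ (d * (N - i)) * (f ^ (i - Suc i0) * v0)))" if "i \<in> {i0<..N}" for i
      proof -
        have "i = i0 + Suc (i - Suc i0)" using that by simp
        then have "f ^ i = f ^ i0 * (f * f ^ (i - Suc i0))" by (metis power_add power_Suc)
        then show ?thesis by (simp add: z_def ac_simps)
      qed
      then show ?thesis unfolding t_def sum_distrib_left by (intro sum.cong) (auto simp: ac_simps)
    qed
    finally have "(\<Sum>i\<le>N. Const (c i) * z i) = f ^ i0 * (Const (c i0) * (u ^ (d * (N - i0)) * v0) + f * t)"
      by (simp add: z_def algebra_simps)
    then have "f ^ i0 * (Const (c i0) * (u ^ (d * (N - i0)) * v0) + f * t) \<in> I" using sumz by simp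
    then have "Const (c i0) * (u ^ (d * (N - i0)) * v0) + f * t \<in> I"
      using nonzerodiv_power[OF fp f(2), of i0] unfolding nonzerodiv_def
      by (blast intro: polys_add polys_mult polys_power up fp v0p tp Const_polys)
    then have "Const (c i0) * (u ^ (d * (N - i0)) * v0) \<in> adjoin n I f"
      by (intro adjoinI[of "- t"]) (simp_all add: tp polys_uminus)
    then have "Const (inverse (c i0)) * (Const (c i0) * (u ^ (d * (N - i0)) * v0)) \<in> adjoin n I f"
      by (rule hideal_mult[OF hf Const_polys])
    then have "(Const (inverse (c i0)) * Const (c i0)) * (u ^ (d * (N - i0)) * v0) \<in> adjoin n I f"
      by (simp only: mult.assoc)
    moreover have "Const (inverse (c i0)) * Const (c i0) = 1" using i0(2) by (simp flip: Const_mult)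
    ultimately have uv: "u ^ (d * (N - i0)) * v0 \<in> adjoin n I f" by (simp only: mult_1_left)
    \<comment> \<open>the power of \<open>u\<close> is cancelled too: the margin \<open>d\<close> in the bound on \<open>k\<close> makes the cofactor of \<open>f\<close> divisible by it\<close>
    define j where "j = d * (N - i0)"
    have ujv: "u ^ j * v0 \<in> forms n (int j + k)" using forms_mult[OF forms_power[OF u(1), of j] v0] by simp
    obtain a where a: "a \<in> forms n (int j + k - int d)" "u ^ j * v0 - f * a \<in> I"
      using adjoin_form_witness[OF I f(1) ujv] uv by (auto simp: j_def)
    have "a \<in> forms n ((k - int d) + int j)" using a(1) by (simp add: algebra_simps)
    then obtain a' where a': "a' \<in> forms n (k - int d)" "a - u ^ j * a' \<in> I"
      using divide_by_linear_power[OF I u(1) k0(1)] k by force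
    have "(u ^ j * v0 - f * a) + f * (a - u ^ j * a') \<in> I"
      by (rule hideal_add[OF I a(2) hideal_mult[OF I fp a'(2)]])
    then have "u ^ j * (v0 - f * a') \<in> I" by (simp add: algebra_simps)
    then have "v0 - f * a' \<in> I" using nonzerodiv_power[OF up u(2), of j] unfolding nonzerodiv_def
      by (blast intro: polys_diff polys_mult fp v0p forms_polys[OF a'(1)])
    then show ?thesis by (rule adjoinI[OF forms_polys[OF a'(1)]])
  qed
  then show ?thesis unfolding fin_length_def by blast
qed

text \<open>For \<open>b = True\<close>: \<open>S/I\<close> has finite length and its socle is one-dimensional, in degree \<open>s\<close>. For
\<open>b = False\<close>: the socle is zero. The two cases are treated together because they are exchanged in
the same way.\<close>

definition socle_type :: "nat \<Rightarrow> bool \<Rightarrow> 'k::field mpoly set \<Rightarrow> int \<Rightarrow> bool" where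
  "socle_type n b I s \<longleftrightarrow> (\<exists>y\<in>forms n s. cyclic_socle n I y \<and> (y \<notin> I \<longleftrightarrow> b)) \<and> (b \<longrightarrow> fin_length n I)"

lemma socle_type_exchange:
  assumes I: "hideal n I" and u: "u \<in> forms n 1" "nonzerodiv n I u"
    and f: "f \<in> forms n (int d)" "d > 0" "nonzerodiv n I f"
    and socle_type: "socle_type n b (adjoin n I u) s"
  shows "socle_type n b (adjoin n I f) (s + (int d - 1))"
proof -
  obtain y where y: "y \<in> forms n s" "cyclic_socle n (adjoin n I u) y" "y \<notin> adjoin n I u \<longleftrightarrow> b"
    using socle_type by (auto simp: socle_type_def)
  obtain y' where "y' \<in> forms n (s + int d - 1)" "cyclic_socle n (adjoin n I f) y'"
      "y' \<in> adjoin n I f \<longleftrightarrow> y \<in> adjoin n I u"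
    by (rule exchange_cyclic_socle[OF I u(1) _ u(2) f(1) _ f(3) y(1,2)]) (use f(2) in auto)
  then have "\<exists>y\<in>forms n (s + (int d - 1)). cyclic_socle n (adjoin n I f) y \<and> (y \<notin> adjoin n I f \<longleftrightarrow> b)"
    using y(3) by (intro bexI[of _ y']) (auto simp: algebra_simps)
  moreover have "b \<longrightarrow> fin_length n (adjoin n I f)"
    using exchange_fin_length[OF I u f(1,3)] socle_type by (simp add: socle_type_def)
  ultimately show ?thesis by (simp add: socle_type_def)
qed

text \<open>Let \<open>u\<close> be a linear nonzerodivisor modulo all but the last form of either sequence. Exchange the
last forms for \<open>u\<close>, move \<open>u\<close> to the front, and compare the shorter sequences modulo \<open>(Q, u)\<close> by
induction. Exchanging \<open>u\<close> for a form of degree \<open>d\<close> moves the socle by \<open>d - 1\<close>.\<close>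

lemma socle_type_regular_sequences:
  fixes Q :: "'k::field mpoly set"
  assumes inf: "infinite (UNIV :: 'k set)"
  shows "hideal n Q \<Longrightarrow> regular_forms n Q fs \<Longrightarrow> regular_forms n Q gs \<Longrightarrow> length fs = r \<Longrightarrow> length gs = r \<Longrightarrow>
    (\<And>g. g \<in> set gs \<Longrightarrow> snd g = 1) \<Longrightarrow> socle_type n b (adjoin_all n Q gs) s \<Longrightarrow>
    socle_type n b (adjoin_all n Q fs) (s + (\<Sum>f\<leftarrow>fs. int (snd f) - 1))"
proof (induction r arbitrary: Q fs gs)
  case 0
  then show ?case by simp
next
  case (Suc r)
  obtain fs' f where fs: "fs = fs' @ [f]" "length fs' = r"
    using Suc.prems(4) by (cases fs rule: rev_cases) auto
  obtain gs' g where gs: "gs = gs' @ [g]" "length gs' = r"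
    using Suc.prems(5) by (cases gs rule: rev_cases) auto
  note Q = Suc.prems(1)
  define F G where "F = adjoin_all n Q fs'" and "G = adjoin_all n Q gs'"
  have f: "regular_forms n Q fs'" "fst f \<in> forms n (int (snd f))" "snd f > 0" "nonzerodiv n F (fst f)"
    using Suc.prems(2) by (auto simp: fs regular_forms_snoc F_def)
  have g: "regular_forms n Q gs'" "fst g \<in> forms n 1" "nonzerodiv n G (fst g)"
    using Suc.prems(3) Suc.prems(6)[of g] by (auto simp: gs regular_forms_snoc G_def)
  have F: "hideal n F" and G: "hideal n G"
    using hideal_adjoin_all[OF Q] f(1) g(1) by (auto simp: F_def G_def)
  have "socle n F \<subseteq> F" by (rule socle_trivial[OF F f(2) _ f(4)]) (use f(3) in simp)
  moreover have "socle n G \<subseteq> G" by (rule socle_trivial[OF G g(2) _ g(3)]) simp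
  ultimately obtain u where u: "u \<in> forms n 1" "nonzerodiv n F u" "nonzerodiv n G u"
    using common_linear_nonzerodiv[OF inf F _ G] by blast
  have uQ: "hideal n (adjoin n Q u)" by (rule hideal_adjoin[OF Q u(1)])
  have "socle_type n b (adjoin n G (fst g)) s" using Suc.prems(7) by (simp add: gs adjoin_all_snoc G_def)
  then have "socle_type n b (adjoin n G u) s" using socle_type_exchange[OF G g(2,3), of u 1 b s] u by simp
  then have "socle_type n b (adjoin_all n (adjoin n Q u) gs') s" by (simp add: adjoin_all_commute G_def)
  then have "socle_type n b (adjoin_all n (adjoin n Q u) fs') (s + (\<Sum>f\<leftarrow>fs'. int (snd f) - 1))"
    using Suc.IH[OF uQ _ _ fs(2) gs(2)] regular_forms_move_to_front[OF Q f(1) u(1)] regular_forms_move_to_front[OF Q g(1) u(1)]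
      u Suc.prems(6) by (auto simp: F_def G_def gs)
  then have "socle_type n b (adjoin n F u) (s + (\<Sum>f\<leftarrow>fs'. int (snd f) - 1))" by (simp add: adjoin_all_commute F_def)
  from socle_type_exchange[OF F u(1,2) f(2,3,4) this] show ?case
    by (simp add: fs adjoin_all_snoc F_def algebra_simps)
qed

text \<open>The ideal \<open>(x\<^sub>0, \<dots>, x\<^bsub>j-1\<^esub>)\<close>, described by its monomials.\<close>

definition var_ideal :: "nat \<Rightarrow> nat \<Rightarrow> 'k::field mpoly set" where
  "var_ideal n j = {p \<in> polys n. \<forall>m\<in>keys p. \<exists>i<j. lookup m i \<noteq> 0}"

lemma hideal_var_ideal: "hideal n (var_ideal n j)"
proof (rule hidealI)
  fix a b :: "'a mpoly" assume "a \<in> var_ideal n j" "b \<in> var_ideal n j"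
  then show "a + b \<in> var_ideal n j" using keys_add[of a b] by (auto simp: var_ideal_def polys_add)
next
  fix a b :: "'a mpoly" assume "a \<in> polys n" "b \<in> var_ideal n j"
  then show "a * b \<in> var_ideal n j" using keys_mult[of a b] by (fastforce simp: var_ideal_def polys_mult lookup_add)
next
  fix k and a :: "'a mpoly" assume "a \<in> var_ideal n j"
  then show "hcomp k a \<in> var_ideal n j" by (auto simp: var_ideal_def keys_hcomp intro: forms_polys[OF hcomp_in_forms])
qed (auto simp: var_ideal_def)

lemma nonzerodiv_var_ideal_Var:
  assumes "j \<le> n"
  shows "nonzerodiv n (var_ideal n j) (Var j)"
  unfolding nonzerodiv_def
proof (intro ballI impI)
  fix a :: "'a mpoly" assume a: "a \<in> polys n" "Var j * a \<in> var_ideal n j"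
  have "\<exists>i<j. lookup m i \<noteq> 0" if m: "m \<in> keys a" for m
  proof -
    have "single j 1 + m \<in> keys (Var j * a)"
      using m lookup_single_mult[of "single j 1" 1 a m] by (simp add: Var_def in_keys_iff)
    then obtain i where "i < j" "lookup (single j 1 + m) i \<noteq> 0" using a(2) by (auto simp: var_ideal_def)
    then show ?thesis by (auto simp: lookup_add lookup_single when_def)
  qed
  then show "a \<in> var_ideal n j" using a(1) by (simp add: var_ideal_def)
qed

lemma adjoin_var_ideal_Var:
  assumes j: "j \<le> n"
  shows "adjoin n (var_ideal n j) (Var j) = (var_ideal n (Suc j) :: 'k::field mpoly set)"
proof
  show "adjoin n (var_ideal n j) (Var j) \<subseteq> (var_ideal n (Suc j) :: 'k mpoly set)"
  proof
    fix p :: "'k mpoly" assume "p \<in> adjoin n (var_ideal n j) (Var j)"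
    then obtain q a where p: "p = q + Var j * a" "q \<in> var_ideal n j" "a \<in> polys n" by (auto simp: adjoin_def)
    have key: "\<exists>i<Suc j. lookup m i \<noteq> 0" if "m \<in> keys (Var j * a)" for m
    proof -
      have "m \<in> {x + b | x b. x \<in> keys (Var j :: 'k mpoly) \<and> b \<in> keys a}"
        using that keys_mult[of "Var j" a] by blast
      then obtain b where "m = single j 1 + b" by (auto simp: Var_def)
      then show ?thesis by (intro exI[of _ j]) (simp add: lookup_add)
    qed
    have "Var j * a \<in> var_ideal n (Suc j)" unfolding var_ideal_def
      using key polys_mult[OF Var_polys[OF j] p(3)] by blast
    moreover have "q \<in> var_ideal n (Suc j)" using p(2) by (auto simp: var_ideal_def intro: less_SucI)
    ultimately show "p \<in> var_ideal n (Suc j)" unfolding p(1)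
      using hideal_add[OF hideal_var_ideal] by blast
  qed
  show "(var_ideal n (Suc j) :: 'k mpoly set) \<subseteq> adjoin n (var_ideal n j) (Var j)"
  proof
    fix p :: "'k mpoly" assume p: "p \<in> var_ideal n (Suc j)"
    have hA: "hideal n (adjoin n (var_ideal n j :: 'k mpoly set) (Var j))" by (rule hideal_adjoin[OF hideal_var_ideal Var_forms[OF j]])
    have "single m (lookup p m) \<in> adjoin n (var_ideal n j) (Var j)" if m: "m \<in> keys p" for m
    proof -
      have mk: "keys m \<subseteq> {0..n}" using m p by (auto simp: var_ideal_def polys_def)
      obtain i where i: "i < Suc j" "lookup m i \<noteq> 0" using m p by (auto simp: var_ideal_def)
      show ?thesis
      proof (cases "i = j")
        case False
        then have "single m (lookup p m) \<in> var_ideal n j" using i mk by (auto simp: var_ideal_def polys_def intro!: exI[of _ i])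
        then show ?thesis using adjoin_mono[OF hideal_var_ideal] by blast
      next
        case True
        define m' where "m' = m - single j 1"
        have mm: "m = single j 1 + m'"
          by (rule poly_mapping_eqI)
             (use i True in \<open>auto simp: m'_def lookup_add lookup_minus lookup_single when_def\<close>)
        have "single m' (lookup p m) \<in> polys n" using mk by (auto simp: mm polys_def keys_mon_add)
        moreover have "Var j * single m' (lookup p m) = single m (lookup p m)"
          unfolding Var_def mult_single mm[symmetric] by simp
        ultimately show ?thesis using adjoin_self[OF hideal_var_ideal[of n j], of "single m' (lookup p m)" "Var j"] by simp
      qed
    qed
    then have "(\<Sum>m\<in>keys p. single m (lookup p m)) \<in> adjoin n (var_ideal n j) (Var j)" by (rule hideal_sum[OF hA])
    then show "p \<in> adjoin n (var_ideal n j) (Var j)" using sum_monomials[of p] by simp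
  qed
qed

definition varseq :: "nat \<Rightarrow> ('k::field mpoly \<times> nat) list" where
  "varseq j = map (\<lambda>i. (Var i, 1)) [0..<j]"

lemma set_varseq: "g \<in> set (varseq j) \<Longrightarrow> snd g = 1"
  by (auto simp: varseq_def)

lemma length_varseq: "length (varseq j) = j"
  by (simp add: varseq_def)

lemma varseq_regular:
  "j \<le> Suc n \<Longrightarrow> regular_forms n {0} (varseq j :: ('k::field mpoly \<times> nat) list) \<and>
     adjoin_all n {0} (varseq j) = (var_ideal n j :: 'k mpoly set)"
proof (induction j)
  case 0
  have "p = 0" if "keys p = {}" for p :: "'k mpoly" using that by simp
  then show ?case by (auto simp: varseq_def var_ideal_def)
next
  case (Suc j)
  then have "regular_forms n {0} (varseq j :: ('k mpoly \<times> nat) list) \<and>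
     adjoin_all n {0} (varseq j) = (var_ideal n j :: 'k mpoly set)" by simp
  then show ?case using Suc.prems Var_forms[of j n] nonzerodiv_var_ideal_Var[of j n] adjoin_var_ideal_Var[of j n]
    unfolding varseq_def by (simp add: regular_forms_snoc adjoin_all_snoc)
qed

lemma socle_type_var_ideal_all: "socle_type n True (var_ideal n (Suc n) :: 'k::field mpoly set) 0"
proof -
  have in_var_ideal: "p \<in> var_ideal n (Suc n)" if "p \<in> polys n" "0 \<notin> keys p" for p :: "'k mpoly"
  proof -
    have "\<exists>i<Suc n. lookup m i \<noteq> 0" if m: "m \<in> keys p" for m
    proof -
      have "m \<noteq> 0" using m \<open>0 \<notin> keys p\<close> by auto
      then obtain i where "lookup m i \<noteq> 0" using poly_mapping_eqI[of m 0] by auto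
      moreover have "keys m \<subseteq> {0..n}" using m \<open>p \<in> polys n\<close> by (auto simp: polys_def)
      ultimately have "i \<le> n" by (auto simp: in_keys_iff subset_eq)
      then show ?thesis using \<open>lookup m i \<noteq> 0\<close> by (intro exI[of _ i]) simp
    qed
    then show ?thesis using that(1) by (simp add: var_ideal_def)
  qed
  have "cyclic_socle n (var_ideal n (Suc n)) (1 :: 'k mpoly)"
    unfolding cyclic_socle_def
  proof (intro conjI ballI)
    have "(Var i :: 'k mpoly) \<in> var_ideal n (Suc n)" if "i \<le> n" for i
      using that Var_polys[OF that] by (auto simp: var_ideal_def Var_def lookup_single when_def)
    then show "(1 :: 'k mpoly) \<in> socle n (var_ideal n (Suc n))" by (simp add: socle_def)
    fix v :: "'k mpoly" assume "v \<in> socle n (var_ideal n (Suc n))"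
    then have "v \<in> polys n" by (simp add: socle_def)
    then have "v - Const (lookup v 0) * 1 \<in> var_ideal n (Suc n)"
      by (intro in_var_ideal) (simp_all add: polys_diff in_keys_iff lookup_minus, simp add: Const_def)
    then show "\<exists>c. v - Const c * 1 \<in> var_ideal n (Suc n)" by blast
  qed
  moreover have "(1 :: 'k mpoly) \<notin> var_ideal n (Suc n)" by (simp add: var_ideal_def)
  moreover have "fin_length n (var_ideal n (Suc n) :: 'k mpoly set)"
    unfolding fin_length_def
    by (intro exI[of _ 1]) (auto simp: forms_def mon_degree_def intro!: in_var_ideal)
  ultimately show ?thesis unfolding socle_type_def using forms_1 by blast
qed

lemma socle_type_var_ideal_n: "socle_type n False (var_ideal n n :: 'k::field mpoly set) s"
proof -
  have "socle n (var_ideal n n) \<subseteq> (var_ideal n n :: 'k mpoly set)"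
    by (rule socle_trivial[OF hideal_var_ideal Var_forms _ nonzerodiv_var_ideal_Var]) auto
  then have "cyclic_socle n (var_ideal n n) (0 :: 'k mpoly)"
    by (auto simp: cyclic_socle_def socle_def hideal_0[OF hideal_var_ideal])
  then show ?thesis unfolding socle_type_def
    by (intro conjI bexI[of _ 0]) (auto simp: hideal_0[OF hideal_var_ideal])
qed

text \<open>\<open>S/(x\<^sub>0, \<dots>, x\<^bsub>n-1\<^esub>)\<close> has no socle, as the remaining variable acts injectively on it; so no complete intersection of \<open>n\<close> forms has one.\<close>

lemma regular_sequence_depth:
  fixes fs :: "('k::field mpoly \<times> nat) list"
  assumes inf: "infinite (UNIV :: 'k set)" and fs: "regular_forms n {0} fs" "length fs = n"
  shows "socle n (adjoin_all n {0} fs) \<subseteq> adjoin_all n {0} fs"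
proof
  fix v assume v: "v \<in> socle n (adjoin_all n {0} fs)"
  have I: "hideal n (adjoin_all n {0} fs)" by (rule hideal_adjoin_all[OF hideal_zero fs(1)])
  have "socle_type n False (adjoin_all n {0} fs) (0 + (\<Sum>f\<leftarrow>fs. int (snd f) - 1))"
    by (rule socle_type_regular_sequences[OF inf hideal_zero fs(1) _ fs(2), of "varseq n"])
       (auto simp: varseq_regular socle_type_var_ideal_n set_varseq length_varseq)
  then obtain y c where "y \<in> adjoin_all n {0} fs" "v - Const c * y \<in> adjoin_all n {0} fs"
    using v by (auto simp: socle_type_def cyclic_socle_def)
  then show "v \<in> adjoin_all n {0} fs" using hideal_cong[OF I] hideal_mult[OF I Const_polys] by blast
qed

text \<open>Compare with \<open>S/(x\<^sub>0, \<dots>, x\<^sub>n)\<close>, the field in degree \<open>0\<close>.\<close>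

lemma complete_intersection_gorenstein:
  fixes fs :: "('k::field mpoly \<times> nat) list"
  assumes inf: "infinite (UNIV :: 'k set)" and fs: "regular_forms n {0} fs" "length fs = Suc n"
  shows "socle_type n True (adjoin_all n {0} fs) (\<Sum>f\<leftarrow>fs. int (snd f) - 1)"
proof -
  have "socle_type n True (adjoin_all n {0} fs) (0 + (\<Sum>f\<leftarrow>fs. int (snd f) - 1))"
    by (rule socle_type_regular_sequences[OF inf hideal_zero fs(1) _ fs(2), of "varseq (Suc n)"])
       (auto simp: varseq_regular socle_type_var_ideal_all set_varseq length_varseq)
  then show ?thesis by simp
qed

section \<open>Linear functionals and the trace of an artinian Gorenstein quotient\<close>

lemma separating_functional:
  fixes s :: "'k::field \<Rightarrow> 'b::ab_group_add \<Rightarrow> 'b"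
  assumes vs: "vector_space s" and U: "module.subspace s U" and a: "a \<notin> U"
  shows "\<exists>g. Vector_Spaces.linear s (*) g \<and> (\<forall>u\<in>U. g u = 0) \<and> g a = 1"
proof -
  interpret vector_space s by fact
  interpret k: vector_space "(*) :: 'k \<Rightarrow> 'k \<Rightarrow> 'k" by unfold_locales (auto simp: algebra_simps)
  interpret vp: vector_space_pair s "(*) :: 'k \<Rightarrow> 'k \<Rightarrow> 'k" by unfold_locales
  obtain B where B: "B \<subseteq> U" "independent B" "U \<subseteq> span B"
    using maximal_independent_subset by blast
  have sB: "span B = U" using B U by (simp add: span_minimal subset_antisym)
  then have "independent (insert a B)" using B a by (simp add: independent_insertI)
  then obtain g where g: "Vector_Spaces.linear s (*) g" "\<forall>x\<in>insert a B. g x = (if x = a then 1 else 0)"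
    using vp.linear_independent_extend[of "insert a B" "\<lambda>x. if x = a then 1 else 0"] by blast
  have "g u = 0" if "u \<in> U" for u
  proof (rule vp.linear_eq_0_on_span[OF g(1)])
    show "g x = 0" if "x \<in> B" for x using that g(2) a B(1) by auto
    show "u \<in> span B" using that sB by simp
  qed
  then show ?thesis using g by auto
qed

lemma vector_space_mpoly: "vector_space (\<lambda>c p. Const c * (p :: 'k::field mpoly))"
  by unfold_locales (auto simp: algebra_simps Const_add Const_mult)

definition klinear :: "('k::field mpoly \<Rightarrow> 'k) \<Rightarrow> bool" where
  "klinear g \<longleftrightarrow> (\<forall>p q. g (p + q) = g p + g q) \<and> (\<forall>c p. g (Const c * p) = c * g p)"

lemma klinear_add: "klinear g \<Longrightarrow> g (p + q) = g p + g q" by (simp add: klinear_def)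
lemma klinear_scale: "klinear g \<Longrightarrow> g (Const c * p) = c * g p" by (simp add: klinear_def)
lemma klinear_0: "klinear g \<Longrightarrow> g 0 = 0" using klinear_scale[of g 0 0] by simp
lemma klinear_diff: "klinear g \<Longrightarrow> g (p - q) = g p - g q"
  using klinear_add[of g "p - q" q] by simp
lemma klinear_sum: "klinear g \<Longrightarrow> g (sum h A) = (\<Sum>x\<in>A. g (h x))"
  by (induction A rule: infinite_finite_induct) (auto simp: klinear_0 klinear_add)

definition ksubspace :: "'k::field mpoly set \<Rightarrow> bool" where
  "ksubspace U \<longleftrightarrow> 0 \<in> U \<and> (\<forall>p\<in>U. \<forall>q\<in>U. p + q \<in> U) \<and> (\<forall>c. \<forall>p\<in>U. Const c * p \<in> U)"

lemma ksubspace_hideal: "hideal n I \<Longrightarrow> ksubspace I"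
  by (auto simp: ksubspace_def hideal_0 hideal_add hideal_mult)

lemma ksubspace_forms: "ksubspace (forms n k)"
  using forms_mult[OF Const_forms, of _ n k] by (auto simp: ksubspace_def forms_add)

lemma ksubspace_Int: "ksubspace U \<Longrightarrow> ksubspace V \<Longrightarrow> ksubspace (U \<inter> V)"
  by (auto simp: ksubspace_def)

lemma linear_klinear: "Vector_Spaces.linear (\<lambda>c p. Const c * p) (*) g \<Longrightarrow> klinear g"
  by (auto simp: klinear_def Vector_Spaces.linear.axioms linear_iff_module_hom module_hom_def module_hom_axioms_def)

lemma ksubspace_subspace: "ksubspace U \<Longrightarrow> module.subspace (\<lambda>c p. Const c * p) U"
proof -
  interpret vector_space "\<lambda>c p. Const c * (p :: 'k::field mpoly)" by (rule vector_space_mpoly)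
  show "ksubspace U \<Longrightarrow> subspace U" by (simp add: ksubspace_def subspace_def)
qed

lemma separating_klinear:
  assumes "ksubspace U" "a \<notin> U"
  obtains g where "klinear g" "\<And>u. u \<in> U \<Longrightarrow> g u = 0" "g a = 1"
  using separating_functional[OF vector_space_mpoly ksubspace_subspace[OF assms(1)] assms(2)] linear_klinear
  by blast

lemma extend_klinear:
  assumes U: "ksubspace U"
    and add: "\<And>p q. p \<in> U \<Longrightarrow> q \<in> U \<Longrightarrow> h (p + q) = h p + h q"
    and scale: "\<And>c p. p \<in> U \<Longrightarrow> h (Const c * p) = c * h p"
  obtains g :: "'k::field mpoly \<Rightarrow> 'k" where "klinear g" "\<And>u. u \<in> U \<Longrightarrow> g u = h u"
proof -
  interpret vector_space "\<lambda>c p. Const c * (p :: 'k mpoly)" by (rule vector_space_mpoly)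
  interpret k: vector_space "(*) :: 'k \<Rightarrow> 'k \<Rightarrow> 'k" by unfold_locales (auto simp: algebra_simps)
  interpret vp: vector_space_pair "\<lambda>c p. Const c * (p :: 'k mpoly)" "(*) :: 'k \<Rightarrow> 'k \<Rightarrow> 'k" by unfold_locales
  have sub: "subspace U" using ksubspace_subspace[OF U] .
  obtain B where B: "B \<subseteq> U" "independent B" "U \<subseteq> span B"
    using maximal_independent_subset by blast
  obtain g where g: "Vector_Spaces.linear (\<lambda>c p. Const c * p) (*) g" "\<forall>x\<in>B. g x = h x"
    using vp.linear_independent_extend[OF B(2)] by blast
  have kl: "klinear g" by (rule linear_klinear[OF g(1)])
  have h0: "h 0 = 0" using scale[of 0 0] U by (simp add: ksubspace_def)
  have "u \<in> U \<and> g u = h u" if "u \<in> U" for u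
  proof -
    have "u \<in> span B" using that B(3) by blast
    then show ?thesis
    proof (induction rule: span_induct_alt)
      case base
      then show ?case using h0 kl U by (simp add: klinear_0 ksubspace_def)
    next
      case (step c x y)
      have x: "x \<in> U" "Const c * x \<in> U" using step(1) B(1) U by (auto simp: ksubspace_def)
      have "g (Const c * x) = h (Const c * x)"
        using klinear_scale[OF kl] scale[OF x(1)] g(2) step(1) by simp
      then show ?case using step(2) x U add[OF x(2)] klinear_add[OF kl] by (simp add: ksubspace_def)
    qed
  qed
  then show thesis using that kl by blast
qed

text \<open>A functional on a finite-dimensional space that vanishes where a bilinear form vanishes identically is
given by that form. The functional and the candidates \<open>v \<mapsto> tr (v * w)\<close> are encoded by their values on
monomials, as polynomials; were the former not among the latter, a separating functional, again
given by a form \<open>v\<close>, would contradict the hypothesis.\<close>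

lemma functional_represented:
  fixes tr lam :: "'k::field mpoly \<Rightarrow> 'k"
  assumes tr: "klinear tr" and lam: "klinear lam"
    and nd: "\<And>v. v \<in> forms n j \<Longrightarrow> (\<And>w. w \<in> forms n i \<Longrightarrow> tr (v * w) = 0) \<Longrightarrow> lam v = 0"
  shows "\<exists>w\<in>forms n i. \<forall>v\<in>forms n j. lam v = tr (v * w)"
proof (cases "j < 0")
  case True
  have "lam v = tr (v * 0)" if "v \<in> forms n j" for v
    using forms_negative[OF True that] by (simp add: klinear_0[OF tr] klinear_0[OF lam])
  then show ?thesis by (intro bexI[of _ 0]) auto
next
  case False
  define B where "B = monomials n (nat j)"
  have fB: "finite B" by (simp add: B_def)
  have mono: "single m c \<in> forms n j" if "m \<in> B" for m and c :: 'k
    using single_form[of m n "nat j" c] that False by (simp add: B_def)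
  have expand: "v = (\<Sum>m\<in>B. Const (lookup v m) * single m 1)" if "v \<in> forms n j" for v :: "'k mpoly"
    using form_expansion[of v n "nat j"] that False by (simp add: B_def)
  have on_form: "g v = (\<Sum>m\<in>B. lookup v m * g (single m 1))" if g: "klinear g" and v: "v \<in> forms n j"
    for g and v :: "'k mpoly"
    using arg_cong[OF expand[OF v], of g] by (simp add: klinear_sum[OF g] klinear_scale[OF g])
  have trw: "klinear (\<lambda>v. tr (v * w))" for w
    using tr by (simp add: klinear_def distrib_right mult.assoc)
  define vec where "vec g = (\<Sum>m\<in>B. Const (g (single m 1)) * single m 1)" for g :: "'k mpoly \<Rightarrow> 'k"
  define W where "W = (\<lambda>w. vec (\<lambda>v. tr (v * w))) ` forms n i"
  have lookup_vec: "lookup (vec g) m = g (single m 1)" if "m \<in> B" for g m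
    using that fB by (simp add: vec_def lookup_sum Const_mult_single lookup_single when_def)
  have "vec lam \<in> W"
  proof (rule ccontr)
    assume out: "vec lam \<notin> W"
    have "ksubspace W"
      unfolding ksubspace_def
    proof (intro conjI ballI allI)
      have "vec (\<lambda>v. tr (v * 0)) = 0" by (simp add: vec_def klinear_0[OF tr])
      then show "0 \<in> W" unfolding W_def by (metis forms_0 image_eqI)
    next
      fix x y assume "x \<in> W" "y \<in> W"
      then obtain u w where uw: "u \<in> forms n i" "w \<in> forms n i" "x = vec (\<lambda>v. tr (v * u))" "y = vec (\<lambda>v. tr (v * w))"
        by (auto simp: W_def)
      have "x + y = vec (\<lambda>v. tr (v * (u + w)))"
        by (simp add: uw vec_def distrib_left distrib_right klinear_add[OF tr] Const_add sum.distrib)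
      then show "x + y \<in> W" unfolding W_def using forms_add[OF uw(1,2)] by blast
    next
      fix c x assume "x \<in> W"
      then obtain w where w: "w \<in> forms n i" "x = vec (\<lambda>v. tr (v * w))"
        by (auto simp: W_def)
      have "tr (v * (Const c * w)) = c * tr (v * w)" for v
        using klinear_scale[OF tr, of c "v * w"] by (simp add: mult.left_commute)
      then have "Const c * x = vec (\<lambda>v. tr (v * (Const c * w)))"
        by (simp add: w vec_def sum_distrib_left Const_mult mult.assoc)
      moreover have "Const c * w \<in> forms n i" using forms_mult[OF Const_forms w(1)] by simp
      ultimately show "Const c * x \<in> W" unfolding W_def by blast
    qed
    then obtain g where g: "klinear g" "\<And>x. x \<in> W \<Longrightarrow> g x = 0" "g (vec lam) = 1"
      using separating_klinear[OF _ out] by blast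
    define e where "e m = single m (1 :: 'k)" for m :: "nat \<Rightarrow>\<^sub>0 nat"
    have gvec: "g (vec h) = (\<Sum>m\<in>B. h (single m 1) * g (e m))" for h
      by (simp add: vec_def e_def klinear_sum[OF g(1)] klinear_scale[OF g(1)])
    define v where "v = (\<Sum>m\<in>B. Const (g (e m)) * single m 1)"
    have v: "v \<in> forms n j" unfolding v_def
    proof (rule forms_sum)
      fix m assume "m \<in> B"
      show "Const (g (e m)) * single m 1 \<in> forms n j"
        using forms_mult[OF Const_forms mono[OF \<open>m \<in> B\<close>]] by simp
    qed
    have at_v: "h v = g (vec h)" if "klinear h" for h
      unfolding v_def gvec klinear_sum[OF that] klinear_scale[OF that] by (rule sum.cong) simp_all
    have "tr (v * w) = 0" if "w \<in> forms n i" for w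
      using at_v[OF trw[of w]] g(2) that by (simp add: W_def)
    then have "lam v = 0" by (intro nd v)
    then show False using at_v[OF lam] g(3) by simp
  qed
  then obtain w where w: "w \<in> forms n i" "vec lam = vec (\<lambda>v. tr (v * w))" by (auto simp: W_def)
  have eq: "lam (single m 1) = tr (single m 1 * w)" if "m \<in> B" for m
    using arg_cong[OF w(2), of "\<lambda>p. lookup p m"] that by (simp add: lookup_vec)
  have "lam v = tr (v * w)" if v: "v \<in> forms n j" for v
    using on_form[OF lam v] on_form[OF trw v, of w] eq by simp
  then show ?thesis using w(1) by blast
qed

text \<open>A functional that factors through the degree \<open>s\<close> part of \<open>S/I\<close> and makes \<open>(a, b) \<mapsto> tr (a * b)\<close> nondegenerate there.\<close>

definition trace_form :: "nat \<Rightarrow> 'k::field mpoly set \<Rightarrow> int \<Rightarrow> ('k mpoly \<Rightarrow> 'k) \<Rightarrow> bool" where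
  "trace_form n I s tr \<longleftrightarrow> klinear tr \<and> (\<forall>p\<in>I. tr p = 0) \<and> (\<forall>k. \<forall>p\<in>forms n k. k \<noteq> s \<longrightarrow> tr p = 0) \<and>
     (\<forall>k. \<forall>a\<in>forms n k. a \<notin> I \<longrightarrow> (\<exists>b\<in>forms n (s - k). tr (a * b) \<noteq> 0))"

text \<open>Any functional that is nonzero on the socle generator works: finite length provides, for a form
\<open>a \<notin> I\<close>, a multiple \<open>b a \<notin> I\<close> of largest degree, and this multiple lies in the socle.\<close>

lemma trace_form_exists:
  fixes I :: "'k::field mpoly set"
  assumes I: "hideal n I" and socle_type: "socle_type n True I s"
  shows "\<exists>tr. trace_form n I s tr"
proof -
  obtain y where y: "y \<in> forms n s" "y \<notin> I" and socle: "\<And>v. v \<in> socle n I \<Longrightarrow> \<exists>c. v - Const c * y \<in> I"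
    using socle_type by (auto simp: socle_type_def cyclic_socle_def)
  obtain k0 where k0: "\<And>k. k \<ge> k0 \<Longrightarrow> forms n k \<subseteq> I" using socle_type by (auto simp: socle_type_def fin_length_def)
  obtain g where g: "klinear g" "\<And>u. u \<in> I \<Longrightarrow> g u = 0" "g y = 1"
    using separating_klinear[OF ksubspace_hideal[OF I] y(2)] by blast
  define tr where "tr p = g (hcomp s p)" for p
  have "hcomp s (Const c * p) = Const c * hcomp s p" for c and p :: "'k mpoly"
    by (rule poly_mapping_eqI) (use lookup_single_mult[of 0 c] in \<open>simp add: lookup_hcomp Const_def\<close>)
  then have "klinear tr" using g(1) by (simp add: klinear_def tr_def hcomp_add)
  moreover have "tr p = 0" if "p \<in> I" for p using g(2) hideal_hcomp[OF I that] by (simp add: tr_def)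
  moreover have "tr p = 0" if "p \<in> forms n k" "k \<noteq> s" for p k
    using that hcomp_of_form[of p n k s] klinear_0[OF g(1)] by (simp add: tr_def)
  moreover have "\<exists>b\<in>forms n (s - k). tr (a * b) \<noteq> 0" if a: "a \<in> forms n k" "a \<notin> I" for a k
  proof -
    define E where "E e \<longleftrightarrow> (\<exists>b\<in>forms n (int e). b * a \<notin> I)" for e
    have E0: "E 0" unfolding E_def using a(2) by (intro bexI[of _ 1]) auto
    have bd: "e \<le> nat (k0 - k)" if "E e" for e
    proof (rule ccontr)
      assume "\<not> e \<le> nat (k0 - k)"
      then have "int e + k \<ge> k0" by simp
      then show False using that k0 forms_mult[OF _ a(1)] unfolding E_def by blast
    qed
    obtain e where e: "E e" "\<And>e'. E e' \<Longrightarrow> e' \<le> e"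
      using GreatestI_nat[of E 0 "nat (k0 - k)"] Greatest_le_nat[of E _ "nat (k0 - k)"] E0 bd by blast
    obtain b where b: "b \<in> forms n (int e)" "b * a \<notin> I" using e(1) by (auto simp: E_def)
    have ba: "b * a \<in> forms n (int e + k)" by (rule forms_mult[OF b(1) a(1)])
    have "Var i * (b * a) \<in> I" if i: "i \<le> n" for i
    proof (rule ccontr)
      assume "Var i * (b * a) \<notin> I"
      then have "E (Suc e)" unfolding E_def
        using forms_mult[OF Var_forms[OF i] b(1)] by (intro bexI[of _ "Var i * b"]) (simp_all add: mult.assoc)
      then show False using e(2)[of "Suc e"] by simp
    qed
    then have "b * a \<in> socle n I" using forms_polys[OF ba] by (simp add: socle_def)
    then obtain c where c: "b * a - Const c * y \<in> I" using socle by blast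
    have cy: "Const c * y \<in> forms n s" using forms_mult[OF Const_forms y(1)] by simp
    have "int e + k = s"
    proof (rule ccontr)
      assume "int e + k \<noteq> s"
      then have "hcomp (int e + k) (b * a - Const c * y) = b * a"
        using hcomp_of_form[OF ba] hcomp_of_form[OF cy] by (simp add: hcomp_diff)
      then show False using hideal_hcomp[OF I c, of "int e + k"] b(2) by simp
    qed
    then have bs: "b \<in> forms n (s - k)" "b * a \<in> forms n s" using b(1) ba by (auto simp flip: \<open>int e + k = s\<close>)
    have "c \<noteq> 0" using c b(2) by auto
    have "g (b * a) - c * g y = 0" using g(2)[OF c] klinear_diff[OF g(1)] klinear_scale[OF g(1)] by simp
    then have "tr (a * b) = c" using hcomp_of_form[OF bs(2), of s] g(3) by (simp add: tr_def mult.commute)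
    then show ?thesis using \<open>c \<noteq> 0\<close> bs(1) by blast
  qed
  ultimately show ?thesis unfolding trace_form_def by blast
qed

lemma trace_represents:
  assumes tr: "trace_form n I s tr" and lam: "klinear lam" "\<And>v. v \<in> forms n j \<Longrightarrow> v \<in> I \<Longrightarrow> lam v = 0"
  shows "\<exists>w\<in>forms n (s - j). \<forall>v\<in>forms n j. lam v = tr (v * w)"
proof (rule functional_represented[OF _ lam(1)])
  show "klinear tr" using tr by (simp add: trace_form_def)
  fix v assume v: "v \<in> forms n j" "\<And>w. w \<in> forms n (s - j) \<Longrightarrow> tr (v * w) = 0"
  then have "v \<in> I" using tr unfolding trace_form_def by blast
  then show "lam v = 0" by (rule lam(2)[OF v(1)])
qed

section \<open>Linkage and the pairing\<close>

text \<open>The form \<open>f\<close> of degree \<open>d\<close> plays the role of \<open>f\<^sub>0\<close>, and \<open>J\<close> that of the ideal of a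
one-dimensional complete intersection. The assumption \<open>gorenstein\<close> says that \<open>S/(J + (l\<^sup>M))\<close> has finite length and a
one-dimensional socle in degree \<open>tau + M\<close>.\<close>

locale linked_form =
  fixes n :: nat and J :: "'k::field mpoly set" and f l :: "'k mpoly" and d tau :: int
  assumes J: "hideal n J" and f: "f \<in> forms n d" and l: "l \<in> forms n 1" and l_nonzerodiv: "nonzerodiv n J l"
    and gorenstein: "\<And>M. M \<ge> 1 \<Longrightarrow> socle_type n True (adjoin n J (l ^ M)) (tau + int M)"
begin

definition A where "A = colon_by n J f"
definition L where "L = {p \<in> polys n. \<forall>a\<in>A. a * p \<in> J}"
abbreviation I where "I \<equiv> adjoin n J f"

lemma fp: "f \<in> polys n" and lp: "l ^ M \<in> polys n" and lform: "l ^ M \<in> forms n (int M)"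
  using forms_polys[OF f] forms_polys[OF l] forms_power[OF l, of M] by (auto intro: polys_power)

lemma hideal_A: "hideal n A"
  unfolding A_def by (rule hideal_colon_by[OF J f])

lemma hideal_I: "hideal n I"
  by (rule hideal_adjoin[OF J f])

lemma J_subset_I: "J \<subseteq> I" by (rule adjoin_mono[OF J])

lemma l_cancel: "p \<in> polys n \<Longrightarrow> l ^ M * p \<in> J \<Longrightarrow> p \<in> J"
  using nonzerodiv_power[OF forms_polys[OF l] l_nonzerodiv, of M] by (simp add: nonzerodiv_def)

lemma A_iff: "a \<in> A \<longleftrightarrow> a \<in> polys n \<and> a * f \<in> J"
  by (auto simp: A_def colon_by_def)

lemma L_polys: "p \<in> L \<Longrightarrow> p \<in> polys n" by (simp add: L_def)

lemma A_L: "a \<in> A \<Longrightarrow> p \<in> L \<Longrightarrow> a * p \<in> J" by (simp add: L_def)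

lemma hideal_L: "hideal n L"
proof (rule hidealI)
  fix a b :: "'k mpoly" assume "a \<in> L" "b \<in> L"
  then show "a + b \<in> L" by (simp add: L_def polys_add distrib_left hideal_add[OF J])
next
  fix a b :: "'k mpoly" assume ab: "a \<in> polys n" "b \<in> L"
  have "c * (a * b) \<in> J" if "c \<in> A" for c
    using hideal_mult[OF J ab(1) A_L[OF that ab(2)]] by (simp add: mult.left_commute)
  then show "a * b \<in> L" using ab by (simp add: L_def polys_mult)
next
  fix k p assume p: "p \<in> L"
  have "a * hcomp k p \<in> J" if a: "a \<in> A" for a
  proof -
    note ap = hideal_subset[OF hideal_A a]
    have "hcomp i a * hcomp k p \<in> J" for i
    proof -
      have "hcomp (i + k) (hcomp i a * p) \<in> J"
        by (rule hideal_hcomp[OF J A_L[OF hideal_hcomp[OF hideal_A a] p]])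
      then show ?thesis using hcomp_form_mult[OF hcomp_in_forms[OF ap] L_polys[OF p], of "i + k" i] by simp
    qed
    then have "(\<Sum>i\<in>degrees a. hcomp i a * hcomp k p) \<in> J" by (intro hideal_sum[OF J])
    then show ?thesis using sum_hcomp[of a] by (simp flip: sum_distrib_right)
  qed
  then show "hcomp k p \<in> L" using L_polys[OF p] by (simp add: L_def forms_polys[OF hcomp_in_forms])
qed (auto simp: L_def hideal_0[OF J])

lemma I_subset_L: "I \<subseteq> L"
proof
  fix p assume p: "p \<in> I"
  then obtain b where b: "b \<in> polys n" "p - f * b \<in> J" by (auto simp: adjoin_iff)
  have "a * p \<in> J" if a: "a \<in> A" for a
  proof -
    have "a * (p - f * b) + (a * f) * b \<in> J"
      using a b hideal_mult[OF J _ b(2)] hideal_mult_right[OF J b(1)] by (intro hideal_add[OF J]) (auto simp: A_iff)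
    then show ?thesis by (simp add: algebra_simps)
  qed
  then show "p \<in> L" using hideal_subset[OF hideal_I p] by (simp add: L_def)
qed

lemma adjoin_small_degree:
  assumes v: "v \<in> forms n k" "v \<in> adjoin n J (l ^ M)" and k: "k < int M"
  shows "v \<in> J"
proof -
  obtain a where a: "a \<in> forms n (k - int M)" "v - l ^ M * a \<in> J"
    by (rule adjoin_form_witness[OF J lform v])
  have "a = 0" by (rule forms_negative[OF _ a(1)]) (use k in simp)
  then show ?thesis using a(2) by simp
qed

text \<open>Below degree \<open>M\<close> the ideals \<open>J\<close> and \<open>J + (l\<^sup>M)\<close> agree, so the trace represents \<open>lam\<close> by some \<open>b\<close>. As \<open>lam\<close>
kills the multiples of \<open>f\<close>, the form \<open>f * b\<close> is orthogonal to everything.\<close>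

lemma represented_by_linkage:
  assumes M: "M \<ge> 1" "j < int M" and tr: "trace_form n (adjoin n J (l ^ M)) (tau + int M) tr"
    and lam: "klinear lam" "\<And>v. v \<in> forms n j \<Longrightarrow> v \<in> I \<Longrightarrow> lam v = 0"
  obtains b where "b \<in> forms n (tau + int M - j)" "f * b \<in> adjoin n J (l ^ M)"
    "\<And>v. v \<in> forms n j \<Longrightarrow> lam v = tr (v * b)"
proof -
  have "lam v = 0" if "v \<in> forms n j" "v \<in> adjoin n J (l ^ M)" for v
    using adjoin_small_degree[OF that M(2)] lam(2)[OF that(1)] J_subset_I by blast
  then obtain b where b: "b \<in> forms n (tau + int M - j)" "\<And>v. v \<in> forms n j \<Longrightarrow> lam v = tr (v * b)"
    using trace_represents[OF tr lam(1), of j] by blast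
  have fb: "f * b \<in> forms n (d + (tau + int M - j))" by (rule forms_mult[OF f b(1)])
  have "f * b \<in> adjoin n J (l ^ M)"
  proof (rule ccontr)
    assume "f * b \<notin> adjoin n J (l ^ M)"
    then obtain w where w: "w \<in> forms n (tau + int M - (d + (tau + int M - j)))" "tr (f * b * w) \<noteq> 0"
      using tr fb unfolding trace_form_def by blast
    have fw: "f * w \<in> forms n j" using forms_mult[OF f w(1)] by simp
    have "f * w \<in> I" by (rule adjoin_self[OF J forms_polys[OF w(1)]])
    then have "tr (f * w * b) = 0" using b(2)[OF fw] lam(2)[OF fw] by simp
    then show False using w(2) by (simp add: ac_simps)
  qed
  then show thesis using that b by blast
qed

text \<open>A functional that separates \<open>a\<close> from \<open>I\<close> is represented by some \<open>b\<close>. In these degrees \<open>f * b\<close> has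
degree less than \<open>M\<close>, so it lies in \<open>J\<close>, that is \<open>b \<in> A\<close>. Then \<open>a * b \<in> J\<close>, although its trace is \<open>1\<close>.\<close>

lemma L_high_degree:
  assumes a: "a \<in> L" "a \<in> forms n k" and k: "k > tau + d"
  shows "a \<in> I"
proof (rule ccontr)
  assume out: "a \<notin> I"
  define M where "M = nat k + 1"
  have M: "M \<ge> 1" "k < int M" by (auto simp: M_def)
  obtain tr where tr: "trace_form n (adjoin n J (l ^ M)) (tau + int M) tr"
    using trace_form_exists[OF hideal_adjoin[OF J lform] gorenstein[OF M(1)]] by blast
  obtain lam where lam: "klinear lam" "\<And>u. u \<in> I \<Longrightarrow> lam u = 0" "lam a = 1"
    using separating_klinear[OF ksubspace_hideal[OF hideal_I] out] by blast
  obtain b where b: "b \<in> forms n (tau + int M - k)" "f * b \<in> adjoin n J (l ^ M)"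
      "\<And>v. v \<in> forms n k \<Longrightarrow> lam v = tr (v * b)"
    using represented_by_linkage[OF M tr lam(1), of thesis] lam(2) by blast
  have "f * b \<in> J" by (rule adjoin_small_degree[OF forms_mult[OF f b(1)] b(2)]) (use k in simp)
  then have "b \<in> A" using forms_polys[OF b(1)] by (simp add: A_iff mult.commute)
  then have "b * a \<in> adjoin n J (l ^ M)" using A_L[OF _ a(1)] adjoin_mono[OF J] by blast
  then have "tr (a * b) = 0" using tr by (simp add: trace_form_def mult.commute)
  then show False using b(3)[OF a(2)] lam(3) by simp
qed

text \<open>Every form in \<open>L\<close> of degree at least \<open>M\<close> lies in \<open>I\<close>, so that \<open>l\<^sup>M\<close> carries \<open>L\<close> into \<open>I\<close>.\<close>

definition M where "M = nat (tau + d) + 1"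

lemma M: "M \<ge> 1" "int M > tau + d"
  by (auto simp: M_def)

lemma high_degree_times_L:
  assumes p: "p \<in> L" and w: "w \<in> polys n" "\<And>k. k < int M \<Longrightarrow> hcomp k w = 0"
  shows "w * p \<in> I"
proof -
  have piece: "hcomp i w * hcomp j p \<in> I" for i j
  proof (cases "i < int M \<or> j < 0")
    case True
    then show ?thesis using w(2) hcomp_negative hideal_0[OF hideal_I] by (auto simp: hcomp_negative)
  next
    case False
    have wf: "hcomp i w \<in> forms n i" by (rule hcomp_in_forms[OF w(1)])
    have "hcomp i w * hcomp j p \<in> L"
      by (rule hideal_mult[OF hideal_L forms_polys[OF wf] hideal_hcomp[OF hideal_L p]])
    moreover have "hcomp i w * hcomp j p \<in> forms n (i + j)"
      by (rule forms_mult[OF wf hcomp_in_forms[OF L_polys[OF p]]])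
    ultimately show ?thesis by (rule L_high_degree) (use False M in simp)
  qed
  have "w * p = (\<Sum>i\<in>degrees w. hcomp i w) * (\<Sum>j\<in>degrees p. hcomp j p)"
    using sum_hcomp[of w] sum_hcomp[of p] by simp
  also have "\<dots> = (\<Sum>i\<in>degrees w. \<Sum>j\<in>degrees p. hcomp i w * hcomp j p)" by (rule sum_product)
  also have "\<dots> \<in> I" by (intro hideal_sum[OF hideal_I] piece)
  finally show ?thesis .
qed

lemma in_L_if_power_in_I:
  assumes p: "p \<in> polys n" and "l ^ i * p \<in> I"
  shows "p \<in> L"
proof -
  have "a * p \<in> J" if a: "a \<in> A" for a
  proof -
    have "a * (l ^ i * p) \<in> J" using A_L[OF a] I_subset_L assms(2) by blast
    then have "l ^ i * (a * p) \<in> J" by (simp add: mult.left_commute)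
    then show ?thesis by (rule l_cancel[rotated]) (intro polys_mult p hideal_subset[OF hideal_A a])
  qed
  then show ?thesis using p by (simp add: L_def)
qed

definition tr where "tr = (SOME t. trace_form n (adjoin n J (l ^ M)) (tau + int M) t)"

lemma trace: "trace_form n (adjoin n J (l ^ M)) (tau + int M) tr"
  unfolding tr_def
  by (rule someI_ex[OF trace_form_exists[OF hideal_adjoin[OF J lform] gorenstein[OF M(1)]]])

lemma tr_linear: "klinear tr" using trace by (simp add: trace_form_def)

lemma tr_J: "p \<in> J \<Longrightarrow> tr p = 0"
  using trace adjoin_mono[OF J, of "l ^ M"] unfolding trace_form_def by blast

lemma tr_cong: "p - q \<in> J \<Longrightarrow> tr p = tr q"
  using tr_J[of "p - q"] klinear_diff[OF tr_linear, of p q] by simp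

lemma tr_power: "p \<in> polys n \<Longrightarrow> tr (l ^ M * p) = 0"
  using trace adjoin_self[OF J, of p "l ^ M"] unfolding trace_form_def by blast

lemma tr_degree: "p \<in> forms n k \<Longrightarrow> k \<noteq> tau + int M \<Longrightarrow> tr p = 0"
  using trace unfolding trace_form_def by blast

text \<open>The element \<open>a\<close> represents the fraction \<open>l\<^sup>M p / f\<close>, which is defined modulo \<open>A\<close>.\<close>

definition links where "links p a \<longleftrightarrow> a \<in> polys n \<and> l ^ M * p - f * a \<in> J"

lemma links_exists: "p \<in> L \<Longrightarrow> \<exists>a. links p a"
proof -
  assume p: "p \<in> L"
  have "l ^ M * p \<in> I"
    by (rule high_degree_times_L[OF p lp]) (simp add: hcomp_of_form[OF lform])
  then show ?thesis by (auto simp: adjoin_iff links_def)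
qed

definition pairing where "pairing p q = tr ((SOME a. links p a) * q)"

text \<open>The ambiguity of \<open>a\<close> lies in \<open>A\<close>, and \<open>A\<close> annihilates \<open>L\<close> modulo \<open>J\<close>.\<close>

lemma pairing_eq:
  assumes "links p a" "q \<in> L"
  shows "pairing p q = tr (a * q)"
proof -
  define b where "b = (SOME a. links p a)"
  have b: "links p b" unfolding b_def using assms(1) by (rule someI)
  have "(l ^ M * p - f * a) - (l ^ M * p - f * b) \<in> J"
    using assms(1) b unfolding links_def by (blast intro: hideal_diff[OF J])
  then have "(b - a) * f \<in> J" by (simp add: algebra_simps)
  then have "b - a \<in> A" using assms(1) b by (simp add: A_iff links_def polys_diff)
  then have "(b - a) * q \<in> J" using A_L assms(2) by blast
  then have "tr (b * q) = tr (a * q)" by (intro tr_cong) (simp add: left_diff_distrib)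
  then show ?thesis by (simp add: pairing_def b_def)
qed

lemma links_add: "links p a \<Longrightarrow> links q b \<Longrightarrow> links (p + q) (a + b)"
  using hideal_add[OF J, of "l ^ M * p - f * a" "l ^ M * q - f * b"]
  by (simp add: links_def polys_add algebra_simps)

lemma links_mult: "links p a \<Longrightarrow> w \<in> polys n \<Longrightarrow> links (w * p) (w * a)"
  using hideal_mult[OF J, of w "l ^ M * p - f * a"]
  by (simp add: links_def polys_mult algebra_simps)

lemma links_hcomp:
  assumes "links p a" "p \<in> polys n"
  shows "links (hcomp k p) (hcomp (k + int M - d) a)"
  using assms hideal_hcomp[OF J, of "l ^ M * p - f * a" "k + int M"]
  by (simp add: links_def hcomp_diff hcomp_form_mult[OF lform] hcomp_form_mult[OF f] forms_polys[OF hcomp_in_forms])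

lemma pairing_add_left:
  assumes "p \<in> L" "p' \<in> L" "q \<in> L"
  shows "pairing (p + p') q = pairing p q + pairing p' q"
proof -
  obtain a a' where a: "links p a" "links p' a'" using assms links_exists by blast
  show ?thesis
    using pairing_eq[OF a(1) assms(3)] pairing_eq[OF a(2) assms(3)] pairing_eq[OF links_add[OF a] assms(3)]
    by (simp add: distrib_right klinear_add[OF tr_linear])
qed

lemma pairing_mult:
  assumes "p \<in> L" "w \<in> polys n" "q \<in> L"
  shows "pairing (w * p) q = pairing p (w * q)"
proof -
  obtain a where a: "links p a" using assms links_exists by blast
  show ?thesis
    using pairing_eq[OF a hideal_mult[OF hideal_L assms(2,3)]] pairing_eq[OF links_mult[OF a assms(2)] assms(3)]
    by (simp add: ac_simps)
qed

text \<open>If \<open>l\<^sup>M p = f a\<close> and \<open>l\<^sup>M q = f b\<close>, then \<open>l\<^sup>M a q = f a b = l\<^sup>M b p\<close>, and \<open>l\<close> can be cancelled.\<close>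

lemma pairing_commute:
  assumes "p \<in> L" "q \<in> L"
  shows "pairing p q = pairing q p"
proof -
  obtain a b where ab: "links p a" "links q b" using assms links_exists by blast
  note pp = L_polys[OF assms(1)] and qp = L_polys[OF assms(2)]
  have "a * (l ^ M * q - f * b) - b * (l ^ M * p - f * a) \<in> J"
    using hideal_diff[OF J hideal_mult[OF J, of a] hideal_mult[OF J, of b]] ab by (simp add: links_def)
  then have "l ^ M * (a * q - b * p) \<in> J" by (simp add: algebra_simps)
  then have "a * q - b * p \<in> J"
    by (rule l_cancel[rotated]) (use ab pp qp in \<open>auto simp: links_def intro!: polys_diff polys_mult\<close>)
  then have "tr (a * q) = tr (b * p)" by (rule tr_cong)
  then show ?thesis using pairing_eq[OF ab(1) assms(2)] pairing_eq[OF ab(2) assms(1)] by simp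
qed

text \<open>For \<open>p = f w\<close> the choice \<open>a = l\<^sup>M w\<close> is possible, and the trace kills multiples of \<open>l\<^sup>M\<close>.\<close>

lemma pairing_I_left:
  assumes p: "p \<in> I" and q: "q \<in> L"
  shows "pairing p q = 0"
proof -
  obtain w where w: "w \<in> polys n" "p - f * w \<in> J" using p by (auto simp: adjoin_iff)
  have "links p (l ^ M * w)"
    using hideal_mult[OF J lp w(2)] w(1) lp by (simp add: links_def polys_mult algebra_simps)
  then show ?thesis
    using pairing_eq[OF _ q] tr_power[OF polys_mult[OF w(1) L_polys[OF q]]] by (simp add: mult.assoc)
qed

lemma pairing_degree:
  assumes p: "p \<in> L" "p \<in> forms n i" and q: "q \<in> L" "q \<in> forms n j" and ij: "i + j \<noteq> tau + d"
  shows "pairing p q = 0"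
proof -
  obtain a where a: "links p a" using p links_exists by blast
  then have "links p (hcomp (i + int M - d) a)" using links_hcomp[OF a L_polys[OF p(1)], of i] hcomp_of_form[OF p(2)] by simp
  then have "pairing p q = tr (hcomp (i + int M - d) a * q)" by (rule pairing_eq[OF _ q(1)])
  also have "\<dots> = 0"
    by (rule tr_degree[OF forms_mult[OF hcomp_in_forms q(2)]]) (use a ij in \<open>auto simp: links_def\<close>)
  finally show ?thesis .
qed

text \<open>The \<open>b\<close> that represents \<open>lam\<close> satisfies \<open>f b = l\<^sup>M h\<close> modulo \<open>J\<close>. So \<open>b\<close> is the partner of \<open>h\<close>, and
\<open>h\<close> lies in \<open>L\<close> since \<open>A\<close> annihilates \<open>f b\<close>.\<close>

lemma pairing_represents:
  assumes lam: "klinear lam" "\<And>v. v \<in> forms n j \<Longrightarrow> v \<in> I \<Longrightarrow> lam v = 0"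
  shows "\<exists>h. h \<in> L \<and> h \<in> forms n (tau + d - j) \<and> (\<forall>v. v \<in> L \<longrightarrow> v \<in> forms n j \<longrightarrow> lam v = pairing h v)"
proof (cases "j < int M")
  case True
  obtain b where b: "b \<in> forms n (tau + int M - j)" "f * b \<in> adjoin n J (l ^ M)"
      "\<And>v. v \<in> forms n j \<Longrightarrow> lam v = tr (v * b)"
    using represented_by_linkage[OF M(1) True trace lam] by blast
  obtain h where h: "h \<in> forms n (d + (tau + int M - j) - int M)" "f * b - l ^ M * h \<in> J"
    by (rule adjoin_form_witness[OF J lform forms_mult[OF f b(1)] b(2)])
  note hp = forms_polys[OF h(1)]
  have links: "links h b"
    using hideal_uminus[OF J h(2)] forms_polys[OF b(1)] by (simp add: links_def)
  have "a * h \<in> J" if a: "a \<in> A" for a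
  proof -
    note ap = hideal_subset[OF hideal_A a]
    have "(a * f) * b - a * (f * b - l ^ M * h) \<in> J"
      using a hideal_mult[OF J ap h(2)] hideal_mult_right[OF J forms_polys[OF b(1)]]
      by (intro hideal_diff[OF J]) (auto simp: A_iff)
    then have "l ^ M * (a * h) \<in> J" by (simp add: algebra_simps)
    then show ?thesis by (rule l_cancel[rotated]) (intro polys_mult ap hp)
  qed
  then have hL: "h \<in> L" using hp by (simp add: L_def)
  have "lam v = pairing h v" if "v \<in> L" "v \<in> forms n j" for v
    using b(3)[OF that(2)] pairing_eq[OF links that(1)] by (simp add: mult.commute)
  moreover have "h \<in> forms n (tau + d - j)" using h(1) by (simp add: algebra_simps)
  ultimately show ?thesis using hL by blast
next
  case False
  have "lam v = pairing 0 v" if "v \<in> L" "v \<in> forms n j" for v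
  proof -
    have "v \<in> I" by (rule L_high_degree[OF that]) (use False M in simp)
    then show ?thesis using lam(2)[OF that(2)] pairing_I_left[OF hideal_0[OF hideal_I] that(1)] by simp
  qed
  then show ?thesis using hideal_0[OF hideal_L] forms_0 by blast
qed

lemma pairing_0_left: "q \<in> L \<Longrightarrow> pairing 0 q = 0"
  by (rule pairing_I_left[OF hideal_0[OF hideal_I]])

lemma pairing_add_right: "p \<in> L \<Longrightarrow> q \<in> L \<Longrightarrow> q' \<in> L \<Longrightarrow> pairing p (q + q') = pairing p q + pairing p q'"
  using pairing_add_left[of q q' p] pairing_commute[of p] hideal_add[OF hideal_L, of q q'] by simp

lemma pairing_I_right: "p \<in> L \<Longrightarrow> q \<in> I \<Longrightarrow> pairing p q = 0"
  using pairing_I_left[of q p] pairing_commute[of p q] I_subset_L by auto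

lemma pairing_sum_right:
  assumes "p \<in> L" "\<And>x. x \<in> X \<Longrightarrow> g x \<in> L"
  shows "pairing p (sum g X) = (\<Sum>x\<in>X. pairing p (g x))"
  using assms(2)
proof (induction X rule: infinite_finite_induct)
  case (insert x X)
  then have "sum g X \<in> L" by (intro hideal_sum[OF hideal_L]) auto
  then show ?case using insert pairing_add_right[OF assms(1), of "g x" "sum g X"] by simp
qed (auto intro: pairing_I_right[OF assms(1)] hideal_0[OF hideal_I])

lemma pairing_sum_left:
  assumes "q \<in> L" "\<And>x. x \<in> X \<Longrightarrow> g x \<in> L"
  shows "pairing (sum g X) q = (\<Sum>x\<in>X. pairing (g x) q)"
proof -
  have "pairing (sum g X) q = pairing q (sum g X)"
    by (rule pairing_commute[OF hideal_sum[OF hideal_L assms(2)] assms(1)])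
  also have "\<dots> = (\<Sum>x\<in>X. pairing q (g x))" by (rule pairing_sum_right[OF assms])
  also have "\<dots> = (\<Sum>x\<in>X. pairing (g x) q)"
    by (rule sum.cong) (simp_all add: pairing_commute[OF assms(1)] assms(2))
  finally show ?thesis .
qed

lemma pairing_scale_right:
  assumes "p \<in> L" "q \<in> L"
  shows "pairing p (Const c * q) = c * pairing p q"
proof -
  obtain a where a: "links p a" using assms links_exists by blast
  show ?thesis
    using pairing_eq[OF a assms(2)] pairing_eq[OF a hideal_mult[OF hideal_L Const_polys assms(2)]]
      klinear_scale[OF tr_linear, of c "a * q"] by (simp add: mult.left_commute)
qed

lemma pairing_nondegenerate:
  assumes p: "p \<in> L" and zero: "\<And>q. q \<in> L \<Longrightarrow> pairing p q = 0"
  shows "p \<in> I"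
proof (rule ccontr)
  assume "p \<notin> I"
  then obtain j where j: "hcomp j p \<notin> I" using hideal_hcomp_iff[OF hideal_I] by blast
  obtain lam where lam: "klinear lam" "\<And>u. u \<in> I \<Longrightarrow> lam u = 0" "lam (hcomp j p) = 1"
    using separating_klinear[OF ksubspace_hideal[OF hideal_I] j] by blast
  then obtain h where h: "h \<in> L" "h \<in> forms n (tau + d - j)"
      "\<And>v. v \<in> L \<Longrightarrow> v \<in> forms n j \<Longrightarrow> lam v = pairing h v"
    using pairing_represents[of lam j] by blast
  have hcL: "hcomp i p \<in> L" for i by (rule hideal_hcomp[OF hideal_L p])
  have hcf: "hcomp i p \<in> forms n i" for i by (rule hcomp_in_forms[OF L_polys[OF p]])
  have jd: "j \<in> degrees p" using hcomp_outside_degrees[of j p] j hideal_0[OF hideal_I] by (cases "j \<in> degrees p") simp_all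
  have "pairing h (\<Sum>i\<in>degrees p. hcomp i p) = (\<Sum>i\<in>degrees p. pairing h (hcomp i p))"
    by (rule pairing_sum_right[OF h(1) hcL])
  also have "\<dots> = (\<Sum>i\<in>degrees p. if i = j then 1 else 0)"
  proof (rule sum.cong)
    fix i show "pairing h (hcomp i p) = (if i = j then 1 else 0)"
      using pairing_degree[OF h(1,2) hcL hcf, of i] h(3)[OF hcL hcf] lam(3) by auto
  qed simp
  also have "\<dots> = 1" using jd by simp
  finally have "pairing h p = 1" using sum_hcomp[of p] by simp
  then show False using zero[OF h(1)] pairing_commute[OF p h(1)] by simp
qed

end

section \<open>The polynomial ring and its quotients\<close>

lemma poly_ring_simps [simp]:
  "carrier (poly_ring n) = polys n" "rcomp (poly_ring n) k = forms n k"
  "monoid.mult (poly_ring n) = (*)" "one (poly_ring n) = 1" "zero (poly_ring n) = 0"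
  "add (poly_ring n) = (+)"
  by (simp_all add: poly_ring_def polys_def forms_def)

lemma cring_poly_ring: "cring (poly_ring n)"
proof (rule cringI)
  show "abelian_group (poly_ring n :: 'a mpoly graded_ring)"
  proof (rule abelian_groupI)
    fix x :: "'a mpoly" assume "x \<in> carrier (poly_ring n)"
    then show "\<exists>y\<in>carrier (poly_ring n). y \<oplus>\<^bsub>poly_ring n\<^esub> x = \<zero>\<^bsub>poly_ring n\<^esub>"
      by (intro bexI[of _ "- x"]) (auto simp: polys_uminus)
  qed (auto simp: polys_add)
  show "comm_monoid (poly_ring n :: 'a mpoly graded_ring)"
    by (rule comm_monoidI) (auto simp: polys_mult ac_simps)
qed (simp add: distrib_right)

lemma poly_ring_minus: "p \<in> polys n \<Longrightarrow> q \<in> polys n \<Longrightarrow> p \<ominus>\<^bsub>poly_ring n\<^esub> q = p - q"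
proof -
  interpret cring "poly_ring n :: 'a mpoly graded_ring" by (rule cring_poly_ring)
  assume p: "p \<in> polys n" and q: "q \<in> polys n"
  have "\<ominus>\<^bsub>poly_ring n\<^esub> q = - q"
    using q polys_uminus[OF q] by (intro minus_equality) auto
  then show ?thesis by (simp add: a_minus_def)
qed

lemma hideal_ideal:
  assumes "hideal n I"
  shows "ideal I (poly_ring n)"
proof (rule idealI)
  interpret cring "poly_ring n :: 'a mpoly graded_ring" by (rule cring_poly_ring)
  show "ring (poly_ring n :: 'a mpoly graded_ring)" ..
  show "subgroup I (add_monoid (poly_ring n))"
  proof
    fix x assume x: "x \<in> I"
    have xp: "x \<in> polys n" by (rule hideal_subset[OF assms x])
    then have "inv\<^bsub>add_monoid (poly_ring n)\<^esub> x = - x"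
      using poly_ring_minus[of 0 n x] by (simp add: a_minus_def a_inv_def)
    then show "inv\<^bsub>add_monoid (poly_ring n)\<^esub> x \<in> I" using hideal_uminus[OF assms x] by simp
  qed (use assms in \<open>auto simp: hideal_def\<close>)
qed (use assms in \<open>auto simp: hideal_mult hideal_mult_right\<close>)

lemma ideal_poly_ring_closed:
  assumes "ideal I (poly_ring n)"
  shows "a \<in> I \<Longrightarrow> b \<in> I \<Longrightarrow> a + b \<in> I" "a \<in> I \<Longrightarrow> b \<in> polys n \<Longrightarrow> a * b \<in> I" "0 \<in> I"
  using ideal.axioms(1)[OF assms] additive_subgroup.a_closed[of I "poly_ring n" a b]
    ideal.I_r_closed[OF assms, of a b] additive_subgroup.zero_closed[of I "poly_ring n"] by auto

text \<open>Generated ideals are built up by \<open>adjoin\<close>, one form after the other.\<close>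

lemma Idl_forms:
  fixes fs :: "'k::field mpoly list"
  assumes "\<And>f. f \<in> set fs \<Longrightarrow> \<exists>d. f \<in> forms n d"
  shows "Idl\<^bsub>poly_ring n\<^esub> (set fs) = foldl (adjoin n) {0} fs \<and> hideal n (foldl (adjoin n) {0} fs)"
  using assms
proof (induction fs rule: rev_induct)
  case Nil
  interpret cring "poly_ring n :: 'k mpoly graded_ring" by (rule cring_poly_ring)
  have "Idl\<^bsub>poly_ring n\<^esub> {} \<subseteq> {0 :: 'k mpoly}"
    by (rule genideal_minimal) (auto intro: hideal_ideal hideal_zero)
  moreover have "(0 :: 'k mpoly) \<in> Idl\<^bsub>poly_ring n\<^esub> {}"
    using ideal_poly_ring_closed(3)[OF genideal_ideal[of "{}"]] by simp
  ultimately show ?case by (auto simp: hideal_zero)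
next
  case (snoc f fs)
  interpret cring "poly_ring n :: 'k mpoly graded_ring" by (rule cring_poly_ring)
  define Q where "Q = foldl (adjoin n) {0} fs"
  have Q: "Idl\<^bsub>poly_ring n\<^esub> (set fs) = Q" "hideal n Q" using snoc by (auto simp: Q_def)
  obtain d where f: "f \<in> forms n d" using snoc.prems[of f] by auto
  have h: "hideal n (adjoin n Q f)" by (rule hideal_adjoin[OF Q(2) f])
  have carr: "set (fs @ [f]) \<subseteq> carrier (poly_ring n)" using snoc.prems forms_polys by fastforce
  have "Idl\<^bsub>poly_ring n\<^esub> (set (fs @ [f])) \<subseteq> adjoin n Q f"
  proof (rule genideal_minimal[OF hideal_ideal[OF h]])
    have "set fs \<subseteq> Q" using genideal_self[of "set fs"] carr Q(1) by auto
    moreover have "f \<in> adjoin n Q f" using adjoin_self[OF Q(2), of 1 f] by simp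
    ultimately show "set (fs @ [f]) \<subseteq> adjoin n Q f" using adjoin_mono[OF Q(2), of f] by auto
  qed
  moreover have "adjoin n Q f \<subseteq> Idl\<^bsub>poly_ring n\<^esub> (set (fs @ [f]))"
  proof -
    have id: "ideal (Idl\<^bsub>poly_ring n\<^esub> (set (fs @ [f]))) (poly_ring n)" by (rule genideal_ideal[OF carr])
    have "Q \<subseteq> Idl\<^bsub>poly_ring n\<^esub> (set (fs @ [f]))"
      unfolding Q(1)[symmetric] by (rule genideal_minimal[OF id]) (use genideal_self[OF carr] in auto)
    moreover have "f \<in> Idl\<^bsub>poly_ring n\<^esub> (set (fs @ [f]))" using genideal_self[OF carr] by auto
    ultimately show ?thesis
      unfolding adjoin_def using ideal_poly_ring_closed[OF id] by blast
  qed
  ultimately show ?case using h by (simp add: Q_def)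
qed

abbreviation (input) cls :: "nat \<Rightarrow> 'k::field mpoly set \<Rightarrow> 'k mpoly \<Rightarrow> 'k mpoly set" where
  "cls n J p \<equiv> J +>\<^bsub>poly_ring n\<^esub> p"

abbreviation (input) quo :: "nat \<Rightarrow> 'k::field mpoly set \<Rightarrow> 'k mpoly set graded_ring" where
  "quo n J \<equiv> graded_quotient (poly_ring n) J"

lemma graded_quotient_sel:
  "carrier (graded_quotient T K) = (\<lambda>a. K +>\<^bsub>T\<^esub> a) ` carrier T"
  "monoid.mult (graded_quotient T K) = rcoset_mult T K"
  "one (graded_quotient T K) = K +>\<^bsub>T\<^esub> \<one>\<^bsub>T\<^esub>"
  "zero (graded_quotient T K) = K"
  "add (graded_quotient T K) = set_add T"
  "rcomp (graded_quotient T K) k = (\<lambda>a. K +>\<^bsub>T\<^esub> a) ` rcomp T k"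
  by (auto simp: graded_quotient_def FactRing_def A_RCOSETS_def')

context
  fixes n and J :: "'k::field mpoly set" assumes J: "hideal n J"
begin

lemma cls_eq_iff: "p \<in> polys n \<Longrightarrow> q \<in> polys n \<Longrightarrow> cls n J p = cls n J q \<longleftrightarrow> p - q \<in> J"
  using ring.quotient_eq_iff_same_a_r_cos[OF cring.axioms(1)[OF cring_poly_ring] hideal_ideal[OF J], of p q]
  by (simp add: poly_ring_minus)

lemma cls_add: "p \<in> polys n \<Longrightarrow> q \<in> polys n \<Longrightarrow> set_add (poly_ring n) (cls n J p) (cls n J q) = cls n J (p + q)"
  using ideal.a_rcos_sum[OF hideal_ideal[OF J], of p q] by simp

lemma cls_mult: "p \<in> polys n \<Longrightarrow> q \<in> polys n \<Longrightarrow> rcoset_mult (poly_ring n) J (cls n J p) (cls n J q) = cls n J (p * q)"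
  using ideal.rcoset_mult_add[OF hideal_ideal[OF J], of p q] by simp

lemma cls_0: "cls n J 0 = J"
  by (auto simp: a_r_coset_def')

lemma quotient_simps:
  "carrier (quo n J) = cls n J ` polys n"
  "rcomp (quo n J) k = cls n J ` forms n k"
  "one (quo n J) = cls n J 1"
  "zero (quo n J) = cls n J 0"
  "p \<in> polys n \<Longrightarrow> q \<in> polys n \<Longrightarrow> cls n J p \<oplus>\<^bsub>quo n J\<^esub> cls n J q = cls n J (p + q)"
  "p \<in> polys n \<Longrightarrow> q \<in> polys n \<Longrightarrow> cls n J p \<otimes>\<^bsub>quo n J\<^esub> cls n J q = cls n J (p * q)"
  by (simp_all add: graded_quotient_sel cls_add cls_mult cls_0)

end

section \<open>Presentations of graded modules\<close>

text \<open>\<open>M\<close> is isomorphic to \<open>(X/Y)[a]\<close> over \<open>S/J\<close>, via a map \<open>\<pi>\<close> that is defined on polynomials. Working with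
representatives in \<open>X\<close> turns all questions about \<open>M\<close> into polynomial identities.\<close>

definition presents ::
  "nat \<Rightarrow> 'k::field mpoly set \<Rightarrow> ('k mpoly set, 'm) graded_module \<Rightarrow> ('k mpoly \<Rightarrow> 'm) \<Rightarrow>
     'k mpoly set \<Rightarrow> 'k mpoly set \<Rightarrow> int \<Rightarrow> bool" where
  "presents n J M \<pi> X Y a \<longleftrightarrow>
     hideal n X \<and> hideal n Y \<and> Y \<subseteq> X \<and> carrier M = \<pi> ` X \<and> zero M = \<pi> 0 \<and>
     (\<forall>p\<in>X. \<forall>q\<in>X. \<pi> p = \<pi> q \<longleftrightarrow> p - q \<in> Y) \<and>
     (\<forall>p\<in>X. \<forall>q\<in>X. \<pi> p \<oplus>\<^bsub>M\<^esub> \<pi> q = \<pi> (p + q)) \<and>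
     (\<forall>w\<in>polys n. \<forall>p\<in>X. cls n J w \<odot>\<^bsub>M\<^esub> \<pi> p = \<pi> (w * p)) \<and>
     (\<forall>k. gcomp M k = \<pi> ` (X \<inter> forms n (a + k)))"

lemma presents_shift:
  "presents n J M \<pi> X Y a \<Longrightarrow> presents n J (shift M b) \<pi> X Y (a + b)"
  by (simp add: presents_def shift_def add.assoc)

context
  fixes n and J :: "'k::field mpoly set" and M :: "('k mpoly set, 'm) graded_module" and \<pi> X Y a
  assumes J: "hideal n J" and pres: "presents n J M \<pi> X Y a"
begin

lemma presents_props:
  shows X: "hideal n X" and Y: "hideal n Y" and YX: "Y \<subseteq> X"
    and carr: "carrier M = \<pi> ` X" and zero: "\<zero>\<^bsub>M\<^esub> = \<pi> 0"
    and eq: "p \<in> X \<Longrightarrow> q \<in> X \<Longrightarrow> \<pi> p = \<pi> q \<longleftrightarrow> p - q \<in> Y"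
    and add: "p \<in> X \<Longrightarrow> q \<in> X \<Longrightarrow> \<pi> p \<oplus>\<^bsub>M\<^esub> \<pi> q = \<pi> (p + q)"
    and smult: "w \<in> polys n \<Longrightarrow> p \<in> X \<Longrightarrow> cls n J w \<odot>\<^bsub>M\<^esub> \<pi> p = \<pi> (w * p)"
    and gcomp: "gcomp M k = \<pi> ` (X \<inter> forms n (a + k))"
proof -
  note c = pres[unfolded presents_def]
  note c1 = c[THEN conjunct2] note c2 = c1[THEN conjunct2] note c3 = c2[THEN conjunct2]
  note c4 = c3[THEN conjunct2] note c5 = c4[THEN conjunct2] note c6 = c5[THEN conjunct2]
  note c7 = c6[THEN conjunct2]
  show "hideal n X" "hideal n Y" "Y \<subseteq> X" "carrier M = \<pi> ` X" "\<zero>\<^bsub>M\<^esub> = \<pi> 0"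
    by (rule c[THEN conjunct1] c1[THEN conjunct1] c2[THEN conjunct1] c3[THEN conjunct1] c4[THEN conjunct1])+
  show "\<pi> p = \<pi> q \<longleftrightarrow> p - q \<in> Y" if "p \<in> X" "q \<in> X"
    by (rule c5[THEN conjunct1, rule_format, OF that])
  show "\<pi> p \<oplus>\<^bsub>M\<^esub> \<pi> q = \<pi> (p + q)" if "p \<in> X" "q \<in> X"
    by (rule c6[THEN conjunct1, rule_format, OF that])
  show "cls n J w \<odot>\<^bsub>M\<^esub> \<pi> p = \<pi> (w * p)" if "w \<in> polys n" "p \<in> X"
    by (rule c7[THEN conjunct1, rule_format, OF that])
  show "gcomp M k = \<pi> ` (X \<inter> forms n (a + k))"
    by (rule c7[THEN conjunct2, rule_format])
qed

lemma presents_zero_iff: "p \<in> X \<Longrightarrow> \<pi> p = \<zero>\<^bsub>M\<^esub> \<longleftrightarrow> p \<in> Y"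
  using eq[of p 0] hideal_0[OF X] by (simp add: zero)

lemma presents_abelian_group: "abelian_group M"
proof (rule abelian_groupI)
  fix x y assume "x \<in> carrier M" "y \<in> carrier M"
  then obtain p q where pq: "p \<in> X" "q \<in> X" "x = \<pi> p" "y = \<pi> q" by (auto simp: carr)
  then show "x \<oplus>\<^bsub>M\<^esub> y \<in> carrier M" "x \<oplus>\<^bsub>M\<^esub> y = y \<oplus>\<^bsub>M\<^esub> x"
    using hideal_add[OF X] by (auto simp: carr add add.commute)
next
  show "\<zero>\<^bsub>M\<^esub> \<in> carrier M" using hideal_0[OF X] by (auto simp: carr zero)
next
  fix x y z assume "x \<in> carrier M" "y \<in> carrier M" "z \<in> carrier M"
  then obtain p q r where pq: "p \<in> X" "q \<in> X" "r \<in> X" "x = \<pi> p" "y = \<pi> q" "z = \<pi> r" by (auto simp: carr)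
  then show "x \<oplus>\<^bsub>M\<^esub> y \<oplus>\<^bsub>M\<^esub> z = x \<oplus>\<^bsub>M\<^esub> (y \<oplus>\<^bsub>M\<^esub> z)"
    using hideal_add[OF X] by (auto simp: add add.assoc)
next
  fix x assume "x \<in> carrier M"
  then obtain p where p: "p \<in> X" "x = \<pi> p" by (auto simp: carr)
  then show "\<zero>\<^bsub>M\<^esub> \<oplus>\<^bsub>M\<^esub> x = x" using hideal_0[OF X] by (simp add: zero add)
  show "\<exists>y\<in>carrier M. y \<oplus>\<^bsub>M\<^esub> x = \<zero>\<^bsub>M\<^esub>"
    using p hideal_uminus[OF X p(1)] by (intro bexI[of _ "\<pi> (- p)"]) (auto simp: zero add carr)
qed

lemma presents_finsum:
  assumes "finite F" "\<And>k. k \<in> F \<Longrightarrow> g k \<in> X"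
  shows "finsum M (\<lambda>k. \<pi> (g k)) F = \<pi> (\<Sum>k\<in>F. g k)"
proof -
  interpret abelian_group M by (rule presents_abelian_group)
  show ?thesis
    using assms
  proof (induction F rule: finite_induct)
    case (insert x F)
    have "(\<Sum>k\<in>F. g k) \<in> X" by (rule hideal_sum[OF X]) (use insert.prems in auto)
    then show ?case
      using insert by (subst finsum_insert) (auto simp: carr add)
  qed (simp add: zero)
qed

text \<open>The components of \<open>\<pi> p\<close> are the images of the components of \<open>p\<close>; they are unique because \<open>Y\<close> is homogeneous.\<close>

lemma presents_direct_sum: "direct_sum_decomposition M (gcomp M)"
proof -
  interpret abelian_group M by (rule presents_abelian_group)
  have sub: "additive_subgroup (gcomp M k) M" for k
  proof (rule additive_subgroupI, rule subgroup.intro)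
    show "gcomp M k \<subseteq> carrier (add_monoid M)" by (auto simp: gcomp carr)
    have "0 \<in> X \<inter> forms n (a + k)" using hideal_0[OF X] by simp
    then show "\<one>\<^bsub>add_monoid M\<^esub> \<in> gcomp M k" by (auto simp: gcomp zero)
    fix x assume "x \<in> gcomp M k"
    then obtain p where p: "p \<in> X" "p \<in> forms n (a + k)" "x = \<pi> p" by (auto simp: gcomp)
    have mp: "- p \<in> X" "- p \<in> forms n (a + k)" using hideal_uminus[OF X p(1)] forms_uminus[OF p(2)] by auto
    then have "\<ominus>\<^bsub>M\<^esub> x = \<pi> (- p)" using p(1) hideal_uminus[OF X p(1)]
      by (intro minus_equality) (auto simp: p(3) add zero carr)
    then show "inv\<^bsub>add_monoid M\<^esub> x \<in> gcomp M k" using mp by (auto simp: gcomp a_inv_def)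
    fix y assume "y \<in> gcomp M k"
    then obtain q where q: "q \<in> X" "q \<in> forms n (a + k)" "y = \<pi> q" by (auto simp: gcomp)
    then show "x \<otimes>\<^bsub>add_monoid M\<^esub> y \<in> gcomp M k"
      using p hideal_add[OF X p(1) q(1)] forms_add[OF p(2) q(2)] by (auto simp: gcomp add)
  qed
  have "\<exists>!c. (\<forall>k. c k \<in> gcomp M k) \<and> finite {k. c k \<noteq> \<zero>\<^bsub>M\<^esub>} \<and> x = finsum M c {k. c k \<noteq> \<zero>\<^bsub>M\<^esub>}"
    if "x \<in> carrier M" for x
  proof -
    obtain p where p: "p \<in> X" "x = \<pi> p" using \<open>x \<in> carrier M\<close> by (auto simp: carr)
    note pp = hideal_subset[OF X p(1)]
    have hX: "hcomp k p \<in> X" for k by (rule hideal_hcomp[OF X p(1)])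
    define c where "c k = \<pi> (hcomp (a + k) p)" for k
    define D where "D = (\<lambda>j. j - a) ` degrees p"
    have cg: "c k \<in> gcomp M k" for k using hX hcomp_in_forms[OF pp] by (auto simp: c_def gcomp)
    have sup: "{k. c k \<noteq> \<zero>\<^bsub>M\<^esub>} \<subseteq> D"
    proof
      fix k assume "k \<in> {k. c k \<noteq> \<zero>\<^bsub>M\<^esub>}"
      then have "hcomp (a + k) p \<noteq> 0" by (auto simp: c_def zero)
      then have "a + k \<in> degrees p" using hcomp_outside_degrees by blast
      then show "k \<in> D" by (force simp: D_def)
    qed
    have fD: "finite D" by (simp add: D_def)
    then have fin: "finite {k. c k \<noteq> \<zero>\<^bsub>M\<^esub>}" using sup finite_subset by blast
    have "finsum M c {k. c k \<noteq> \<zero>\<^bsub>M\<^esub>} = finsum M c D"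
      by (rule add.finprod_mono_neutral_cong_left) (use fD sup hX in \<open>auto simp: c_def carr\<close>)
    also have "\<dots> = \<pi> (\<Sum>k\<in>D. hcomp (a + k) p)" unfolding c_def by (rule presents_finsum[OF fD hX])
    also have "(\<Sum>k\<in>D. hcomp (a + k) p) = (\<Sum>j\<in>degrees p. hcomp j p)"
      unfolding D_def by (subst sum.reindex) (auto simp: inj_on_def)
    finally have xsum: "x = finsum M c {k. c k \<noteq> \<zero>\<^bsub>M\<^esub>}" using sum_hcomp[of p] p(2) by simp
    show ?thesis
    proof (rule ex1I[of _ c])
      show "(\<forall>k. c k \<in> gcomp M k) \<and> finite {k. c k \<noteq> \<zero>\<^bsub>M\<^esub>} \<and> x = finsum M c {k. c k \<noteq> \<zero>\<^bsub>M\<^esub>}"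
        using cg fin xsum by blast
      fix c' assume c': "(\<forall>k. c' k \<in> gcomp M k) \<and> finite {k. c' k \<noteq> \<zero>\<^bsub>M\<^esub>} \<and> x = finsum M c' {k. c' k \<noteq> \<zero>\<^bsub>M\<^esub>}"
      define F where "F = {k. c' k \<noteq> \<zero>\<^bsub>M\<^esub>}"
      have "\<exists>r. r \<in> X \<and> r \<in> forms n (a + k) \<and> c' k = \<pi> r" for k
      proof -
        have "c' k \<in> gcomp M k" using c' by blast
        then show ?thesis by (auto simp: gcomp)
      qed
      then obtain r where r: "\<And>k. r k \<in> X" "\<And>k. r k \<in> forms n (a + k)" "\<And>k. c' k = \<pi> (r k)" by metis
      have fF: "finite F" using c' by (simp add: F_def)
      have "\<pi> p = finsum M (\<lambda>k. \<pi> (r k)) F" using c' p(2) by (simp add: F_def r(3)[symmetric])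
      also have "\<dots> = \<pi> (\<Sum>k\<in>F. r k)" by (rule presents_finsum[OF fF r(1)])
      finally have "\<pi> p = \<pi> (\<Sum>k\<in>F. r k)" .
      moreover have "(\<Sum>k\<in>F. r k) \<in> X" by (rule hideal_sum[OF X r(1)])
      ultimately have diff: "p - (\<Sum>k\<in>F. r k) \<in> Y" using eq[OF p(1)] by blast
      show "c' = c"
      proof
        fix k
        have "hcomp (a + k) (\<Sum>j\<in>F. r j) = (\<Sum>j\<in>F. if j = k then r k else 0)"
          unfolding hcomp_sum by (rule sum.cong) (auto simp: hcomp_of_form[OF r(2)])
        also have "\<dots> = (if k \<in> F then r k else 0)" using fF by simp
        finally have Yk: "hcomp (a + k) p - (if k \<in> F then r k else 0) \<in> Y"
          using hideal_hcomp[OF Y diff, of "a + k"] by (simp add: hcomp_diff)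
        show "c' k = c k"
        proof (cases "k \<in> F")
          case True
          then have "\<pi> (hcomp (a + k) p) = \<pi> (r k)" using eq[OF hX r(1)] Yk by simp
          then show ?thesis by (simp add: c_def r(3))
        next
          case False
          then have "c k = \<zero>\<^bsub>M\<^esub>" using presents_zero_iff[OF hX] Yk by (simp add: c_def)
          then show ?thesis using False by (simp add: F_def)
        qed
      qed
    qed
  qed
  then show ?thesis using sub unfolding direct_sum_decomposition_def by blast
qed

lemma presents_graded_module:
  assumes T: "is_graded_ring (quo n J)"
  shows "is_graded_module (quo n J) M"
proof -
  note q = quotient_simps[OF J]
  have "Module.module (quo n J) M"
  proof (rule moduleI)
    show "cring (quo n J)" using T by (simp add: is_graded_ring_def)
    show "abelian_group M" by (rule presents_abelian_group)
  next
    fix t x assume "t \<in> carrier (quo n J)" "x \<in> carrier M"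
    then obtain w p where "w \<in> polys n" "p \<in> X" "t = cls n J w" "x = \<pi> p" by (auto simp: q carr)
    then show "t \<odot>\<^bsub>M\<^esub> x \<in> carrier M" using hideal_mult[OF X] by (auto simp: smult carr)
  next
    fix s t x assume "s \<in> carrier (quo n J)"
      "t \<in> carrier (quo n J)" "x \<in> carrier M"
    then obtain v w p where "v \<in> polys n" "w \<in> polys n" "p \<in> X" "s = cls n J v" "t = cls n J w" "x = \<pi> p"
      by (auto simp: q carr)
    then show "(s \<oplus>\<^bsub>quo n J\<^esub> t) \<odot>\<^bsub>M\<^esub> x = s \<odot>\<^bsub>M\<^esub> x \<oplus>\<^bsub>M\<^esub> t \<odot>\<^bsub>M\<^esub> x"
      "(s \<otimes>\<^bsub>quo n J\<^esub> t) \<odot>\<^bsub>M\<^esub> x = s \<odot>\<^bsub>M\<^esub> (t \<odot>\<^bsub>M\<^esub> x)"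
      using hideal_mult[OF X] by (auto simp: q smult add polys_add polys_mult distrib_right mult.assoc)
  next
    fix t x y assume "t \<in> carrier (quo n J)" "x \<in> carrier M" "y \<in> carrier M"
    then obtain w p p' where "w \<in> polys n" "p \<in> X" "p' \<in> X" "t = cls n J w" "x = \<pi> p" "y = \<pi> p'"
      by (auto simp: q carr)
    then show "t \<odot>\<^bsub>M\<^esub> (x \<oplus>\<^bsub>M\<^esub> y) = t \<odot>\<^bsub>M\<^esub> x \<oplus>\<^bsub>M\<^esub> t \<odot>\<^bsub>M\<^esub> y"
      using hideal_mult[OF X] hideal_add[OF X] by (auto simp: smult add distrib_left)
  next
    fix x assume "x \<in> carrier M"
    then show "\<one>\<^bsub>quo n J\<^esub> \<odot>\<^bsub>M\<^esub> x = x" by (auto simp: q carr smult)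
  qed
  moreover have "t \<odot>\<^bsub>M\<^esub> x \<in> gcomp M (i + j)"
    if "t \<in> rcomp (quo n J) i" "x \<in> gcomp M j" for i j t x
  proof -
    obtain w p where w: "w \<in> forms n i" "p \<in> X" "p \<in> forms n (a + j)" "t = cls n J w" "x = \<pi> p"
      using \<open>t \<in> _\<close> \<open>x \<in> _\<close> by (auto simp: q gcomp)
    have "w * p \<in> forms n (a + (i + j))" using forms_mult[OF w(1,3)] by (simp add: algebra_simps)
    then show ?thesis using w smult[OF forms_polys[OF w(1)] w(2)] hideal_mult[OF X forms_polys[OF w(1)] w(2)]
      by (auto simp: gcomp)
  qed
  ultimately show ?thesis using T presents_direct_sum by (auto simp: is_graded_module_def)
qed

end

text \<open>Multiplication by a form that carries \<open>X\<close> into \<open>X'\<close> and \<open>Y\<close> into \<open>Y'\<close>.\<close>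

lemma presents_induced_hom:
  fixes M :: "('k::field mpoly set, 'm) graded_module" and N :: "('k mpoly set, 'p) graded_module"
  assumes J: "hideal n J" and T: "is_graded_ring (quo n J)"
    and M: "presents n J M \<pi> X Y a" and N: "presents n J N \<pi>' X' Y' (a + e)"
    and g: "g \<in> forms n e" and gX: "\<And>p. p \<in> X \<Longrightarrow> g * p \<in> X'" and gY: "\<And>p. p \<in> Y \<Longrightarrow> g * p \<in> Y'"
  obtains \<phi> where "graded_hom (quo n J) M N \<phi>" "\<And>p. p \<in> X \<Longrightarrow> \<phi> (\<pi> p) = \<pi>' (g * p)"
proof -
  note m = presents_props[OF J M] and n' = presents_props[OF J N]
  define \<phi> where "\<phi> x = \<pi>' (g * (SOME p. p \<in> X \<and> \<pi> p = x))" for x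
  have \<phi>: "\<phi> (\<pi> p) = \<pi>' (g * p)" if p: "p \<in> X" for p
  proof -
    define p' where "p' = (SOME q. q \<in> X \<and> \<pi> q = \<pi> p)"
    have p': "p' \<in> X \<and> \<pi> p' = \<pi> p" unfolding p'_def by (rule someI[of _ p]) (simp add: p)
    then have "p' - p \<in> Y" using m(6)[of p' p] p by blast
    then have "g * p' - g * p \<in> Y'" using gY by (simp flip: right_diff_distrib)
    then show ?thesis using n'(6)[OF gX gX, of p' p] p p' by (simp add: \<phi>_def p'_def)
  qed
  have "graded_hom (quo n J) M N \<phi>"
    unfolding graded_hom_def
  proof (intro conjI allI)
    show "is_graded_module (quo n J) M" by (rule presents_graded_module[OF J M T])
    show "is_graded_module (quo n J) N" by (rule presents_graded_module[OF J N T])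
    have "\<phi> \<in> carrier M \<rightarrow> carrier N" using gX by (auto simp: m(4) n'(4) \<phi>)
    moreover have "\<phi> (x \<oplus>\<^bsub>M\<^esub> y) = \<phi> x \<oplus>\<^bsub>N\<^esub> \<phi> y" if "x \<in> carrier M" "y \<in> carrier M" for x y
      using that gX hideal_add[OF m(1)] by (auto simp: m(4,7) n'(7) \<phi> distrib_left)
    moreover have "\<phi> (t \<odot>\<^bsub>M\<^esub> x) = t \<odot>\<^bsub>N\<^esub> \<phi> x"
      if "t \<in> carrier (quo n J)" "x \<in> carrier M" for t x
      using that gX hideal_mult[OF m(1)] by (auto simp: m(4,8) n'(8) quotient_simps[OF J] \<phi> mult.left_commute)
    ultimately show "\<phi> \<in> module_homs (quo n J) M N" by (auto simp: module_homs_def)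
    fix k
    show "\<phi> ` gcomp M k \<subseteq> gcomp N k"
    proof
      fix y assume "y \<in> \<phi> ` gcomp M k"
      then obtain p where p: "p \<in> X" "p \<in> forms n (a + k)" "y = \<phi> (\<pi> p)" by (auto simp: m(9))
      have "g * p \<in> forms n (a + e + k)" using forms_mult[OF g p(2)] by (simp add: algebra_simps)
      then show "y \<in> gcomp N k" using p gX[OF p(1)] by (auto simp: n'(9) \<phi>)
    qed
  qed
  then show thesis using that \<phi> by blast
qed

text \<open>The sequence \<open>X/Y \<rightarrow> X'/Y' \<rightarrow> X'/Y''\<close>, first multiplication by \<open>g\<close> and then the projection.\<close>

lemma presents_short_exact:
  fixes M :: "('k::field mpoly set, 'm) graded_module" and N :: "('k mpoly set, 'p) graded_module"
    and P :: "('k mpoly set, 'q) graded_module"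
  assumes J: "hideal n J" and T: "is_graded_ring (quo n J)"
    and M: "presents n J M \<pi> X Y a" and N: "presents n J N \<pi>' X' Y' (a + e)"
    and P: "presents n J P \<pi>'' X' Y'' (a + e)"
    and g: "g \<in> forms n e" and gX: "\<And>p. p \<in> X \<Longrightarrow> g * p \<in> X'"
    and gY: "\<And>p. p \<in> X \<Longrightarrow> g * p \<in> Y' \<longleftrightarrow> p \<in> Y"
    and Y'': "Y' \<subseteq> Y''" "\<And>p. p \<in> X' \<Longrightarrow> p \<in> Y'' \<longleftrightarrow> (\<exists>q\<in>X. p - g * q \<in> Y')"
  shows "\<exists>\<phi> \<psi>. graded_short_exact (quo n J) M N P \<phi> \<psi>"
proof -
  note m = presents_props[OF J M] and n' = presents_props[OF J N] and p' = presents_props[OF J P]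
  obtain \<phi> where \<phi>: "graded_hom (quo n J) M N \<phi>" "\<And>p. p \<in> X \<Longrightarrow> \<phi> (\<pi> p) = \<pi>' (g * p)"
    by (rule presents_induced_hom[OF J T M N g gX]) (use gY m(3) in auto)
  have P0: "presents n J P \<pi>'' X' Y'' (a + e + 0)" using P by simp
  obtain \<psi> where \<psi>: "graded_hom (quo n J) N P \<psi>" "\<And>p. p \<in> X' \<Longrightarrow> \<psi> (\<pi>' p) = \<pi>'' (1 * p)"
    by (rule presents_induced_hom[OF J T N P0 forms_1]) (use Y''(1) in auto)
  have "inj_on \<phi> (carrier M)"
  proof (rule inj_onI)
    fix x y assume "x \<in> carrier M" "y \<in> carrier M" "\<phi> x = \<phi> y"
    then obtain p q where pq: "p \<in> X" "q \<in> X" "x = \<pi> p" "y = \<pi> q" "\<pi>' (g * p) = \<pi>' (g * q)"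
      by (auto simp: m(4) \<phi>(2))
    then have "g * (p - q) \<in> Y'" using n'(6)[OF gX gX] by (simp add: right_diff_distrib)
    then have "p - q \<in> Y" using gY[OF hideal_diff[OF m(1) pq(1,2)]] by simp
    then show "x = y" using m(6) pq by simp
  qed
  moreover have "\<phi> ` carrier M = {y \<in> carrier N. \<psi> y = \<zero>\<^bsub>P\<^esub>}"
  proof (intro equalityI subsetI)
    fix y assume "y \<in> \<phi> ` carrier M"
    then obtain q where q: "q \<in> X" "y = \<pi>' (g * q)" by (auto simp: m(4) \<phi>(2))
    have "g * q \<in> Y''" using Y''(2)[OF gX[OF q(1)]] q(1) hideal_0[OF n'(2)] by force
    then show "y \<in> {y \<in> carrier N. \<psi> y = \<zero>\<^bsub>P\<^esub>}"
      using q gX[OF q(1)] presents_zero_iff[OF J P gX[OF q(1)]] by (auto simp: n'(4) \<psi>(2))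
  next
    fix y assume "y \<in> {y \<in> carrier N. \<psi> y = \<zero>\<^bsub>P\<^esub>}"
    then obtain p where p: "p \<in> X'" "y = \<pi>' p" "\<pi>'' p = \<zero>\<^bsub>P\<^esub>" by (auto simp: n'(4) \<psi>(2))
    then have "p \<in> Y''" using presents_zero_iff[OF J P] by blast
    then obtain q where q: "q \<in> X" "p - g * q \<in> Y'" using Y''(2)[OF p(1)] by blast
    then have "y = \<phi> (\<pi> q)" using n'(6)[OF p(1) gX[OF q(1)]] p(2) by (simp add: \<phi>(2))
    then show "y \<in> \<phi> ` carrier M" using q(1) by (auto simp: m(4))
  qed
  moreover have "\<psi> ` carrier N = carrier P"
  proof -
    have "\<psi> ` carrier N = (\<lambda>p. \<psi> (\<pi>' p)) ` X'" by (simp add: n'(4) image_image)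
    also have "\<dots> = \<pi>'' ` X'" by (rule image_cong) (simp_all add: \<psi>(2))
    finally show ?thesis by (simp add: p'(4))
  qed
  ultimately show ?thesis using \<phi>(1) \<psi>(1) unfolding graded_short_exact_def by blast
qed

lemma presents_isomorphic:
  fixes M :: "('k::field mpoly set, 'm) graded_module" and N :: "('k mpoly set, 'p) graded_module"
  assumes J: "hideal n J" and T: "is_graded_ring (quo n J)"
    and M: "presents n J M \<pi> X Y a" and N: "presents n J N \<pi>' X Y a"
  shows "graded_isomorphic (quo n J) M N"
proof -
  note m = presents_props[OF J M] and n' = presents_props[OF J N]
  have N0: "presents n J N \<pi>' X Y (a + 0)" using N by simp
  obtain \<phi> where \<phi>: "graded_hom (quo n J) M N \<phi>" "\<And>p. p \<in> X \<Longrightarrow> \<phi> (\<pi> p) = \<pi>' (1 * p)"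
    by (rule presents_induced_hom[OF J T M N0 forms_1]) auto
  have "inj_on \<phi> (carrier M)"
    by (rule inj_onI) (auto simp: m(4,6) n'(6) \<phi>(2))
  moreover have "\<phi> ` carrier M = carrier N"
  proof -
    have "\<phi> ` carrier M = (\<lambda>p. \<phi> (\<pi> p)) ` X" by (simp add: m(4) image_image)
    also have "\<dots> = \<pi>' ` X" by (rule image_cong) (simp_all add: \<phi>(2))
    finally show ?thesis by (simp add: n'(4))
  qed
  ultimately show ?thesis using \<phi>(1) unfolding graded_isomorphic_def bij_betw_def by blast
qed

section \<open>Powers of the irrelevant ideal and cyclic modules\<close>

lemma hideal_polys: "hideal n (polys n)"
  by (rule hidealI) (auto simp: polys_add polys_mult forms_polys[OF hcomp_in_forms])

text \<open>The polynomials without terms of degree less than \<open>i\<close>; this filtration bounds the powers of the irrelevant ideals.\<close>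

definition order_ge :: "nat \<Rightarrow> nat \<Rightarrow> 'k::field mpoly set" where
  "order_ge n i = {p \<in> polys n. \<forall>k < int i. hcomp k p = 0}"

lemma hcomp_mult_expand: "hcomp k (p * q) = (\<Sum>i\<in>degrees p. hcomp i p * hcomp (k - i) q)"
  if "p \<in> polys n" "q \<in> polys n"
proof -
  have "p * q = (\<Sum>i\<in>degrees p. hcomp i p * q)"
    using arg_cong[OF sum_hcomp[of p], of "\<lambda>x. x * q"] by (simp only: sum_distrib_right)
  then have "hcomp k (p * q) = (\<Sum>i\<in>degrees p. hcomp k (hcomp i p * q))" by (simp only: hcomp_sum)
  then show ?thesis by (simp add: hcomp_form_mult[OF hcomp_in_forms[OF that(1)] that(2)])
qed

lemma order_ge_mult:
  assumes "p \<in> order_ge n i" "q \<in> order_ge n j"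
  shows "p * q \<in> order_ge n (i + j)"
proof -
  have pq: "p \<in> polys n" "q \<in> polys n" using assms by (auto simp: order_ge_def)
  have "hcomp k (p * q) = 0" if "k < int (i + j)" for k
  proof -
    have "hcomp a p * hcomp (k - a) q = 0" for a
      using assms that by (cases "a < int i") (auto simp: order_ge_def)
    then show ?thesis unfolding hcomp_mult_expand[OF pq] by (intro sum.neutral ballI)
  qed
  then show ?thesis using pq by (simp add: order_ge_def polys_mult)
qed

lemma hideal_order_ge: "hideal n (order_ge n i :: 'k::field mpoly set)"
proof (rule hidealI)
  fix a b :: "'k mpoly" assume "a \<in> order_ge n i" "b \<in> order_ge n i"
  then show "a + b \<in> order_ge n i" by (auto simp: order_ge_def polys_add hcomp_add)
next
  fix a b :: "'k mpoly" assume "a \<in> polys n" "b \<in> order_ge n i"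
  moreover from this(1) have "a \<in> order_ge n 0" by (simp add: order_ge_def hcomp_negative)
  ultimately show "a * b \<in> order_ge n i" using order_ge_mult[of a n 0 b i] by simp
next
  fix k and a :: "'k mpoly" assume a: "a \<in> order_ge n i"
  then have "hcomp k a \<in> forms n k" by (auto simp: order_ge_def intro: hcomp_in_forms)
  then show "hcomp k a \<in> order_ge n i" using a by (auto simp: order_ge_def hcomp_of_form forms_polys)
qed (auto simp: order_ge_def)

lemma form_in_order_ge: "p \<in> forms n k \<Longrightarrow> k \<ge> int i \<Longrightarrow> p \<in> order_ge n i"
  by (auto simp: order_ge_def hcomp_of_form forms_polys)

lemma ideal_power_in:
  assumes "x \<in> m" "\<And>k. pw (Suc k) = x \<otimes>\<^bsub>A\<^esub> pw k" "pw 0 \<in> carrier A"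
  shows "pw i \<in> ideal_power A m i"
proof (induction i)
  case (Suc i)
  then show ?case using ideal_prod.prod[OF assms(1), of "pw i" _ A] by (simp add: assms(2))
qed (simp add: assms(3))

text \<open>A multiplicative filtration whose first step contains the ideal contains its powers.\<close>

lemma ideal_power_graded_bound:
  assumes F0: "carrier A \<subseteq> F 0" and m: "m \<subseteq> F 1"
    and mult: "\<And>i x y. x \<in> F 1 \<Longrightarrow> y \<in> F i \<Longrightarrow> x \<otimes>\<^bsub>A\<^esub> y \<in> F (Suc i)"
    and add: "\<And>i x y. x \<in> F i \<Longrightarrow> y \<in> F i \<Longrightarrow> x \<oplus>\<^bsub>A\<^esub> y \<in> F i"
  shows "ideal_power A m i \<subseteq> F i"
proof (induction i)
  case (Suc i)
  have "x \<in> F (Suc i)" if "x \<in> ideal_prod A m (ideal_power A m i)" for x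
    using that by induction (use Suc m in \<open>auto intro!: mult add\<close>)
  then show ?case by auto
qed (simp add: F0)

lemma Idl_Var:
  shows "Idl\<^bsub>poly_ring n\<^esub> (Var ` {0..n}) = (var_ideal n (Suc n) :: 'k::field mpoly set)"
proof -
  have eq: "(Var ` {0..n} :: 'k mpoly set) = set (map Var [0..<Suc n])" by (auto simp del: upt_Suc)
  have "Idl\<^bsub>poly_ring n\<^esub> (set (map Var [0..<Suc n])) = (foldl (adjoin n) {0} (map Var [0..<Suc n]) :: 'k mpoly set)"
    by (rule Idl_forms[THEN conjunct1]) (auto intro!: exI[of _ 1] Var_forms simp del: upt_Suc)
  also have "\<dots> = adjoin_all n {0} (varseq (Suc n))"
    by (simp add: adjoin_all_def varseq_def comp_def del: upt_Suc)
  also have "\<dots> = var_ideal n (Suc n)" by (rule varseq_regular[THEN conjunct2]) simp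
  finally show ?thesis by (simp only: eq)
qed

lemma positive_form_in_var_ideal:
  assumes "f \<in> forms n d" "d > 0"
  shows "f \<in> var_ideal n (Suc n)"
proof -
  have "1 \<in> socle n (var_ideal n (Suc n))"
    using Var_polys[of _ n] by (auto simp: socle_def var_ideal_def Var_def lookup_single when_def)
  from socle_mult[OF hideal_var_ideal this assms] show ?thesis by simp
qed

lemma var_ideal_subset_order_ge: "var_ideal n (Suc n) \<subseteq> (order_ge n 1 :: 'k::field mpoly set)"
proof
  fix p :: "'k mpoly" assume p: "p \<in> var_ideal n (Suc n)"
  have "hcomp k p = 0" if "k < 1" for k
  proof (rule poly_mapping_eqI)
    fix m
    show "lookup (hcomp k p) m = lookup 0 m"
    proof (cases "m \<in> keys p \<and> int (mon_degree m) = k")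
      case True
      then obtain i where "lookup m i \<noteq> 0" using p by (auto simp: var_ideal_def)
      then show ?thesis using lookup_le_mon_degree[of m i] True \<open>k < 1\<close> by simp
    next
      case False
      then show ?thesis by (auto simp: lookup_hcomp in_keys_iff)
    qed
  qed
  then show "p \<in> order_ge n 1" using p by (simp add: order_ge_def var_ideal_def)
qed

context
  fixes n and J :: "'k::field mpoly set"
  assumes J: "hideal n J" and T: "cring (quo n J)"
begin

lemma quotient_uminus: "p \<in> polys n \<Longrightarrow> \<ominus>\<^bsub>quo n J\<^esub> cls n J p = cls n J (- p)"
proof -
  interpret T: cring "quo n J" by (rule T)
  assume p: "p \<in> polys n"
  show ?thesis
    using p polys_uminus[OF p] by (intro T.minus_equality) (auto simp: quotient_simps[OF J])
qed

lemma quotient_minus: "p \<in> polys n \<Longrightarrow> q \<in> polys n \<Longrightarrow>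
    cls n J p \<ominus>\<^bsub>quo n J\<^esub> cls n J q = cls n J (p - q)"
  by (simp add: a_minus_def quotient_uminus quotient_simps[OF J] polys_uminus)

lemma ideal_image:
  assumes X: "hideal n X"
  shows "ideal (cls n J ` X) (quo n J)"
proof (rule idealI)
  interpret T: cring "quo n J" by (rule T)
  note q = quotient_simps[OF J] note xp = hideal_subset[OF X]
  show "ring (quo n J)" ..
  show "subgroup (cls n J ` X) (add_monoid (quo n J))"
  proof
    show "cls n J ` X \<subseteq> carrier (add_monoid (quo n J))"
      using xp by (auto simp: q)
    show "\<one>\<^bsub>add_monoid (quo n J)\<^esub> \<in> cls n J ` X"
      using hideal_0[OF X] by (auto simp: q)
    fix x assume "x \<in> cls n J ` X"
    then obtain p where p: "p \<in> X" "x = cls n J p" by auto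
    have "inv\<^bsub>add_monoid (quo n J)\<^esub> x = cls n J (- p)"
      using quotient_uminus[OF xp[OF p(1)]] p(2) by (simp add: a_inv_def)
    then show "inv\<^bsub>add_monoid (quo n J)\<^esub> x \<in> cls n J ` X"
      using hideal_uminus[OF X p(1)] by simp
    fix y assume "y \<in> cls n J ` X"
    then show "x \<otimes>\<^bsub>add_monoid (quo n J)\<^esub> y \<in> cls n J ` X"
      using p hideal_add[OF X] xp by (auto simp: q)
  qed
  fix a x assume "a \<in> cls n J ` X" "x \<in> carrier (quo n J)"
  then show "x \<otimes>\<^bsub>quo n J\<^esub> a \<in> cls n J ` X"
    "a \<otimes>\<^bsub>quo n J\<^esub> x \<in> cls n J ` X"
    using hideal_mult[OF X] hideal_mult_right[OF X] xp by (auto simp: q)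
qed

lemma irrelevant_ideal_quotient:
  "irrelevant_ideal (quo n J) \<subseteq> cls n J ` order_ge n 1"
  "p \<in> forms n k \<Longrightarrow> k > 0 \<Longrightarrow> cls n J p \<in> irrelevant_ideal (quo n J)"
proof -
  interpret T: cring "quo n J" by (rule T)
  note q = quotient_simps[OF J]
  show "irrelevant_ideal (quo n J) \<subseteq> cls n J ` order_ge n 1"
    unfolding irrelevant_ideal_def
    by (rule T.genideal_minimal[OF ideal_image[OF hideal_order_ge]]) (auto simp: q intro!: form_in_order_ge)
  have "(\<Union>k\<in>{0<..}. rcomp (quo n J) k) \<subseteq> carrier (quo n J)"
    using forms_polys by (auto simp: q)
  from T.genideal_self[OF this]
  show "p \<in> forms n k \<Longrightarrow> k > 0 \<Longrightarrow> cls n J p \<in> irrelevant_ideal (quo n J)"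
    unfolding irrelevant_ideal_def by (auto simp: q)
qed

lemma ideal_power_quotient:
  "ideal_power (quo n J) (irrelevant_ideal (quo n J)) i
     \<subseteq> cls n J ` order_ge n i"
proof (rule ideal_power_graded_bound)
  note q = quotient_simps[OF J]
  have lp: "p \<in> order_ge n j \<Longrightarrow> p \<in> polys n" for p :: "'k mpoly" and j by (simp add: order_ge_def)
  show "carrier (quo n J) \<subseteq> cls n J ` order_ge n 0"
    by (auto simp: q order_ge_def hcomp_negative)
  show "x \<otimes>\<^bsub>quo n J\<^esub> y \<in> cls n J ` order_ge n (Suc i)"
    if "x \<in> cls n J ` order_ge n 1" "y \<in> cls n J ` order_ge n i" for i x y
  proof -
    obtain p p' where "x = cls n J p" "p \<in> order_ge n 1" "y = cls n J p'" "p' \<in> order_ge n i" using \<open>x \<in> _\<close> \<open>y \<in> _\<close> by blast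
    moreover from this have "p * p' \<in> order_ge n (Suc i)" using order_ge_mult[of p n 1 p' i] by simp
    ultimately show ?thesis using lp by (auto simp: q)
  qed
  show "x \<oplus>\<^bsub>quo n J\<^esub> y \<in> cls n J ` order_ge n i"
    if "x \<in> cls n J ` order_ge n i" "y \<in> cls n J ` order_ge n i" for i x y
  proof -
    obtain p p' where "x = cls n J p" "p \<in> order_ge n i" "y = cls n J p'" "p' \<in> order_ge n i" using \<open>x \<in> _\<close> \<open>y \<in> _\<close> by blast
    moreover from this have "p + p' \<in> order_ge n i" using hideal_add[OF hideal_order_ge, of p n i p'] by simp
    ultimately show ?thesis using lp by (auto simp: q)
  qed
qed (rule irrelevant_ideal_quotient(1))

lemma presents_quotient_ring:
  "presents n J (ring_as_module (\<lambda>t. t) (quo n J)) (cls n J) (polys n) J 0"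
  using hideal_subset[OF J] forms_subset[of n]
  by (auto simp: presents_def ring_as_module_def quotient_simps[OF J] J hideal_polys cls_eq_iff[OF J]
      Int_absorb1)

text \<open>The surjection of \<open>S/J\<close> onto \<open>S/I\<close>, as it acts on cosets.\<close>

lemma set_add_cls:
  assumes I: "hideal n I" and JI: "J \<subseteq> I" and w: "w \<in> polys n"
  shows "I <+>\<^bsub>poly_ring n\<^esub> cls n J w = cls n I w"
proof
  show "I <+>\<^bsub>poly_ring n\<^esub> cls n J w \<subseteq> cls n I w"
  proof
    fix x assume "x \<in> I <+>\<^bsub>poly_ring n\<^esub> cls n J w"
    then obtain i j where ij: "i \<in> I" "j \<in> J" "x = i + (j + w)" by (auto simp: set_add_def' a_r_coset_def')
    then have "i + j \<in> I" using JI hideal_add[OF I] by blast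
    then show "x \<in> cls n I w" using ij(3) by (force simp: a_r_coset_def' add.assoc)
  qed
  show "cls n I w \<subseteq> I <+>\<^bsub>poly_ring n\<^esub> cls n J w"
    using hideal_0[OF J] by (force simp: set_add_def' a_r_coset_def')
qed

lemma presents_further_quotient:
  assumes I: "hideal n I" and JI: "J \<subseteq> I"
  shows "presents n J (ring_as_module (\<lambda>t. I <+>\<^bsub>poly_ring n\<^esub> t) (graded_quotient (poly_ring n) I))
    (cls n I) (polys n) I 0"
  using hideal_subset[OF I] forms_subset[of n]
  by (auto simp: presents_def ring_as_module_def quotient_simps[OF I] I hideal_polys cls_eq_iff[OF I]
      Int_absorb1 set_add_cls[OF I JI])

lemma presents_cyclic_quotient:
  assumes A: "hideal n A" and JA: "J \<subseteq> A"
  shows "presents n J (ring_as_module (\<lambda>t. cls n J ` A +>\<^bsub>quo n J\<^esub> t)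
      (graded_quotient (quo n J) (cls n J ` A)))
    (\<lambda>p. cls n J ` A +>\<^bsub>quo n J\<^esub> cls n J p) (polys n) A 0"
proof -
  interpret T: cring "quo n J" by (rule T)
  note q = quotient_simps[OF J]
  note id = ideal_image[OF A]
  interpret K: ideal "cls n J ` A" "quo n J" by (rule id)
  have mem: "cls n J p \<in> cls n J ` A \<longleftrightarrow> p \<in> A" if p: "p \<in> polys n" for p
  proof
    assume "cls n J p \<in> cls n J ` A"
    then obtain a where "a \<in> A" "cls n J p = cls n J a" by blast
    then have "p - a \<in> A" using cls_eq_iff[OF J p] hideal_subset[OF A] JA by blast
    then show "p \<in> A" using hideal_cong[OF A] \<open>a \<in> A\<close> by blast
  qed simp
  have eq: "(cls n J ` A +>\<^bsub>quo n J\<^esub> cls n J p) = (cls n J ` A +>\<^bsub>quo n J\<^esub> cls n J p')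
     \<longleftrightarrow> p - p' \<in> A" if "p \<in> polys n" "p' \<in> polys n" for p p'
    using T.quotient_eq_iff_same_a_r_cos[OF id, of "cls n J p" "cls n J p'"] that
    by (simp add: quotient_minus mem polys_diff q)
  have z: "cls n J ` A +>\<^bsub>quo n J\<^esub> cls n J 0 = cls n J ` A"
    using T.a_coset_add_zero[of "cls n J ` A"] hideal_subset[OF A] by (auto simp: q)
  have int: "polys n \<inter> forms n k = forms n k" for k using forms_subset[of n k] by blast
  show ?thesis
    unfolding presents_def ring_as_module_def
    using K.a_rcos_sum K.rcoset_mult_add
    by (auto simp: graded_quotient_sel[of "quo n J"] q A hideal_polys eq z
        hideal_subset[OF A] image_image int)
qed

end

text \<open>A bijective graded homomorphism transports a presentation. Only its inverse needs an argument, because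
a graded homomorphism is merely required to map components into components: if the image of \<open>x\<close> is
homogeneous, then comparing components in the target shows that all components of \<open>x\<close> but one vanish.\<close>

lemma presents_transfer:
  fixes M :: "('k::field mpoly set, 'm) graded_module" and N :: "('k mpoly set, 'p) graded_module"
  assumes J: "hideal n J" and N: "presents n J N \<pi> X Y a"
    and M: "is_graded_module (quo n J) M"
    and iso: "graded_isomorphic (quo n J) M N"
  shows "\<exists>\<pi>'. presents n J M \<pi>' X Y a"
proof -
  note n' = presents_props[OF J N] and q = quotient_simps[OF J]
  obtain \<omega> where \<omega>: "graded_hom (quo n J) M N \<omega>" "bij_betw \<omega> (carrier M) (carrier N)"
    using iso by (auto simp: graded_isomorphic_def)
  interpret M: Module.module "quo n J" M using M by (simp add: is_graded_module_def)
  have dec: "direct_sum_decomposition M (gcomp M)" using M by (simp add: is_graded_module_def)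
  have \<omega>_add: "\<omega> (x \<oplus>\<^bsub>M\<^esub> y) = \<omega> x \<oplus>\<^bsub>N\<^esub> \<omega> y" if "x \<in> carrier M" "y \<in> carrier M" for x y
    using \<omega>(1) that by (simp add: graded_hom_def module_homs_def)
  have \<omega>_smult: "\<omega> (t \<odot>\<^bsub>M\<^esub> x) = t \<odot>\<^bsub>N\<^esub> \<omega> x" if "t \<in> carrier (quo n J)" "x \<in> carrier M" for t x
    using \<omega>(1) that by (simp add: graded_hom_def module_homs_def)
  define \<pi>' where "\<pi>' p = inv_into (carrier M) \<omega> (\<pi> p)" for p
  have \<pi>'c: "\<pi>' p \<in> carrier M" "\<omega> (\<pi>' p) = \<pi> p" if "p \<in> X" for p
    using bij_betw_inv_into_right[OF \<omega>(2), of "\<pi> p"] inv_into_into[of "\<pi> p" \<omega> "carrier M"] that \<omega>(2)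
    by (auto simp: \<pi>'_def bij_betw_def n'(4))
  have inj: "x = y" if "x \<in> carrier M" "y \<in> carrier M" "\<omega> x = \<omega> y" for x y
    using \<omega>(2) that by (auto simp: bij_betw_def inj_on_def)
  have ex: "\<exists>p\<in>X. x = \<pi>' p" if x: "x \<in> carrier M" for x
  proof -
    have "\<omega> x \<in> \<pi> ` X" using \<omega>(2) x n'(4) by (auto simp: bij_betw_def)
    then obtain p where p: "p \<in> X" "\<omega> x = \<pi> p" by blast
    then have "x = \<pi>' p" using \<pi>'c[OF p(1)] inj[OF x] by simp
    then show ?thesis using p(1) by blast
  qed
  have eq: "\<pi>' p = \<pi>' q \<longleftrightarrow> p - q \<in> Y" if "p \<in> X" "q \<in> X" for p q
    using \<pi>'c[OF that(1)] \<pi>'c[OF that(2)] n'(6)[OF that] inj by metis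
  have add: "\<pi>' p \<oplus>\<^bsub>M\<^esub> \<pi>' q = \<pi>' (p + q)" if "p \<in> X" "q \<in> X" for p q
    by (rule inj) (use that \<pi>'c hideal_add[OF n'(1)] in \<open>simp_all add: \<omega>_add n'(7)\<close>)
  have smult: "cls n J w \<odot>\<^bsub>M\<^esub> \<pi>' p = \<pi>' (w * p)" if "w \<in> polys n" "p \<in> X" for w p
    by (rule inj) (use that \<pi>'c hideal_mult[OF n'(1)] in \<open>simp_all add: \<omega>_smult n'(8) q\<close>)
  have "\<pi>' 0 \<oplus>\<^bsub>M\<^esub> \<pi>' 0 = \<pi>' 0" using add[of 0 0] hideal_0[OF n'(1)] by simp
  then have zero: "\<zero>\<^bsub>M\<^esub> = \<pi>' 0"
    using \<pi>'c(1)[OF hideal_0[OF n'(1)]] by (metis M.M.add.l_cancel_one)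
  have sum: "finsum M (\<lambda>k. \<pi>' (r k)) F = \<pi>' (\<Sum>k\<in>F. r k)" if "finite F" "\<And>k. k \<in> F \<Longrightarrow> r k \<in> X"
    for F and r :: "int \<Rightarrow> 'k mpoly"
    using that
  proof (induction F rule: finite_induct)
    case (insert x F)
    have "(\<Sum>k\<in>F. r k) \<in> X" by (rule hideal_sum[OF n'(1)]) (use insert.prems in auto)
    then show ?case
      using insert \<pi>'c(1) by (subst M.M.finsum_insert) (auto simp: add)
  qed (simp add: zero)
  have sub: "additive_subgroup (gcomp M k) M" for k using dec by (simp add: direct_sum_decomposition_def)
  have gcomp1: "\<exists>r. r \<in> X \<and> r \<in> forms n (a + k) \<and> x = \<pi>' r" if x: "x \<in> gcomp M k" for x k
  proof -
    have xc: "x \<in> carrier M" using additive_subgroup.a_subset[OF sub] x by blast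
    have "\<omega> x \<in> gcomp N k" using \<omega>(1) x by (auto simp: graded_hom_def)
    then obtain r where r: "r \<in> X" "r \<in> forms n (a + k)" "\<omega> x = \<pi> r" by (auto simp: n'(9))
    then have "x = \<pi>' r" using inj[OF xc] \<pi>'c by simp
    then show ?thesis using r by blast
  qed
  have gcomp2: "\<pi>' p \<in> gcomp M k" if p: "p \<in> X" "p \<in> forms n (a + k)" for p k
  proof -
    have "\<exists>c. (\<forall>k. c k \<in> gcomp M k) \<and> finite {k. c k \<noteq> \<zero>\<^bsub>M\<^esub>} \<and> \<pi>' p = finsum M c {k. c k \<noteq> \<zero>\<^bsub>M\<^esub>}"
      using dec \<pi>'c(1)[OF p(1)] unfolding direct_sum_decomposition_def by blast
    then obtain c where c: "\<And>k. c k \<in> gcomp M k" "finite {k. c k \<noteq> \<zero>\<^bsub>M\<^esub>}" "\<pi>' p = finsum M c {k. c k \<noteq> \<zero>\<^bsub>M\<^esub>}"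
      by blast
    define F where "F = {k. c k \<noteq> \<zero>\<^bsub>M\<^esub>}"
    obtain r where r: "\<And>k. r k \<in> X" "\<And>k. r k \<in> forms n (a + k)" "\<And>k. c k = \<pi>' (r k)"
      using gcomp1[OF c(1)] by metis
    have cr: "c = (\<lambda>k. \<pi>' (r k))" using r(3) by blast
    have fF: "finite F" using c(2) by (simp add: F_def)
    have "\<pi>' p = \<pi>' (\<Sum>k\<in>F. r k)" using c(3) sum[OF fF r(1)] by (simp add: F_def cr)
    then have diff: "p - (\<Sum>k\<in>F. r k) \<in> Y" using eq[OF p(1)] hideal_sum[OF n'(1), of F r] r(1) by simp
    have "F \<subseteq> {k}"
    proof
      fix j assume j: "j \<in> F"
      show "j \<in> {k}"
      proof (rule ccontr)
        assume ne: "j \<notin> {k}"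
        have "hcomp (a + j) (\<Sum>i\<in>F. r i) = (\<Sum>i\<in>F. if i = j then r j else 0)"
          unfolding hcomp_sum by (rule sum.cong) (auto simp: hcomp_of_form[OF r(2)])
        then have "hcomp (a + j) (p - (\<Sum>k\<in>F. r k)) = - r j"
          using ne j fF by (simp add: hcomp_diff hcomp_of_form[OF p(2)])
        then have "- r j \<in> Y" using hideal_hcomp[OF n'(2) diff, of "a + j"] by simp
        then have "r j \<in> Y" using hideal_uminus[OF n'(2)] by force
        then have "c j = \<zero>\<^bsub>M\<^esub>" using eq[OF r(1) hideal_0[OF n'(1)]] by (simp add: r(3) zero)
        then show False using j by (simp add: F_def)
      qed
    qed
    then consider "F = {}" | "F = {k}" by blast
    then show ?thesis
    proof cases
      case 1
      then have "\<pi>' p = \<zero>\<^bsub>M\<^esub>" using c(3) by (simp add: F_def)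
      then show ?thesis using additive_subgroup.zero_closed[OF sub] by simp
    next
      case 2
      then have "\<pi>' p = \<pi>' (r k)" using c(3) sum[OF fF r(1)] by (simp add: F_def cr)
      then show ?thesis using c(1)[of k] by (simp add: r(3))
    qed
  qed
  have "presents n J M \<pi>' X Y a"
    unfolding presents_def
  proof (intro conjI ballI allI)
    show "carrier M = \<pi>' ` X" using ex \<pi>'c(1) by blast
    show "gcomp M k = \<pi>' ` (X \<inter> forms n (a + k))" for k using gcomp1 gcomp2 by blast
  qed (use n'(1-3) eq add smult zero in auto)
  then show ?thesis by blast
qed

section \<open>The modules of the theorem as subquotients\<close>

locale linked_ring = linked_form +
  assumes graded_T: "is_graded_ring (quo n J)"
begin

abbreviation "S \<equiv> poly_ring n"
abbreviation "T \<equiv> quo n J"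
abbreviation "K \<equiv> cls n J ` A"

lemma cring_T: "cring T" using graded_T by (simp add: is_graded_ring_def)

lemmas q = quotient_simps[OF J]

lemma J_subset_A: "J \<subseteq> A"
  using hideal_subset[OF J] hideal_mult_right[OF J fp] by (auto simp: A_iff)

text \<open>The powers of \<open>l\<close> lie in the powers of the irrelevant ideal, so an element of the saturation is carried into
\<open>I\<close> by some \<open>l\<^sup>i\<close>, and hence lies in \<open>L\<close>. Conversely the \<open>M\<close>-th power of the irrelevant ideal raises degrees enough to
carry \<open>L\<close> into \<open>I\<close>.\<close>

lemma saturation_eq: "saturation S (Idl\<^bsub>S\<^esub> (Var ` {0..n})) I = L"
proof -
  define m :: "'a mpoly set" where "m = Idl\<^bsub>S\<^esub> (Var ` {0..n})"
  have m: "m = var_ideal n (Suc n)" by (simp add: m_def Idl_Var)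
  have "l \<in> m" unfolding m by (rule positive_form_in_var_ideal[OF l]) simp
  then have pow: "l ^ i \<in> ideal_power S m i" for i
    by (rule ideal_power_in) auto
  have bound: "ideal_power S m i \<subseteq> order_ge n i" for i
  proof (rule ideal_power_graded_bound)
    show "m \<subseteq> order_ge n 1" unfolding m by (rule var_ideal_subset_order_ge)
    show "x \<otimes>\<^bsub>S\<^esub> y \<in> order_ge n (Suc i)" if "x \<in> order_ge n 1" "y \<in> order_ge n i" for i and x y :: "'a mpoly"
      using order_ge_mult[OF that] by simp
  qed (auto simp: order_ge_def hcomp_negative polys_add hcomp_add)
  have "p \<in> L" if sat: "p \<in> saturation S m I" for p
  proof -
    obtain i where p: "p \<in> polys n" "\<forall>b\<in>ideal_power S m i. p * b \<in> I"
      using sat by (auto simp: saturation_def colon_def)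
    then have "p * l ^ i \<in> I" using pow[of i] by blast
    then have "l ^ i * p \<in> I" by (simp only: mult.commute)
    then show ?thesis by (rule in_L_if_power_in_I[OF p(1)])
  qed
  moreover have "p \<in> saturation S m I" if p: "p \<in> L" for p
  proof -
    have "p * b \<in> I" if "b \<in> ideal_power S m M" for b
    proof -
      have "b \<in> order_ge n M" using bound[of M] that by blast
      then have "b * p \<in> I" by (intro high_degree_times_L[OF p]) (auto simp: order_ge_def)
      then show ?thesis by (simp only: mult.commute)
    qed
    then have "p \<in> colon S I (ideal_power S m M)" using L_polys[OF p] by (simp add: colon_def)
    then show ?thesis unfolding saturation_def using M(1) by blast
  qed
  ultimately show ?thesis unfolding m_def by blast
qed

text \<open>\<open>A\<close> annihilates \<open>L\<close> by definition of \<open>L\<close>, and an annihilator of \<open>L\<close> annihilates \<open>f \<in> L\<close>.\<close>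

lemma ann_eq: "ann T (cls n J ` L) = K"
proof (intro equalityI subsetI)
  fix t assume t: "t \<in> ann T (cls n J ` L)"
  then obtain w where w: "w \<in> polys n" "t = cls n J w" by (auto simp: ann_def q)
  have "f \<in> L" using adjoin_self[OF J, of 1 f] I_subset_L by auto
  then have "t \<otimes>\<^bsub>T\<^esub> cls n J f = \<zero>\<^bsub>T\<^esub>" using t by (auto simp: ann_def)
  then have "w * f \<in> J" using w fp by (simp add: q cls_eq_iff[OF J] polys_mult)
  then show "t \<in> K" using w by (auto simp: A_iff)
next
  fix t assume "t \<in> K"
  then obtain a where a: "a \<in> A" "t = cls n J a" by blast
  note ap = hideal_subset[OF hideal_A a(1)]
  have "t \<otimes>\<^bsub>T\<^esub> cls n J p = \<zero>\<^bsub>T\<^esub>" if p: "p \<in> L" for p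
    using A_L[OF a(1) p] ap L_polys[OF p] by (simp add: a(2) q cls_eq_iff[OF J] polys_mult)
  then show "t \<in> ann T (cls n J ` L)" using a(2) ap by (auto simp: ann_def q)
qed

definition "B \<equiv> ring_as_module (\<lambda>t. K +>\<^bsub>T\<^esub> t) (graded_quotient T K)"
definition "R \<equiv> ring_as_module (\<lambda>t. I <+>\<^bsub>S\<^esub> t) (graded_quotient S I)"
definition "H0 \<equiv> local_cohomology_0 T (irrelevant_ideal T) R"
abbreviation "b p \<equiv> K +>\<^bsub>T\<^esub> cls n J p"

lemma presents_B: "presents n J B b (polys n) A 0"
  unfolding B_def by (rule presents_cyclic_quotient[OF J cring_T hideal_A J_subset_A])

lemma presents_R: "presents n J R (cls n I) (polys n) I 0"
  unfolding R_def by (rule presents_further_quotient[OF J cring_T hideal_I J_subset_I])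

lemma torsion_eq:
  "{x \<in> carrier R. \<exists>i. \<forall>t\<in>ideal_power T (irrelevant_ideal T) i. t \<odot>\<^bsub>R\<^esub> x = \<zero>\<^bsub>R\<^esub>} = cls n I ` L"
proof (intro equalityI subsetI)
  note r = presents_props[OF J presents_R] presents_zero_iff[OF J presents_R]
  fix x
  assume x: "x \<in> {x \<in> carrier R. \<exists>i. \<forall>t\<in>ideal_power T (irrelevant_ideal T) i. t \<odot>\<^bsub>R\<^esub> x = \<zero>\<^bsub>R\<^esub>}"
  then obtain p i where p: "p \<in> polys n" "x = cls n I p"
      "\<forall>t\<in>ideal_power T (irrelevant_ideal T) i. t \<odot>\<^bsub>R\<^esub> x = \<zero>\<^bsub>R\<^esub>"
    by (auto simp: r(4))
  have "cls n J (l ^ i) \<in> ideal_power T (irrelevant_ideal T) i"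
    by (rule ideal_power_in[OF irrelevant_ideal_quotient(2)[OF J cring_T l]])
       (use lp forms_polys[OF l] in \<open>simp_all add: q\<close>)
  then have "cls n J (l ^ i) \<odot>\<^bsub>R\<^esub> cls n I p = \<zero>\<^bsub>R\<^esub>" using p by blast
  then have "l ^ i * p \<in> I" using r(8)[OF lp p(1)] r(10)[OF polys_mult[OF lp p(1)]] by simp
  then have "p \<in> L" by (rule in_L_if_power_in_I[OF p(1)])
  then show "x \<in> cls n I ` L" using p(2) by blast
next
  note r = presents_props[OF J presents_R] presents_zero_iff[OF J presents_R]
  fix x assume "x \<in> cls n I ` L"
  then obtain p where p: "p \<in> L" "x = cls n I p" by blast
  have "t \<odot>\<^bsub>R\<^esub> x = \<zero>\<^bsub>R\<^esub>" if t: "t \<in> ideal_power T (irrelevant_ideal T) M" for t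
  proof -
    obtain w where w: "w \<in> order_ge n M" "t = cls n J w"
      using ideal_power_quotient[OF J cring_T, of M] t by blast
    have wp: "w \<in> polys n" using w(1) by (simp add: order_ge_def)
    have "w * p \<in> I" using high_degree_times_L[OF p(1), of w] w(1) by (simp add: order_ge_def)
    then show ?thesis
      using r(8)[OF wp L_polys[OF p(1)]] r(10)[OF polys_mult[OF wp L_polys[OF p(1)]]] by (simp add: w(2) p(2))
  qed
  moreover have "x \<in> carrier R" using p L_polys by (auto simp: r(4))
  ultimately show "x \<in> {x \<in> carrier R. \<exists>i. \<forall>t\<in>ideal_power T (irrelevant_ideal T) i. t \<odot>\<^bsub>R\<^esub> x = \<zero>\<^bsub>R\<^esub>}"
    by blast
qed

lemma presents_H0: "presents n J H0 (cls n I) L I 0"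
proof -
  note r = presents_props[OF J presents_R]
  have H0: "H0 = R\<lparr>carrier := cls n I ` L, gcomp := \<lambda>k. gcomp R k \<inter> cls n I ` L\<rparr>"
    by (simp add: H0_def local_cohomology_0_def torsion_eq Let_def)
  have "gcomp R k \<inter> cls n I ` L = cls n I ` (L \<inter> forms n k)" for k
  proof -
    have in_L: "p \<in> L" if p: "p \<in> forms n k" "cls n I p = cls n I p'" "p' \<in> L" for p p'
    proof -
      have "p - p' \<in> I" using r(6)[OF forms_polys[OF p(1)] L_polys[OF p(3)]] p(2) by simp
      then show ?thesis using hideal_cong[OF hideal_L, of p p'] I_subset_L p(3) by blast
    qed
    show ?thesis
    proof (intro equalityI subsetI)
      fix x assume "x \<in> gcomp R k \<inter> cls n I ` L"
      then obtain p p' where p: "p \<in> forms n k" "x = cls n I p" "p' \<in> L" "x = cls n I p'" by (auto simp: r(9))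
      then have "p \<in> L" using in_L[of p p'] by simp
      then show "x \<in> cls n I ` (L \<inter> forms n k)" using p(1,2) by blast
    next
      fix x assume "x \<in> cls n I ` (L \<inter> forms n k)"
      then show "x \<in> gcomp R k \<inter> cls n I ` L" using L_polys by (auto simp: r(9))
    qed
  qed
  then show ?thesis
    unfolding presents_def H0
    using hideal_L hideal_I I_subset_L r(5-8) L_polys by auto
qed

text \<open>The homomorphism from \<open>B\<close> that sends the class of \<open>w\<close> to the element \<open>v (w * p)\<close>, hence the class of \<open>1\<close> to \<open>v p\<close>.\<close>

definition mult_hom :: "('a mpoly \<Rightarrow> 'w) \<Rightarrow> 'a mpoly \<Rightarrow> 'a mpoly set set \<Rightarrow> 'w" where
  "mult_hom v p = (\<lambda>x\<in>carrier B. v ((SOME w. w \<in> polys n \<and> b w = x) * p))"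

context
  fixes \<Omega> :: "('a mpoly set, 'w) graded_module" and v
  assumes \<Omega>: "presents n J \<Omega> v (polys n) J tau"
begin

lemmas o = presents_props[OF J \<Omega>]
lemmas bp = presents_props[OF J presents_B]

lemma mult_hom_apply:
  assumes p: "p \<in> L" and w: "w \<in> polys n"
  shows "mult_hom v p (b w) = v (w * p)"
proof -
  define w' where "w' = (SOME u. u \<in> polys n \<and> b u = b w)"
  have w': "w' \<in> polys n \<and> b w' = b w" unfolding w'_def by (rule someI[of _ w]) (simp add: w)
  then have "w' - w \<in> A" using bp(6)[OF _ w] by blast
  then have "(w' - w) * p \<in> J" using A_L p by blast
  then have "w' * p - w * p \<in> J" by (simp add: left_diff_distrib)
  then have "v (w' * p) = v (w * p)" using o(6)[of "w' * p" "w * p"] w' w L_polys[OF p] by (simp add: polys_mult)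
  moreover have "b w \<in> carrier B" using w by (auto simp: bp(4))
  ultimately show ?thesis by (simp add: mult_hom_def w'_def)
qed

lemma mult_hom_in_Hom: "p \<in> L \<Longrightarrow> mult_hom v p \<in> module_homs T B \<Omega> \<inter> extensional (carrier B)"
proof -
  assume p: "p \<in> L"
  note pp = L_polys[OF p]
  have "mult_hom v p (x \<oplus>\<^bsub>B\<^esub> y) = mult_hom v p x \<oplus>\<^bsub>\<Omega>\<^esub> mult_hom v p y" if "x \<in> carrier B" "y \<in> carrier B" for x y
    using that p pp by (auto simp: bp(4,7) mult_hom_apply polys_add polys_mult o(7) distrib_right)
  moreover have "mult_hom v p (t \<odot>\<^bsub>B\<^esub> x) = t \<odot>\<^bsub>\<Omega>\<^esub> mult_hom v p x" if "t \<in> carrier T" "x \<in> carrier B" for t x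
    using that p pp by (auto simp: q bp(4,8) mult_hom_apply polys_mult o(8) mult.assoc)
  moreover have "mult_hom v p x \<in> carrier \<Omega>" if "x \<in> carrier B" for x
    using that p pp by (auto simp: bp(4) o(4) mult_hom_apply polys_mult)
  ultimately show ?thesis by (auto simp: module_homs_def mult_hom_def)
qed

text \<open>\<open>B\<close> is cyclic, generated by the class of \<open>1\<close>, which \<open>A\<close> annihilates; so the value at it is annihilated by \<open>A\<close>.\<close>

lemma hom_determined_at_one:
  assumes \<phi>: "\<phi> \<in> module_homs T B \<Omega> \<inter> extensional (carrier B)" and p: "p \<in> polys n" "\<phi> (b 1) = v p"
  shows "p \<in> L \<and> \<phi> = mult_hom v p"
proof -
  have ev: "\<phi> (b w) = v (w * p)" if w: "w \<in> polys n" for w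
  proof -
    have "\<phi> (cls n J w \<odot>\<^bsub>B\<^esub> b 1) = cls n J w \<odot>\<^bsub>\<Omega>\<^esub> \<phi> (b 1)"
      using \<phi> w by (auto simp: module_homs_def q bp(4))
    then show ?thesis using w p by (simp add: bp(8) o(8))
  qed
  have "a * p \<in> J" if a: "a \<in> A" for a
  proof -
    note ap = hideal_subset[OF hideal_A a]
    have "b a = b 0" using bp(6)[OF ap, of 0] a by simp
    then have "v (a * p) = v 0" using ev[OF ap] ev[of 0] by simp
    then show ?thesis using o(6)[of "a * p" 0] ap p(1) by (simp add: polys_mult)
  qed
  then have pL: "p \<in> L" using p(1) by (simp add: L_def)
  have "\<phi> = mult_hom v p"
  proof (rule extensionalityI[of _ "carrier B"])
    show "\<phi> \<in> extensional (carrier B)" "mult_hom v p \<in> extensional (carrier B)" using \<phi> mult_hom_in_Hom[OF pL] by auto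
    fix x assume "x \<in> carrier B"
    then obtain w where "w \<in> polys n" "x = b w" by (auto simp: bp(4))
    then show "\<phi> x = mult_hom v p x" using ev mult_hom_apply[OF pL] by simp
  qed
  then show ?thesis using pL by blast
qed

lemma Hom_comp_eq: "Hom_comp T B \<Omega> k = mult_hom v ` (L \<inter> forms n (tau + k))"
proof (intro equalityI subsetI)
  fix \<phi> assume \<phi>: "\<phi> \<in> Hom_comp T B \<Omega> k"
  have "b 1 \<in> gcomp B 0" by (auto simp: bp(9))
  then have "\<phi> (b 1) \<in> gcomp \<Omega> (0 + k)" using \<phi> unfolding Hom_comp_def by blast
  then obtain p where p: "p \<in> polys n" "p \<in> forms n (tau + k)" "\<phi> (b 1) = v p" by (auto simp: o(9))
  have "\<phi> \<in> module_homs T B \<Omega> \<inter> extensional (carrier B)" using \<phi> by (simp add: Hom_comp_def)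
  from hom_determined_at_one[OF this p(1,3)] show "\<phi> \<in> mult_hom v ` (L \<inter> forms n (tau + k))" using p(2) by blast
next
  fix \<phi> assume "\<phi> \<in> mult_hom v ` (L \<inter> forms n (tau + k))"
  then obtain p where p: "p \<in> L" "p \<in> forms n (tau + k)" "\<phi> = mult_hom v p" by blast
  have "mult_hom v p x \<in> gcomp \<Omega> (i + k)" if x: "x \<in> gcomp B i" for x i
  proof -
    obtain w where w: "w \<in> polys n" "w \<in> forms n i" "x = b w" using x by (auto simp: bp(9))
    have "w * p \<in> forms n (tau + (i + k))" using forms_mult[OF w(2) p(2)] by (simp add: algebra_simps)
    then show ?thesis using w p(1) by (auto simp: mult_hom_apply o(9) forms_polys)
  qed
  then show "\<phi> \<in> Hom_comp T B \<Omega> k" using mult_hom_in_Hom[OF p(1)] p(3) by (auto simp: Hom_comp_def)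
qed

lemma presents_Hom: "presents n J (graded_Hom T B \<Omega>) (mult_hom v) L J tau"
proof -
  have b1: "b 1 \<in> carrier B" by (auto simp: bp(4))
  have carr: "carrier (graded_Hom T B \<Omega>) = mult_hom v ` L"
  proof (intro equalityI subsetI)
    fix \<phi> assume "\<phi> \<in> carrier (graded_Hom T B \<Omega>)"
    then have \<phi>: "\<phi> \<in> module_homs T B \<Omega> \<inter> extensional (carrier B)" by (simp add: graded_Hom_def)
    then have "\<phi> (b 1) \<in> carrier \<Omega>" using b1 by (auto simp: module_homs_def)
    then obtain p where "p \<in> polys n" "\<phi> (b 1) = v p" by (auto simp: o(4))
    from hom_determined_at_one[OF \<phi> this] show "\<phi> \<in> mult_hom v ` L" by blast
  next
    fix \<phi> assume "\<phi> \<in> mult_hom v ` L"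
    then obtain p where p: "p \<in> L" "\<phi> = mult_hom v p" by blast
    note pp = L_polys[OF p(1)]
    define F where "F = (\<lambda>j. j - tau) ` degrees p"
    define c where "c k = mult_hom v (hcomp (tau + k) p)" for k
    have fF: "finite F" by (simp add: F_def)
    have hL: "hcomp k p \<in> L" for k by (rule hideal_hcomp[OF hideal_L p(1)])
    have cc: "c k \<in> Hom_comp T B \<Omega> k" for k
      unfolding Hom_comp_eq c_def using hL hcomp_in_forms[OF pp] by blast
    have "\<phi> x = finsum \<Omega> (\<lambda>k. c k x) F" if x: "x \<in> carrier B" for x
    proof -
      obtain w where w: "w \<in> polys n" "x = b w" using x by (auto simp: bp(4))
      have "finsum \<Omega> (\<lambda>k. v (w * hcomp (tau + k) p)) F = v (\<Sum>k\<in>F. w * hcomp (tau + k) p)"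
        by (rule presents_finsum[OF J \<Omega> fF]) (intro polys_mult w L_polys hL)
      also have "(\<Sum>k\<in>F. w * hcomp (tau + k) p) = w * (\<Sum>j\<in>degrees p. hcomp j p)"
        unfolding F_def sum_distrib_left by (subst sum.reindex) (auto simp: inj_on_def)
      finally show ?thesis using sum_hcomp[of p] mult_hom_apply[OF p(1) w(1)] mult_hom_apply[OF hL w(1)]
        by (simp add: p(2) w(2) c_def)
    qed
    then have "\<exists>F c. finite F \<and> (\<forall>k\<in>F. c k \<in> Hom_comp T B \<Omega> k) \<and>
        (\<forall>x\<in>carrier B. \<phi> x = finsum \<Omega> (\<lambda>k. c k x) F)"
      using fF cc by (intro exI[of _ F] exI[of _ c]) blast
    then show "\<phi> \<in> carrier (graded_Hom T B \<Omega>)" using mult_hom_in_Hom[OF p(1)] p(2) by (simp add: graded_Hom_def)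
  qed
  have ext: "\<phi> = mult_hom v p" if "p \<in> L" "\<phi> \<in> extensional (carrier B)" "\<And>w. w \<in> polys n \<Longrightarrow> \<phi> (b w) = v (w * p)" for \<phi> p
    by (rule extensionalityI[of _ "carrier B"]) (use that mult_hom_in_Hom mult_hom_apply in \<open>auto simp: bp(4)\<close>)
  show ?thesis
    unfolding presents_def
  proof (intro conjI ballI allI)
    show "hideal n L" "hideal n J" by (rule hideal_L J)+
    show "J \<subseteq> L" using I_subset_L J_subset_I by blast
    show "carrier (graded_Hom T B \<Omega>) = mult_hom v ` L" by (rule carr)
    show "\<zero>\<^bsub>graded_Hom T B \<Omega>\<^esub> = mult_hom v 0"
      by (rule ext) (auto simp: graded_Hom_def hideal_0[OF hideal_L] o(5) bp(4))
    show "gcomp (graded_Hom T B \<Omega>) k = mult_hom v ` (L \<inter> forms n (tau + k))" for k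
      by (simp add: graded_Hom_def Hom_comp_eq)
  next
    fix p p' :: "'a mpoly" assume p: "p \<in> L" "p' \<in> L"
    note pp = L_polys[OF p(1)] L_polys[OF p(2)]
    show "(mult_hom v p = mult_hom v p') = (p - p' \<in> J)"
    proof
      assume "mult_hom v p = mult_hom v p'"
      then show "p - p' \<in> J" using mult_hom_apply[OF p(1), of 1] mult_hom_apply[OF p(2), of 1] o(6)[OF pp] by simp
    next
      assume d: "p - p' \<in> J"
      have "v (w * p) = v (w * p')" if w: "w \<in> polys n" for w
        using o(6)[of "w * p" "w * p'"] hideal_mult[OF J w d] pp w by (simp add: polys_mult right_diff_distrib)
      then show "mult_hom v p = mult_hom v p'" using mult_hom_in_Hom[OF p(1)] mult_hom_apply[OF p(1)] by (intro ext p) auto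
    qed
    show "mult_hom v p \<oplus>\<^bsub>graded_Hom T B \<Omega>\<^esub> mult_hom v p' = mult_hom v (p + p')"
      by (rule ext) (use p pp in \<open>auto simp: graded_Hom_def hideal_add[OF hideal_L] mult_hom_apply o(7) polys_mult distrib_left bp(4)\<close>)
  next
    fix w p :: "'a mpoly" assume w: "w \<in> polys n" and p: "p \<in> L"
    show "cls n J w \<odot>\<^bsub>graded_Hom T B \<Omega>\<^esub> mult_hom v p = mult_hom v (w * p)"
      by (rule ext) (use w p L_polys[OF p] in \<open>auto simp: graded_Hom_def hideal_mult[OF hideal_L] mult_hom_apply o(8) polys_mult bp(4) mult.left_commute\<close>)
  qed
qed

end

end

section \<open>Self-duality\<close>

context linked_ring
begin

definition pairing_functional :: "'a mpoly \<Rightarrow> 'a mpoly set \<Rightarrow> 'a" where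
  "pairing_functional p = (\<lambda>x\<in>cls n I ` L. pairing p (SOME q. q \<in> L \<and> cls n I q = x))"

lemma pairing_functional_extensional: "pairing_functional p \<in> extensional (cls n I ` L)" by (simp add: pairing_functional_def)

abbreviation "N \<equiv> shift H0 (tau + d)"
abbreviation "N_dual \<equiv> matlis_dual (\<lambda>c. cls n J (Const c)) N"

lemma presents_N: "presents n J N (cls n I) L I (tau + d)"
  using presents_shift[OF presents_H0, of "tau + d"] by simp

lemmas np = presents_props[OF J presents_N]

lemma pairing_functional_apply:
  assumes p: "p \<in> L" and v: "v \<in> L"
  shows "pairing_functional p (cls n I v) = pairing p v"
proof -
  define v' where "v' = (SOME u. u \<in> L \<and> cls n I u = cls n I v)"
  have v': "v' \<in> L \<and> cls n I v' = cls n I v" unfolding v'_def by (rule someI[of _ v]) (simp add: v)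
  then have "v' - v \<in> I" using np(6)[OF _ v] by blast
  then have "pairing p (v' - v) = 0" by (rule pairing_I_right[OF p])
  moreover have "pairing p (v' - v + v) = pairing p (v' - v) + pairing p v"
    by (rule pairing_add_right[OF p _ v]) (use v' v hideal_diff[OF hideal_L] in blast)
  ultimately have "pairing p v' = pairing p v" by simp
  then show ?thesis using v by (simp add: pairing_functional_def v'_def)
qed

text \<open>The Matlis dual in terms of representatives: a functional on \<open>L/I\<close> is evaluated on the classes of elements of \<open>L\<close>.\<close>

lemma N_dual_sel:
  "carrier N_dual = {\<phi> \<in> extensional (cls n I ` L).
     (\<forall>v\<in>L. \<forall>v'\<in>L. \<phi> (cls n I (v + v')) = \<phi> (cls n I v) + \<phi> (cls n I v')) \<and>
     (\<forall>c. \<forall>v\<in>L. \<phi> (cls n I (Const c * v)) = c * \<phi> (cls n I v)) \<and>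
     finite {k. \<exists>v\<in>L \<inter> forms n (tau + d + k). \<phi> (cls n I v) \<noteq> 0}}"
  "gcomp N_dual k = {\<phi> \<in> carrier N_dual. \<forall>j. j \<noteq> - k \<longrightarrow> (\<forall>v\<in>L \<inter> forms n (tau + d + j). \<phi> (cls n I v) = 0)}"
  "zero N_dual = (\<lambda>x\<in>cls n I ` L. 0)"
  "add N_dual = (\<lambda>\<phi> \<psi>. \<lambda>x\<in>cls n I ` L. \<phi> x + \<psi> x)"
  "module.smult N_dual = (\<lambda>t \<phi>. \<lambda>x\<in>cls n I ` L. \<phi> (t \<odot>\<^bsub>N\<^esub> x))"
  using np(7,8) by (auto simp: matlis_dual_def Let_def np(4,9))

lemma pairing_functional_in_dual:
  assumes p: "p \<in> L"
  shows "pairing_functional p \<in> carrier N_dual"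
    "p \<in> forms n k \<Longrightarrow> pairing_functional p \<in> gcomp N_dual k"
proof -
  have deg: "pairing p v = 0" if "v \<in> L" "v \<in> forms n (tau + d + k)" "- k \<notin> degrees p" for v k
  proof -
    have "pairing p v = pairing (\<Sum>i\<in>degrees p. hcomp i p) v" using sum_hcomp[of p] by simp
    also have "\<dots> = (\<Sum>i\<in>degrees p. pairing (hcomp i p) v)"
      by (rule pairing_sum_left[OF that(1) hideal_hcomp[OF hideal_L p]])
    also have "\<dots> = 0"
    proof (rule sum.neutral, rule ballI)
      fix i assume "i \<in> degrees p"
      then have "i \<noteq> - k" using that(3) by blast
      then show "pairing (hcomp i p) v = 0"
        by (intro pairing_degree[OF hideal_hcomp[OF hideal_L p] hcomp_in_forms[OF L_polys[OF p]] that(1,2)]) simp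
    qed
    finally show ?thesis .
  qed
  have "{k. \<exists>v\<in>L \<inter> forms n (tau + d + k). pairing_functional p (cls n I v) \<noteq> 0} \<subseteq> uminus ` degrees p"
  proof
    fix k assume "k \<in> {k. \<exists>v\<in>L \<inter> forms n (tau + d + k). pairing_functional p (cls n I v) \<noteq> 0}"
    then obtain v where v: "v \<in> L" "v \<in> forms n (tau + d + k)" "pairing p v \<noteq> 0" by (auto simp: pairing_functional_apply[OF p])
    then have "- k \<in> degrees p" using deg by blast
    then show "k \<in> uminus ` degrees p" by force
  qed
  then have "finite {k. \<exists>v\<in>L \<inter> forms n (tau + d + k). pairing_functional p (cls n I v) \<noteq> 0}"
    by (rule finite_subset) simp
  then show c: "pairing_functional p \<in> carrier N_dual"
    unfolding N_dual_sel(1)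
    by (auto simp: pairing_functional_apply[OF p] hideal_add[OF hideal_L] hideal_mult[OF hideal_L]
        pairing_add_right[OF p] pairing_scale_right[OF p] pairing_functional_extensional)
  show "pairing_functional p \<in> gcomp N_dual k" if pk: "p \<in> forms n k"
    unfolding N_dual_sel(2) using c pairing_degree[OF p pk] by (auto simp: pairing_functional_apply[OF p])
qed

lemma dual_represented_degree:
  assumes \<phi>: "\<phi> \<in> carrier N_dual"
  shows "\<exists>h. h \<in> L \<and> h \<in> forms n (- j) \<and> (\<forall>v. v \<in> L \<longrightarrow> v \<in> forms n (tau + d + j) \<longrightarrow> \<phi> (cls n I v) = pairing h v)"
proof -
  have add: "\<phi> (cls n I (v + v')) = \<phi> (cls n I v) + \<phi> (cls n I v')" if "v \<in> L" "v' \<in> L" for v v'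
    using \<phi> that unfolding N_dual_sel(1) by blast
  have scale: "\<phi> (cls n I (Const c * v)) = c * \<phi> (cls n I v)" if "v \<in> L" for v c
    using \<phi> that unfolding N_dual_sel(1) by blast
  define U where "U = L \<inter> forms n (tau + d + j)"
  have U: "ksubspace U" unfolding U_def by (intro ksubspace_Int ksubspace_forms ksubspace_hideal[OF hideal_L])
  obtain lam where lam: "klinear lam" "\<And>v. v \<in> U \<Longrightarrow> lam v = \<phi> (cls n I v)"
    by (rule extend_klinear[OF U, of "\<lambda>v. \<phi> (cls n I v)"]) (auto simp: U_def add scale)
  have "lam v = 0" if v: "v \<in> forms n (tau + d + j)" "v \<in> I" for v
  proof -
    have vL: "v \<in> L" using v(2) I_subset_L by blast
    have "cls n I v = cls n I (Const 0 * v)" using np(6)[OF vL hideal_0[OF hideal_L]] v(2) by simp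
    then have "\<phi> (cls n I v) = 0" using scale[OF vL, of 0] by simp
    then show ?thesis using lam(2)[of v] v(1) vL by (simp add: U_def)
  qed
  then obtain h where h: "h \<in> L" "h \<in> forms n (tau + d - (tau + d + j))"
      "\<forall>v. v \<in> L \<longrightarrow> v \<in> forms n (tau + d + j) \<longrightarrow> lam v = pairing h v"
    using pairing_represents[OF lam(1), of "tau + d + j"] by blast
  have "\<phi> (cls n I v) = pairing h v" if "v \<in> L" "v \<in> forms n (tau + d + j)" for v
    using h(3) lam(2)[of v] that by (simp add: U_def)
  then show ?thesis using h(1,2) by (intro exI[of _ h]) simp
qed

text \<open>The functional is represented in each degree separately. It is nonzero in finitely many degrees only, so the sum of the representatives makes sense; the pairing by degrees keeps them from interfering.\<close>

lemma dual_represented: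
  assumes \<phi>: "\<phi> \<in> carrier N_dual"
  obtains p where "p \<in> L" "\<phi> = pairing_functional p" "\<And>k. \<phi> \<in> gcomp N_dual k \<Longrightarrow> p \<in> forms n k"
proof -
  have add: "\<phi> (cls n I (v + v')) = \<phi> (cls n I v) + \<phi> (cls n I v')" if "v \<in> L" "v' \<in> L" for v v'
    using \<phi> that unfolding N_dual_sel(1) by blast
  have scale: "\<phi> (cls n I (Const c * v)) = c * \<phi> (cls n I v)" if "v \<in> L" for v c
    using \<phi> that unfolding N_dual_sel(1) by blast
  define F where "F = {k. \<exists>v\<in>L \<inter> forms n (tau + d + k). \<phi> (cls n I v) \<noteq> 0}"
  have fF: "finite F" using \<phi> unfolding N_dual_sel(1) F_def by blast
  obtain h where h: "\<And>j. h j \<in> L" "\<And>j. h j \<in> forms n (- j)"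
      "\<And>j v. v \<in> L \<Longrightarrow> v \<in> forms n (tau + d + j) \<Longrightarrow> \<phi> (cls n I v) = pairing (h j) v"
    using dual_represented_degree[OF \<phi>] by metis
  define p where "p = (\<Sum>j\<in>F. h j)"
  have p: "p \<in> L" unfolding p_def by (rule hideal_sum[OF hideal_L h(1)])
  have form: "\<phi> (cls n I v) = pairing p v" if v: "v \<in> L" "v \<in> forms n i" for v i
  proof -
    have "pairing p v = (\<Sum>j\<in>F. pairing (h j) v)" unfolding p_def by (rule pairing_sum_left[OF v(1) h(1)])
    also have "\<dots> = (\<Sum>j\<in>F. if j = i - (tau + d) then \<phi> (cls n I v) else 0)"
    proof (rule sum.cong)
      fix j show "pairing (h j) v = (if j = i - (tau + d) then \<phi> (cls n I v) else 0)"
        using pairing_degree[OF h(1)[of j] h(2)[of j] v] h(3)[OF v(1), of j] v(2) by auto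
    qed simp
    also have "\<dots> = \<phi> (cls n I v)"
    proof (cases "i - (tau + d) \<in> F")
      case False
      then have "\<phi> (cls n I v) = 0" using v by (auto simp: F_def)
      then show ?thesis by (subst sum.neutral) auto
    qed (simp add: fF)
    finally show ?thesis by simp
  qed
  have sum: "\<phi> (cls n I (\<Sum>i\<in>X. g i)) = (\<Sum>i\<in>X. \<phi> (cls n I (g i)))" if "\<And>i. g i \<in> L" "finite X"
    for g and X :: "int set"
    using that(2)
  proof (induction X rule: finite_induct)
    case empty
    show ?case using scale[OF hideal_0[OF hideal_L], of 0] by simp
  next
    case (insert x X)
    have "(\<Sum>i\<in>X. g i) \<in> L" by (rule hideal_sum[OF hideal_L that(1)])
    then show ?case using insert add[OF that(1)[of x]] by simp
  qed
  have "\<phi> = pairing_functional p"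
  proof (rule extensionalityI[of _ "cls n I ` L"])
    show "\<phi> \<in> extensional (cls n I ` L)" using \<phi> unfolding N_dual_sel(1) by blast
    show "pairing_functional p \<in> extensional (cls n I ` L)" by (rule pairing_functional_extensional)
    fix x assume "x \<in> cls n I ` L"
    then obtain v where v: "v \<in> L" "x = cls n I v" by blast
    have hv: "hcomp i v \<in> L" for i by (rule hideal_hcomp[OF hideal_L v(1)])
    have "\<phi> (cls n I (\<Sum>i\<in>degrees v. hcomp i v)) = (\<Sum>i\<in>degrees v. \<phi> (cls n I (hcomp i v)))"
      by (rule sum[OF hv]) simp
    also have "\<dots> = (\<Sum>i\<in>degrees v. pairing p (hcomp i v))"
      by (rule sum.cong) (simp_all add: form[OF hv hcomp_in_forms[OF L_polys[OF v(1)]]])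
    also have "\<dots> = pairing p (\<Sum>i\<in>degrees v. hcomp i v)"
      by (rule pairing_sum_right[OF p hv, symmetric])
    finally show "\<phi> x = pairing_functional p x" using sum_hcomp[of v] pairing_functional_apply[OF p v(1)] v(2) by simp
  qed
  moreover have "p \<in> forms n k" if k: "\<phi> \<in> gcomp N_dual k" for k
    unfolding p_def
  proof (rule forms_sum)
    fix j assume "j \<in> F"
    then have "j = - k" using k unfolding N_dual_sel(2) F_def by blast
    then show "h j \<in> forms n k" using h(2)[of j] by simp
  qed
  ultimately show thesis using that p by blast
qed

lemma presents_dual: "presents n J N_dual pairing_functional L I 0"
proof -
  have ext: "\<phi> = pairing_functional p" if "p \<in> L" "\<phi> \<in> extensional (cls n I ` L)" "\<And>v. v \<in> L \<Longrightarrow> \<phi> (cls n I v) = pairing p v" for \<phi> p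
    by (rule extensionalityI[of _ "cls n I ` L"]) (use that pairing_functional_extensional in \<open>auto simp: pairing_functional_apply\<close>)
  show ?thesis
    unfolding presents_def
  proof (intro conjI ballI allI)
    show "hideal n L" "hideal n I" "I \<subseteq> L" by (rule hideal_L hideal_I I_subset_L)+
    show "carrier N_dual = pairing_functional ` L"
      using pairing_functional_in_dual(1) dual_represented by blast
    show "\<zero>\<^bsub>N_dual\<^esub> = pairing_functional 0"
      by (rule ext) (auto simp: N_dual_sel(3) hideal_0[OF hideal_L] pairing_0_left)
    show "gcomp N_dual k = pairing_functional ` (L \<inter> forms n (0 + k))" for k
    proof (intro equalityI subsetI)
      fix \<phi> assume \<phi>: "\<phi> \<in> gcomp N_dual k"
      then have "\<phi> \<in> carrier N_dual" by (simp add: N_dual_sel(2))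
      then obtain p where "p \<in> L" "\<phi> = pairing_functional p" "p \<in> forms n k" using dual_represented \<phi> by metis
      then show "\<phi> \<in> pairing_functional ` (L \<inter> forms n (0 + k))" by simp
    next
      fix \<phi> assume "\<phi> \<in> pairing_functional ` (L \<inter> forms n (0 + k))"
      then show "\<phi> \<in> gcomp N_dual k" using pairing_functional_in_dual(2) by auto
    qed
  next
    fix p p' :: "'a mpoly" assume p: "p \<in> L" "p' \<in> L"
    have diffL: "p - p' \<in> L" by (rule hideal_diff[OF hideal_L p])
    have diff: "pairing (p - p') v = pairing p v - pairing p' v" if "v \<in> L" for v
      using pairing_add_left[OF diffL p(2) that] by simp
    show "(pairing_functional p = pairing_functional p') = (p - p' \<in> I)"
    proof
      assume eq: "pairing_functional p = pairing_functional p'"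
      show "p - p' \<in> I"
      proof (rule pairing_nondegenerate[OF diffL])
        fix v assume v: "v \<in> L"
        show "pairing (p - p') v = 0"
          using diff[OF v] pairing_functional_apply[OF p(1) v] pairing_functional_apply[OF p(2) v] eq by simp
      qed
    next
      assume "p - p' \<in> I"
      then have "pairing p v = pairing p' v" if "v \<in> L" for v
        using diff[OF that] pairing_I_left[OF _ that, of "p - p'"] by simp
      then show "pairing_functional p = pairing_functional p'" by (intro ext p) (simp_all add: pairing_functional_apply p pairing_functional_extensional)
    qed
    show "pairing_functional p \<oplus>\<^bsub>N_dual\<^esub> pairing_functional p' = pairing_functional (p + p')"
      by (rule ext) (use p in \<open>auto simp: N_dual_sel(4) hideal_add[OF hideal_L] pairing_functional_apply pairing_add_left\<close>)
  next
    fix w p :: "'a mpoly" assume w: "w \<in> polys n" and p: "p \<in> L"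
    show "cls n J w \<odot>\<^bsub>N_dual\<^esub> pairing_functional p = pairing_functional (w * p)"
      by (rule ext) (use w p in \<open>auto simp: N_dual_sel(5) hideal_mult[OF hideal_L] pairing_functional_apply pairing_mult np(8)\<close>)
  qed
qed

lemma N_dual_isomorphic: "graded_isomorphic T N_dual H0"
  by (rule presents_isomorphic[OF J graded_T presents_dual presents_H0])

lemma short_exact:
  assumes \<Omega>: "is_graded_module T \<Omega>" "graded_isomorphic T \<Omega> (shift (ring_as_module (\<lambda>t. t) T) tau)"
  shows "\<exists>\<phi> \<psi>. graded_short_exact T (shift B (tau - d)) (graded_Hom T B \<Omega>) (shift H0 tau) \<phi> \<psi>"
proof -
  have "presents n J (shift (ring_as_module (\<lambda>t. t) T) tau) (cls n J) (polys n) J tau"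
    using presents_shift[OF presents_quotient_ring[OF J cring_T], of tau] by simp
  then obtain v where v: "presents n J \<Omega> v (polys n) J tau"
    using presents_transfer[OF J _ \<Omega>] by blast
  have 1: "presents n J (shift B (tau - d)) b (polys n) A (tau - d)"
    using presents_shift[OF presents_B, of "tau - d"] by simp
  have 2: "presents n J (graded_Hom T B \<Omega>) (mult_hom v) L J (tau - d + d)"
    using presents_Hom[OF v] by simp
  have 3: "presents n J (shift H0 tau) (cls n I) L I (tau - d + d)"
    using presents_shift[OF presents_H0, of tau] by simp
  show ?thesis
  proof (rule presents_short_exact[OF J graded_T 1 2 3 f])
    show "f * p \<in> L" if "p \<in> polys n" for p using adjoin_self[OF J that, of f] I_subset_L by blast
    show "f * p \<in> J \<longleftrightarrow> p \<in> A" if "p \<in> polys n" for p using that by (simp add: A_iff mult.commute)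
    show "J \<subseteq> I" by (rule J_subset_I)
    show "p \<in> I \<longleftrightarrow> (\<exists>q\<in>polys n. p - f * q \<in> J)" for p by (simp add: adjoin_iff)
  qed
qed

end

section \<open>The theorem\<close>

text \<open>Only the positivity of the degrees is not immediate. A form of degree \<open>0\<close> is a constant: if it is not zero, it generates the unit ideal, and
if it is zero, then it is a nonzerodivisor only modulo the unit ideal. Neither can happen, as a regular sequence
generates a proper ideal.\<close>

lemma regular_sequence_regular_forms:
  fixes fs :: "('k::field mpoly \<times> nat) list"
  assumes forms: "\<And>p. p \<in> set fs \<Longrightarrow> fst p \<in> forms n (int (snd p))"
    and regular: "regular_sequence (poly_ring n) (map fst fs)"
  shows "regular_forms n {0} fs"
proof -
  have Idl: "Idl\<^bsub>poly_ring n\<^esub> (set (take k (map fst fs))) = adjoin_all n {0} (take k fs) \<and>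
      hideal n (adjoin_all n {0} (take k fs))" for k
  proof -
    have ex: "\<exists>d. f \<in> forms n d" if f: "f \<in> set (take k (map fst fs))" for f
    proof -
      obtain p where "p \<in> set fs" "f = fst p" using f by (auto dest!: in_set_takeD)
      then show ?thesis using forms[of p] by blast
    qed
    show ?thesis using Idl_forms[of "take k (map fst fs)" n, OF ex] by (simp add: adjoin_all_def take_map)
  qed
  have proper: "1 \<notin> adjoin_all n {0} fs"
  proof
    assume one: "1 \<in> adjoin_all n {0} fs"
    have h: "hideal n (adjoin_all n {0} fs)" using Idl[of "length fs"] by simp
    have "adjoin_all n {0} fs = polys n"
      using hideal_mult[OF h _ one] hideal_subset[OF h] by auto
    then show False using regular Idl[of "length fs"] by (simp add: regular_sequence_def)
  qed
  have mono: "adjoin_all n {0} (take k fs) \<subseteq> adjoin_all n {0} fs" for k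
  proof -
    interpret cring "poly_ring n :: 'k mpoly graded_ring" by (rule cring_poly_ring)
    have sub: "set (map fst fs) \<subseteq> carrier (poly_ring n)" using forms forms_polys by fastforce
    have "Idl\<^bsub>poly_ring n\<^esub> (set (take k (map fst fs))) \<subseteq> Idl\<^bsub>poly_ring n\<^esub> (set (map fst fs))"
      by (rule genideal_minimal[OF genideal_ideal[OF sub]])
         (use genideal_self[OF sub] set_take_subset[of k "map fst fs"] in blast)
    then show ?thesis using Idl[of k] Idl[of "length fs"] by simp
  qed
  have "regular_forms n {0} (take k fs)" if "k \<le> length fs" for k
    using that
  proof (induction k)
    case (Suc k)
    then have k: "k < length fs" by simp
    define Q where "Q = adjoin_all n {0} (take k fs)"
    have Q: "hideal n Q" using Idl[of k] by (simp add: Q_def)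
    have f: "fst (fs ! k) \<in> forms n (int (snd (fs ! k)))" using forms k by simp
    have "\<forall>a\<in>polys n. fst (fs ! k) * a \<in> Q \<longrightarrow> a \<in> Q"
    proof -
      have "\<forall>a\<in>polys n. fst (fs ! k) * a \<in> Idl\<^bsub>poly_ring n\<^esub> (set (take k (map fst fs))) \<longrightarrow>
          a \<in> Idl\<^bsub>poly_ring n\<^esub> (set (take k (map fst fs)))"
        using regular k by (simp add: regular_sequence_def)
      then show ?thesis by (simp only: Idl[of k, THEN conjunct1] Q_def)
    qed
    then have nonzerodiv: "nonzerodiv n Q (fst (fs ! k))" by (simp add: nonzerodiv_def)
    have "snd (fs ! k) > 0"
    proof (rule ccontr)
      assume "\<not> snd (fs ! k) > 0"
      then obtain c where c: "fst (fs ! k) = Const c" using form_0_Const f by fastforce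
      have "1 \<in> adjoin_all n {0} (take (Suc k) fs)"
      proof (cases "c = 0")
        case True
        then have "1 \<in> Q" using nonzerodiv c hideal_0[OF Q] by (simp add: nonzerodiv_def)
        then show ?thesis using adjoin_mono[OF Q] k by (auto simp: take_Suc_conv_app_nth adjoin_all_snoc Q_def)
      next
        case False
        have "Const c * Const (inverse c) \<in> adjoin n Q (Const c)" by (rule adjoin_self[OF Q Const_polys])
        moreover have "Const c * Const (inverse c) = 1" using False by (simp flip: Const_mult)
        ultimately show ?thesis using k c by (simp add: take_Suc_conv_app_nth adjoin_all_snoc Q_def)
      qed
      then show False using proper mono by blast
    qed
    then show ?case using Suc f nonzerodiv k by (simp add: take_Suc_conv_app_nth regular_forms_snoc Q_def)
  qed simp
  from this[of "length fs"] show ?thesis by simp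
qed

theorem theorem4p6:
  fixes n :: nat
    and f :: "nat \<Rightarrow> 'k::alg_closed_field mpoly"
    and d :: "nat \<Rightarrow> nat"
    and \<Omega> :: "('k mpoly set, 'w) graded_module"
  defines "S \<equiv> poly_ring n :: 'k mpoly graded_ring"
  defines "S_plus \<equiv> Idl\<^bsub>S\<^esub> (Var ` {0..n})"
  defines "I \<equiv> Idl\<^bsub>S\<^esub> (f ` {0..n})"
  defines "J \<equiv> Idl\<^bsub>S\<^esub> (f ` {1..n})"
  defines "R \<equiv> graded_quotient S I"
  defines "T \<equiv> graded_quotient S J"
  defines "T_plus \<equiv> irrelevant_ideal T"
  defines "H \<equiv> (\<lambda>p. J +>\<^bsub>S\<^esub> p) ` saturation S S_plus I"
  defines "K \<equiv> ann T H"
  defines "B \<equiv> ring_as_module (\<lambda>t. K +>\<^bsub>T\<^esub> t) (graded_quotient T K)"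
  \<comment> \<open>the surjection \<open>T \<rightarrow> R\<close> sends the coset \<open>t = p + J\<close> to \<open>p + I = I + t\<close>\<close>
  defines "R_T \<equiv> ring_as_module (\<lambda>t. I <+>\<^bsub>S\<^esub> t) R"
  defines "H0 \<equiv> local_cohomology_0 T T_plus R_T"
  defines "\<tau> \<equiv> (\<Sum>i=1..n. int (d i)) - int n - 1"
  assumes "n \<ge> 1"
    and "\<And>i. i \<le> n \<Longrightarrow> f i \<in> rcomp S (int (d i))"
    and "regular_sequence S (map f [1..<Suc n])"
    and "krull_dim (Proj_topology R) = 0"
    and "is_graded_module T \<Omega>"
    and "graded_isomorphic T \<Omega> (shift (ring_as_module (\<lambda>t. t) T) \<tau>)"
  shows "(\<exists>\<phi> \<psi>. graded_short_exact T
             (shift B (\<tau> - int (d 0))) (graded_Hom T B \<Omega>) (shift H0 \<tau>) \<phi> \<psi>)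
       \<and> graded_isomorphic T
             (matlis_dual (\<lambda>c. J +>\<^bsub>S\<^esub> Const c) (shift H0 (\<tau> + int (d 0)))) H0"
proof -
  \<comment> \<open>each generator is listed with its degree\<close>
  define fs where "fs = map (\<lambda>i. (f i, d i)) [1..<Suc n]"
  have forms: "f i \<in> forms n (int (d i))" if "i \<le> n" for i
    using assms(15)[OF that] by (simp add: S_def)
  have fst_fs: "map fst fs = map f [1..<Suc n]" by (simp add: fs_def comp_def del: upt_Suc)
  have set_fs: "set (map f [1..<Suc n]) = f ` {1..n}" by (auto simp del: upt_Suc)
  have regular_forms: "regular_forms n {0} fs"
  proof (rule regular_sequence_regular_forms)
    show "regular_sequence (poly_ring n) (map fst fs)" using assms(16) by (simp only: fst_fs S_def)
    show "fst p \<in> forms n (int (snd p))" if "p \<in> set fs" for p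
      using that forms by (auto simp: fs_def simp del: upt_Suc)
  qed
  have len: "length fs = n" by (simp add: fs_def)
  have J_adjoin_all: "J = adjoin_all n {0} fs"
  proof -
    have "\<exists>e. g \<in> forms n e" if "g \<in> set (map f [1..<Suc n])" for g
    proof -
      have "g \<in> f ` {..n}" using \<open>g \<in> _\<close> by (auto simp: less_Suc_eq_le simp del: upt_Suc)
      then obtain i where "i \<le> n" "g = f i" by blast
      then show ?thesis using forms by blast
    qed
    from Idl_forms[of "map f [1..<Suc n]" n, OF this, THEN conjunct1] show ?thesis
      by (simp only: J_def S_def adjoin_all_def fst_fs set_fs)
  qed
  have hJ: "hideal n J" unfolding J_adjoin_all by (rule hideal_adjoin_all[OF hideal_zero regular_forms])
  have I_adjoin: "I = adjoin n J (f 0)"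
  proof -
    have eq: "set (map f [1..<Suc n] @ [f 0]) = f ` {0..n}"
    proof -
      have "{0..n} = insert 0 {1..n}" by auto
      then show ?thesis by (simp only: set_append set_fs) auto
    qed
    have "\<exists>e. g \<in> forms n e" if "g \<in> set (map f [1..<Suc n] @ [f 0])" for g
    proof -
      have "g \<in> f ` {..n}" using \<open>g \<in> _\<close> by (auto simp: less_Suc_eq_le simp del: upt_Suc)
      then obtain i where "i \<le> n" "g = f i" by blast
      then show ?thesis using forms by blast
    qed
    from Idl_forms[of "map f [1..<Suc n] @ [f 0]" n, OF this, THEN conjunct1] show ?thesis
      by (simp only: I_def S_def eq J_adjoin_all adjoin_all_def fst_fs foldl_append foldl.simps)
  qed
  have inf: "infinite (UNIV :: 'k set)" by (rule infinite_alg_closed_field)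
  obtain l where l: "l \<in> forms n 1" "nonzerodiv n J l"
    using common_linear_nonzerodiv[OF inf hJ _ hJ] regular_sequence_depth[OF inf regular_forms len]
    by (auto simp: J_adjoin_all)
  \<comment> \<open>\<open>f\<^sub>1, \<dots>, f\<^sub>n, l\<^sup>M\<close> is a regular sequence, and the sum of its degrees minus \<open>n + 1\<close> is \<open>\<tau> + M\<close>\<close>
  have gor: "socle_type n True (adjoin n J (l ^ M)) (\<tau> + int M)" if M: "M \<ge> 1" for M
  proof -
    have lM: "l ^ M \<in> forms n (int M)" using forms_power[OF l(1), of M] by simp
    have "regular_forms n {0} (fs @ [(l ^ M, M)])"
      using regular_forms lM M nonzerodiv_power[OF forms_polys[OF l(1)] l(2), of M] by (simp add: regular_forms_snoc J_adjoin_all)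
    from complete_intersection_gorenstein[OF inf this]
    have G: "socle_type n True (adjoin n J (l ^ M)) (\<Sum>p\<leftarrow>fs @ [(l ^ M, M)]. int (snd p) - 1)"
      by (simp add: len adjoin_all_snoc J_adjoin_all)
    have "(\<Sum>p\<leftarrow>fs @ [(l ^ M, M)]. int (snd p) - 1) = \<tau> + int M"
    proof -
      have "(\<Sum>p\<leftarrow>fs. int (snd p) - 1) = (\<Sum>i=1..n. int (d i) - 1)"
        by (simp add: fs_def comp_def interv_sum_list_conv_sum_set_nat atLeastLessThanSuc_atLeastAtMost del: upt_Suc)
      also have "\<dots> = (\<Sum>i=1..n. int (d i)) - int n" by (simp add: sum_subtractf)
      finally show ?thesis by (simp add: \<tau>_def)
    qed
    from G[unfolded this] show ?thesis .
  qed
  have gT: "is_graded_ring (quo n J)"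
    using assms(18) by (simp add: is_graded_module_def T_def S_def)
  interpret lr: linked_ring n J "f 0" l "int (d 0)" \<tau>
    by unfold_locales (use hJ forms l gor gT in auto)
  have T: "T = quo n J" by (simp add: T_def S_def)
  have "H = cls n J ` lr.L"
    using lr.saturation_eq by (simp add: H_def S_plus_def S_def I_adjoin)
  then have K: "K = cls n J ` lr.A" using lr.ann_eq by (simp add: K_def T)
  have B: "B = lr.B" by (simp add: B_def lr.B_def K T)
  have H0: "H0 = lr.H0" by (simp add: H0_def lr.H0_def T_plus_def R_T_def lr.R_def R_def T I_adjoin S_def)
  show ?thesis
    using lr.short_exact[of \<Omega>] assms(18,19) lr.N_dual_isomorphic
    by (simp add: T B H0 S_def)
qed

end
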